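(* Let $F$ be a field of characteristic different from two. In dimension $6$ the nilpotent Lie algebras over $F$ are, up to isomorphism, the following, where $\epsilon\in F$ (with basis $e_1,\ldots,e_6$ where products are given): $L_{6,k}=L_{5,k}\oplus I$ for $k=1,\ldots,9$; $L_{6,10}$: $[e_1,e_2]=e_3$, $[e_1,e_3]=e_6$, $[e_4,e_5]=e_6$; $L_{6,11}$: $[e_1,e_2]=e_3$, $[e_1,e_3]=e_4$, $[e_1,e_4]=e_6$, $[e_2,e_3]=e_6$, $[e_2,e_5]=e_6$; $L_{6,12}$: $[e_1,e_2]=e_3$, $[e_1,e_3]=e_4$, $[e_1,e_4]=e_6$, $[e_2,e_5]=e_6$; $L_{6,13}$: $[e_1,e_2]=e_3$, $[e_1,e_3]=e_5$, $[e_2,e_4]=e_5$, $[e_1,e_5]=e_6$, $[e_3,e_4]=e_6$; $L_{6,14}$: $[e_1,e_2]=e_3$, $[e_1,e_3]=e_4$, $[e_1,e_4]=e_5$, $[e_2,e_3]=e_5$, $[e_2,e_5]=e_6$, $[e_3,e_4]=-e_6$; $L_{6,15}$: $[e_1,e_2]=e_3$, $[e_1,e_3]=e_4$, $[e_1,e_4]=e_5$, $[e_2,e_3]=e_5$, $[e_1,e_5]=e_6$, $[e_2,e_4]=e_6$; $L_{6,16}$: $[e_1,e_2]=e_3$, $[e_1,e_3]=e_4$, $[e_1,e_4]=e_5$, $[e_2,e_5]=e_6$, $[e_3,e_4]=-e_6$; $L_{6,17}$: $[e_1,e_2]=e_3$, $[e_1,e_3]=e_4$, $[e_1,e_4]=e_5$,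 $[e_1,e_5]=e_6$, $[e_2,e_3]=e_6$; $L_{6,18}$: $[e_1,e_2]=e_3$, $[e_1,e_3]=e_4$, $[e_1,e_4]=e_5$, $[e_1,e_5]=e_6$; $L_{6,19}(\epsilon)$: $[e_1,e_2]=e_4$, $[e_1,e_3]=e_5$, $[e_2,e_4]=e_6$, $[e_3,e_5]=\epsilon e_6$; $L_{6,20}$: $[e_1,e_2]=e_4$, $[e_1,e_3]=e_5$, $[e_1,e_5]=e_6$, $[e_2,e_4]=e_6$; $L_{6,21}(\epsilon)$: $[e_1,e_2]=e_3$, $[e_1,e_3]=e_4$, $[e_2,e_3]=e_5$, $[e_1,e_4]=e_6$, $[e_2,e_5]=\epsilon e_6$; $L_{6,22}(\epsilon)$: $[e_1,e_2]=e_5$, $[e_1,e_3]=e_6$, $[e_2,e_4]=\epsilon e_6$, $[e_3,e_4]=e_5$; $L_{6,23}$: $[e_1,e_2]=e_3$, $[e_1,e_3]=e_5$, $[e_1,e_4]=e_6$, $[e_2,e_4]=e_5$; $L_{6,24}(\epsilon)$: $[e_1,e_2]=e_3$, $[e_1,e_3]=e_5$, $[e_1,e_4]=\epsilon e_6$, $[e_2,e_3]=e_6$, $[e_2,e_4]=e_5$; $L_{6,25}$: $[e_1,e_2]=e_3$, $[e_1,e_3]=e_5$, $[e_1,e_4]=e_6$; and $L_{6,26}$: $[e_1,e_2]=e_4$, $[e_1,e_3]=e_5$, $[e_2,e_3]=e_6$. Of these, $L_{6,1}$, $L_{6,2}$, $L_{6,4}$, $L_{6,8}$, $L_{6,22}(\epsilon)$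 and $L_{6,26}$ are CB-algebras, but the others are not.
   Context: A Lie algebra $L$ is a CB-algebra if, whenever $x,y\in L$ satisfy $[x,y]=0$, then $[[x,z],y]=0$ for all $z\in L$. $I$ denotes a one-dimensional ideal (a one-dimensional abelian algebra) and $\oplus$ is the algebra direct sum. Only non-zero products of basis elements are listed, with $[e_j,e_i]=-[e_i,e_j]$ understood. The five-dimensional algebras are: $L_{5,1}$ abelian; $L_{5,2}=L_{3,2}\oplus I\oplus I$ where $L_{3,2}$ has basis $e_1,e_2,e_3$ and $[e_1,e_2]=e_3$; $L_{5,3}=L_{4,3}\oplus I$ where $L_{4,3}$ has basis $e_1,\ldots,e_4$ and $[e_1,e_2]=e_3$, $[e_1,e_3]=e_4$; and, with basis $e_1,\ldots,e_5$: $L_{5,4}$: $[e_1,e_2]=e_5$, $[e_3,e_4]=e_5$; $L_{5,5}$: $[e_1,e_2]=e_3$, $[e_1,e_3]=e_5$, $[e_2,e_4]=e_5$; $L_{5,6}$: $[e_1,e_2]=e_3$, $[e_1,e_3]=e_4$, $[e_1,e_4]=e_5$, $[e_2,e_3]=e_5$; $L_{5,7}$: $[e_1,e_2]=e_3$, $[e_1,e_3]=e_4$, $[e_1,e_4]=e_5$; $L_{5,8}$: $[e_1,e_2]=e_4$, $[e_1,e_3]=e_5$; $L_{5,9}$: $[e_1,e_2]=e_3$, $[e_1,e_3]=e_4$, $[e_2,e_3]=e_5$. *)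

theory Defs
  imports "HOL-Analysis.Analysis"
begin

record ('a, 'v) lie =
  scl :: "'a \<Rightarrow> 'v \<Rightarrow> 'v"
  brk :: "'v \<Rightarrow> 'v \<Rightarrow> 'v"

locale lie_algebra = vector_space "scl L" for L :: "('a::field, 'v::ab_group_add) lie" +
  assumes brk_linear_left: "Vector_Spaces.linear (scl L) (scl L) (\<lambda>x. brk L x y)"
    and brk_linear_right: "Vector_Spaces.linear (scl L) (scl L) (\<lambda>y. brk L x y)"
    and brk_alternating: "brk L x x = 0"
    and jacobi: "brk L (brk L x y) z + brk L (brk L y z) x + brk L (brk L z x) y = 0"

primrec lower_central :: "('a::field, 'v::ab_group_add) lie \<Rightarrow> nat \<Rightarrow> 'v set" where
  "lower_central L 0 = UNIV"
| "lower_central L (Suc n) =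
     module.span (scl L) {brk L x y | x y. y \<in> lower_central L n}"

definition nilpotent_lie :: "('a::field, 'v::ab_group_add) lie \<Rightarrow> bool" where
  "nilpotent_lie L \<longleftrightarrow> (\<exists>n. lower_central L n = {0})"

text \<open>The library gives infinite-dimensional spaces dimension 0, so for positive \<open>n\<close> the last
  condition includes finite-dimensionality.\<close>

definition nilpotent_lie_of_dim :: "nat \<Rightarrow> ('a::field, 'v::ab_group_add) lie \<Rightarrow> bool" where
  "nilpotent_lie_of_dim n L \<longleftrightarrow>
     lie_algebra L \<and> nilpotent_lie L \<and> vector_space.dim (scl L) UNIV = n"

definition CB_algebra :: "('a::field, 'v::ab_group_add) lie \<Rightarrow> bool" where
  "CB_algebra L \<longleftrightarrow> (\<forall>x y. brk L x y = 0 \<longrightarrow> (\<forall>z. brk L (brk L x z) y = 0))"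

definition lie_isomorphic ::
    "('a::field, 'v::ab_group_add) lie \<Rightarrow> ('a, 'w::ab_group_add) lie \<Rightarrow> bool"
    (infix \<open>\<cong>\<^sub>L\<close> 50) where
  "L \<cong>\<^sub>L M \<longleftrightarrow>
     (\<exists>f. Vector_Spaces.linear (scl L) (scl M) f \<and> bij f \<and>
          (\<forall>x y. f (brk L x y) = brk M (f x) (f y)))"

definition lie_sum ::
    "('a::field, 'v::ab_group_add) lie \<Rightarrow> ('a, 'w::ab_group_add) lie \<Rightarrow> ('a, 'v \<times> 'w) lie"
    (infixl \<open>\<oplus>\<^sub>L\<close> 65) where
  "L \<oplus>\<^sub>L M =
     \<lparr>scl = (\<lambda>c x. (scl L c (fst x), scl M c (snd x))),
      brk = (\<lambda>x y. (brk L (fst x) (fst y), brk M (snd x) (snd y)))\<rparr>"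

text \<open>The one-dimensional abelian algebra \<open>I\<close>.\<close>

definition line :: "('a::field, 'a) lie" where
  "line = \<lparr>scl = (*), brk = (\<lambda>x y. 0)\<rparr>"

text \<open>Basis vectors are numbered by the numerals of the index type. These are read modulo its size,
  so in dimension \<open>n\<close> the numerals \<open>1, \<dots>, n\<close> name the \<open>n\<close> indices, with \<open>n = 0\<close>.\<close>

definition e :: "'n::finite \<Rightarrow> 'a::field^'n" where
  "e i = axis i 1"

text \<open>An entry \<open>(i, j, v)\<close> stands for the product \<open>[e i, e j] = v\<close>, and hence \<open>[e j, e i] = - v\<close>; the
  bracket is the bilinear extension, products of basis vectors not listed in either order being 0.\<close>

definition lie_of_products :: "('n::finite \<times> 'n \<times> ('a^'n)) list \<Rightarrow> ('a::field, 'a^'n) lie" where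
  "lie_of_products ps =
     \<lparr>scl = (*s),
      brk = (\<lambda>x y. \<Sum>(i, j, v)\<leftarrow>ps. (x $ i * y $ j - x $ j * y $ i) *s v)\<rparr>"

definition L_3_2 :: "('a::field, 'a^3) lie" where
  "L_3_2 = lie_of_products [(1, 2, e 3)]"

definition L_4_3 :: "('a::field, 'a^4) lie" where
  "L_4_3 = lie_of_products [(1, 2, e 3), (1, 3, e 4)]"

definition L_5_1 :: "('a::field, 'a^5) lie" where
  "L_5_1 = lie_of_products []"

definition L_5_2 :: "('a::field, (('a^3) \<times> 'a) \<times> 'a) lie" where
  "L_5_2 = L_3_2 \<oplus>\<^sub>L line \<oplus>\<^sub>L line"

definition L_5_3 :: "('a::field, ('a^4) \<times> 'a) lie" where
  "L_5_3 = L_4_3 \<oplus>\<^sub>L line"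

definition L_5_4 :: "('a::field, 'a^5) lie" where
  "L_5_4 = lie_of_products
    [(1, 2, e 5), (3, 4, e 5)]"

definition L_5_5 :: "('a::field, 'a^5) lie" where
  "L_5_5 = lie_of_products
    [(1, 2, e 3), (1, 3, e 5), (2, 4, e 5)]"

definition L_5_6 :: "('a::field, 'a^5) lie" where
  "L_5_6 = lie_of_products
    [(1, 2, e 3), (1, 3, e 4), (1, 4, e 5), (2, 3, e 5)]"

definition L_5_7 :: "('a::field, 'a^5) lie" where
  "L_5_7 = lie_of_products
    [(1, 2, e 3), (1, 3, e 4), (1, 4, e 5)]"

definition L_5_8 :: "('a::field, 'a^5) lie" where
  "L_5_8 = lie_of_products
    [(1, 2, e 4), (1, 3, e 5)]"

definition L_5_9 :: "('a::field, 'a^5) lie" where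
  "L_5_9 = lie_of_products
    [(1, 2, e 3), (1, 3, e 4), (2, 3, e 5)]"

definition L_6_1 :: "('a::field, ('a^5) \<times> 'a) lie" where
  "L_6_1 = L_5_1 \<oplus>\<^sub>L line"

definition L_6_2 :: "('a::field, ((('a^3) \<times> 'a) \<times> 'a) \<times> 'a) lie" where
  "L_6_2 = L_5_2 \<oplus>\<^sub>L line"

definition L_6_3 :: "('a::field, (('a^4) \<times> 'a) \<times> 'a) lie" where
  "L_6_3 = L_5_3 \<oplus>\<^sub>L line"

definition L_6_4 :: "('a::field, ('a^5) \<times> 'a) lie" where
  "L_6_4 = L_5_4 \<oplus>\<^sub>L line"

definition L_6_5 :: "('a::field, ('a^5) \<times> 'a) lie" where
  "L_6_5 = L_5_5 \<oplus>\<^sub>L line"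

definition L_6_6 :: "('a::field, ('a^5) \<times> 'a) lie" where
  "L_6_6 = L_5_6 \<oplus>\<^sub>L line"

definition L_6_7 :: "('a::field, ('a^5) \<times> 'a) lie" where
  "L_6_7 = L_5_7 \<oplus>\<^sub>L line"

definition L_6_8 :: "('a::field, ('a^5) \<times> 'a) lie" where
  "L_6_8 = L_5_8 \<oplus>\<^sub>L line"

definition L_6_9 :: "('a::field, ('a^5) \<times> 'a) lie" where
  "L_6_9 = L_5_9 \<oplus>\<^sub>L line"

definition L_6_10 :: "('a::field, 'a^6) lie" where
  "L_6_10 = lie_of_products
    [(1, 2, e 3), (1, 3, e 6), (4, 5, e 6)]"

definition L_6_11 :: "('a::field, 'a^6) lie" where
  "L_6_11 = lie_of_products
    [(1, 2, e 3), (1, 3, e 4), (1, 4, e 6), (2, 3, e 6), (2, 5, e 6)]"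

definition L_6_12 :: "('a::field, 'a^6) lie" where
  "L_6_12 = lie_of_products
    [(1, 2, e 3), (1, 3, e 4), (1, 4, e 6), (2, 5, e 6)]"

definition L_6_13 :: "('a::field, 'a^6) lie" where
  "L_6_13 = lie_of_products
    [(1, 2, e 3), (1, 3, e 5), (2, 4, e 5), (1, 5, e 6), (3, 4, e 6)]"

definition L_6_14 :: "('a::field, 'a^6) lie" where
  "L_6_14 = lie_of_products
    [(1, 2, e 3), (1, 3, e 4), (1, 4, e 5), (2, 3, e 5), (2, 5, e 6), (3, 4, - e 6)]"

definition L_6_15 :: "('a::field, 'a^6) lie" where
  "L_6_15 = lie_of_products
    [(1, 2, e 3), (1, 3, e 4), (1, 4, e 5), (2, 3, e 5), (1, 5, e 6), (2, 4, e 6)]"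

definition L_6_16 :: "('a::field, 'a^6) lie" where
  "L_6_16 = lie_of_products
    [(1, 2, e 3), (1, 3, e 4), (1, 4, e 5), (2, 5, e 6), (3, 4, - e 6)]"

definition L_6_17 :: "('a::field, 'a^6) lie" where
  "L_6_17 = lie_of_products
    [(1, 2, e 3), (1, 3, e 4), (1, 4, e 5), (1, 5, e 6), (2, 3, e 6)]"

definition L_6_18 :: "('a::field, 'a^6) lie" where
  "L_6_18 = lie_of_products
    [(1, 2, e 3), (1, 3, e 4), (1, 4, e 5), (1, 5, e 6)]"

definition L_6_19 :: "'a::field \<Rightarrow> ('a, 'a^6) lie" where
  "L_6_19 \<epsilon> = lie_of_products
    [(1, 2, e 4), (1, 3, e 5), (2, 4, e 6), (3, 5, \<epsilon> *s e 6)]"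

definition L_6_20 :: "('a::field, 'a^6) lie" where
  "L_6_20 = lie_of_products
    [(1, 2, e 4), (1, 3, e 5), (1, 5, e 6), (2, 4, e 6)]"

definition L_6_21 :: "'a::field \<Rightarrow> ('a, 'a^6) lie" where
  "L_6_21 \<epsilon> = lie_of_products
    [(1, 2, e 3), (1, 3, e 4), (2, 3, e 5), (1, 4, e 6), (2, 5, \<epsilon> *s e 6)]"

definition L_6_22 :: "'a::field \<Rightarrow> ('a, 'a^6) lie" where
  "L_6_22 \<epsilon> = lie_of_products
    [(1, 2, e 5), (1, 3, e 6), (2, 4, \<epsilon> *s e 6), (3, 4, e 5)]"

definition L_6_23 :: "('a::field, 'a^6) lie" where
  "L_6_23 = lie_of_products
    [(1, 2, e 3), (1, 3, e 5), (1, 4, e 6), (2, 4, e 5)]"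

definition L_6_24 :: "'a::field \<Rightarrow> ('a, 'a^6) lie" where
  "L_6_24 \<epsilon> = lie_of_products
    [(1, 2, e 3), (1, 3, e 5), (1, 4, \<epsilon> *s e 6), (2, 3, e 6), (2, 4, e 5)]"

definition L_6_25 :: "('a::field, 'a^6) lie" where
  "L_6_25 = lie_of_products
    [(1, 2, e 3), (1, 3, e 5), (1, 4, e 6)]"

definition L_6_26 :: "('a::field, 'a^6) lie" where
  "L_6_26 = lie_of_products
    [(1, 2, e 4), (1, 3, e 5), (2, 3, e 6)]"

end

theory Submission
  imports Defs
begin

text \<open>
  A nilpotent Lie algebra is generated by any complement of \<open>[L, L]\<close>, so a basis can be built along
  the lower central series \<open>L = D 0 \<supset> D 1 \<supset> D 2 \<supset> \<dots>\<close> from brackets of generators. Strict descent and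
  the Jacobi identity leave ten possible sequences of dimensions of the \<open>D i\<close>. In each case few
  structure constants remain undetermined, and they are normalised by changing the generators:
  a symmetric bilinear form on the span of two generators is diagonalised, or, for the families 22 and
  24, an operator \<open>M\<close> on such a plane is made trace-free, so that \<open>M (M v)\<close> is a multiple \<open>\<epsilon>\<close> of \<open>v\<close>.
  Both steps, and the elimination of some other constants, divide by 2.
  No quotient algebras and no classification in lower dimensions are needed. The CB property fails
  whenever \<open>[[x, z], x] \<noteq> 0\<close> for some \<open>x\<close> and \<open>z\<close>, and it is trivial if all triple brackets vanish.
\<close>

section \<open>Lie algebras given by products of basis vectors\<close>

text \<open>The ten sequences split the list into blocks: 6 gives 1; 5,1 gives 2, 4; 4,2 gives 8,
  22; 4,1,1 gives 3, 5, 10; 3,3 gives 26; 3,2,1 gives 19, 20, 23, 25; 3,1,2 gives 9, 24; 3,1,1,1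
  gives 6, 7, 11, 12, 13; 2,1,2,1 gives 21; 2,1,1,1,1 gives 14 to 18. Over an arbitrary field
  neither square roots nor eigenvectors are available, and this shapes the normal forms. A form is
  only diagonalised: one diagonal entry is absorbed into the last basis vector, and \<epsilon> is
  the ratio of the other entry to it. An operator \<open>M\<close> is brought to companion form by
  the basis \<open>M v\<close>, \<open>v\<close>, for which a single vector \<open>v\<close> that is
  not an eigenvector suffices; if there is none, \<open>M\<close> is scalar, and subtracting that
  scalar splits off a central line, which gives 8 or 9. The list is claimed to be complete, not
  irredundant, so \<epsilon> is kept as it comes out and no invariants are compared.\<close>

lemma exhaust_5: "x = 1 \<or> x = 2 \<or> x = 3 \<or> x = 4 \<or> x = 5" for x :: 5
proof (induct x)
  case (of_int z)
  then have "z = 0 \<or> z = 1 \<or> z = 2 \<or> z = 3 \<or> z = 4" by auto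
  then show ?case by auto
qed

lemma exhaust_6: "x = 1 \<or> x = 2 \<or> x = 3 \<or> x = 4 \<or> x = 5 \<or> x = 6" for x :: 6
proof (induct x)
  case (of_int z)
  then have "z = 0 \<or> z = 1 \<or> z = 2 \<or> z = 3 \<or> z = 4 \<or> z = 5" by auto
  then show ?case by auto
qed

lemma forall_5: "(\<forall>i::5. P i) \<longleftrightarrow> P 1 \<and> P 2 \<and> P 3 \<and> P 4 \<and> P 5"
  by (metis exhaust_5)

lemma forall_6: "(\<forall>i::6. P i) \<longleftrightarrow> P 1 \<and> P 2 \<and> P 3 \<and> P 4 \<and> P 5 \<and> P 6"
  by (metis exhaust_6)

lemma UNIV_6: "UNIV = {1, 2, 3, 4, 5, 6::6}"
  using exhaust_6 by auto

lemma sum_6: "sum f (UNIV::6 set) = f 1 + f 2 + f 3 + f 4 + f 5 + f 6"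
  unfolding UNIV_6 by (simp add: ac_simps)

lemma e_nth: "e i $ j = (if j = i then 1 else 0)"
  by (simp add: e_def axis_def)

section \<open>Calculus of the bracket\<close>

context lie_algebra
begin

abbreviation scalar_mult :: "'a \<Rightarrow> 'v \<Rightarrow> 'v" (infixr \<open>\<cdot>\<close> 75)
  where "c \<cdot> x \<equiv> scl L c x"

abbreviation bracket :: "'v \<Rightarrow> 'v \<Rightarrow> 'v" (\<open>\<langle>_,/ _\<rangle>\<close>)
  where "\<langle>x, y\<rangle> \<equiv> brk L x y"

lemma bracket_add_left [simp]: "\<langle>x + y, z\<rangle> = \<langle>x, z\<rangle> + \<langle>y, z\<rangle>"
  using brk_linear_left[of z] by (simp add: Vector_Spaces.linear_iff)

lemma bracket_add_right [simp]: "\<langle>z, x + y\<rangle> = \<langle>z, x\<rangle> + \<langle>z, y\<rangle>"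
  using brk_linear_right[of z] by (simp add: Vector_Spaces.linear_iff)

lemma bracket_scale_left [simp]: "\<langle>c \<cdot> x, z\<rangle> = c \<cdot> \<langle>x, z\<rangle>"
  using brk_linear_left[of z] by (simp add: Vector_Spaces.linear_iff)

lemma bracket_scale_right [simp]: "\<langle>z, c \<cdot> x\<rangle> = c \<cdot> \<langle>z, x\<rangle>"
  using brk_linear_right[of z] by (simp add: Vector_Spaces.linear_iff)

lemma bracket_zero_left [simp]: "\<langle>0, z\<rangle> = 0"
  using bracket_scale_left[of 0 0 z] by simp

lemma bracket_zero_right [simp]: "\<langle>z, 0\<rangle> = 0"
  using bracket_scale_right[of z 0 0] by simp

lemma bracket_minus_left [simp]: "\<langle>- x, z\<rangle> = - \<langle>x, z\<rangle>"
  using bracket_scale_left[of "-1" x z] by simp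

lemma bracket_minus_right [simp]: "\<langle>z, - x\<rangle> = - \<langle>z, x\<rangle>"
  using bracket_scale_right[of z "-1" x] by simp

lemma bracket_diff_left [simp]: "\<langle>x - y, z\<rangle> = \<langle>x, z\<rangle> - \<langle>y, z\<rangle>"
  using bracket_add_left[of x "- y" z] by simp

lemma bracket_diff_right [simp]: "\<langle>z, x - y\<rangle> = \<langle>z, x\<rangle> - \<langle>z, y\<rangle>"
  using bracket_add_right[of z x "- y"] by simp

lemma bracket_self [simp]: "\<langle>x, x\<rangle> = 0"
  by (fact brk_alternating)

lemma bracket_commute: "\<langle>x, y\<rangle> = - \<langle>y, x\<rangle>"
proof -
  have "\<langle>x, y\<rangle> + \<langle>y, x\<rangle> = \<langle>x + y, x + y\<rangle>"
    by (simp del: brk_alternating add: brk_alternating[of x] brk_alternating[of y])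
  also have "\<dots> = 0" by (rule brk_alternating)
  finally show ?thesis by (simp add: eq_neg_iff_add_eq_0)
qed

text \<open>This is the statement that \<open>ad [x, y]\<close> is the commutator of
  \<open>ad x\<close> and \<open>ad y\<close>. Read from left to right it produces right-nested
  brackets, the form in which all later computations are done.\<close>

lemma jacobi_left: "\<langle>\<langle>x, y\<rangle>, z\<rangle> = \<langle>x, \<langle>y, z\<rangle>\<rangle> - \<langle>y, \<langle>x, z\<rangle>\<rangle>"
proof -
  have "\<langle>\<langle>x, y\<rangle>, z\<rangle> = \<langle>x, \<langle>y, z\<rangle>\<rangle> + \<langle>y, \<langle>z, x\<rangle>\<rangle>"
    using jacobi[of x y z]
    by (simp add: bracket_commute[of "\<langle>y, z\<rangle>" x] bracket_commute[of "\<langle>z, x\<rangle>" y] algebra_simps)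
  also have "\<langle>y, \<langle>z, x\<rangle>\<rangle> = - \<langle>y, \<langle>x, z\<rangle>\<rangle>"
    by (subst bracket_commute[of z x]) simp
  finally show ?thesis by simp
qed

lemma bracket_sum_left: "\<langle>sum f A, z\<rangle> = (\<Sum>a\<in>A. \<langle>f a, z\<rangle>)"
  by (induction A rule: infinite_finite_induct) simp_all

lemma bracket_sum_right: "\<langle>z, sum f A\<rangle> = (\<Sum>a\<in>A. \<langle>z, f a\<rangle>)"
  by (induction A rule: infinite_finite_induct) simp_all

end

text \<open>The upper triangle of a multiplication table, row by row. For six vectors it has 5 + 4 +
  3 + 2 + 1 entries; in the displayed tables below the first line holds the brackets with
  \<open>x1\<close>, the second those with \<open>x2\<close>, and the third the remaining
  six.\<close>

primrec pair_brackets :: "('a, 'v) lie \<Rightarrow> 'v list \<Rightarrow> 'v list" where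
  "pair_brackets L [] = []"
| "pair_brackets L (x # xs) = map (brk L x) xs @ pair_brackets L xs"

section \<open>Algebras given by structure constants\<close>

lemma lie_algebra_if_jacobi:
  assumes "vector_space (scl L)"
    and "\<And>x x' y. brk L (x + x') y = brk L x y + brk L x' y"
    and "\<And>x y y'. brk L x (y + y') = brk L x y + brk L x y'"
    and "\<And>c x y. brk L (scl L c x) y = scl L c (brk L x y)"
    and "\<And>c x y. brk L x (scl L c y) = scl L c (brk L x y)"
    and "\<And>x. brk L x x = 0"
    and "\<And>x y z. brk L (brk L x y) z + brk L (brk L y z) x + brk L (brk L z x) y = 0"
  shows "lie_algebra L"
  using assms by (simp add: lie_algebra_def lie_algebra_axioms_def Vector_Spaces.linear_iff)

lemma scl_lie_of_products [simp]: "scl (lie_of_products ps) = (*s)"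
  by (simp add: lie_of_products_def)

text \<open>Each summand of the bracket is bilinear and alternating by its shape, so only the Jacobi
  identity depends on the listed products.\<close>

lemma lie_algebra_lie_of_products:
  fixes ps :: "('n::finite \<times> 'n \<times> ('a::field^'n)) list"
  assumes "\<And>x y z. brk (lie_of_products ps) (brk (lie_of_products ps) x y) z +
    brk (lie_of_products ps) (brk (lie_of_products ps) y z) x +
    brk (lie_of_products ps) (brk (lie_of_products ps) z x) y = 0"
  shows "lie_algebra (lie_of_products ps)"
proof (rule lie_algebra_if_jacobi[OF _ _ _ _ _ _ assms])
  show "vector_space (scl (lie_of_products ps))"
    using vec.vector_space_axioms by simp
qed (induction ps; force simp: lie_of_products_def algebra_simps vec.scale_left_distrib
      vec.scale_right_distrib vec.scale_right_diff_distrib vec.scale_left_diff_distrib)+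

text \<open>The function \<open>r\<close> ranks the basis so that a product involves only basis
  vectors of higher rank than both factors. The spaces \<open>W n\<close> of vectors supported on
  ranks at least \<open>n\<close> then dominate the lower central series, and they vanish beyond the
  maximal rank.\<close>

lemma nilpotent_lie_of_products:
  fixes ps :: "('n::finite \<times> 'n \<times> ('a::field^'n)) list" and r :: "'n \<Rightarrow> nat"
  assumes "\<forall>(i, j, v)\<in>set ps. \<forall>k. v $ k \<noteq> 0 \<longrightarrow> r i < r k \<and> r j < r k"
  shows "nilpotent_lie (lie_of_products ps)"
proof -
  define W where "W n = {v::'a^'n. \<forall>k. r k < n \<longrightarrow> v $ k = 0}" for n
  let ?L = "lie_of_products ps"
  have sub: "vec.subspace (W n)" for n
    by (auto simp: W_def vec.subspace_def)
  \<comment> \<open>If \<open>r k \<le> n\<close> and \<open>v $ k\<close> is nonzero, then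
    \<open>i\<close> and \<open>j\<close> have rank below \<open>n\<close>, so
    \<open>y $ i = y $ j = 0\<close> and the coefficient of \<open>v\<close> vanishes whatever
    \<open>x\<close> is.\<close>
  have step: "brk ?L x y \<in> W (Suc n)" if "y \<in> W n" for x y n
    using assms that
  proof (induction ps)
    case Nil
    then show ?case by (simp add: W_def lie_of_products_def)
  next
    case (Cons p ps)
    obtain i j v where p: "p = (i, j, v)" by (cases p)
    have "(x $ i * y $ j - x $ j * y $ i) *s v \<in> W (Suc n)"
      using Cons.prems by (force simp: W_def p)
    moreover have "brk (lie_of_products ps) x y \<in> W (Suc n)"
      using Cons by simp
    ultimately show ?case
      using vec.subspace_add[OF sub] by (auto simp: lie_of_products_def p)
  qed
  have "lower_central ?L n \<subseteq> W n" for n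
  proof (induction n)
    case 0
    show ?case by (simp add: W_def)
  next
    case (Suc n)
    then have "{brk ?L x y | x y. y \<in> lower_central ?L n} \<subseteq> W (Suc n)"
      using step by blast
    then show ?case
      using vec.span_minimal[OF _ sub] by simp
  qed
  moreover have "W (Suc (Max (range r))) = {0}"
    by (auto simp: W_def vec_eq_iff less_Suc_eq_le)
  moreover have "0 \<in> lower_central ?L n" for n
    by (cases n) (simp_all add: vec.span_zero)
  ultimately have "lower_central ?L (Suc (Max (range r))) = {0}"
    by (metis singletonI subset_singletonD empty_iff)
  then show ?thesis
    unfolding nilpotent_lie_def ..
qed

text \<open>The numeral \<open>6\<close> is \<open>0\<close> in the index type \<open>6\<close>, so its order cannot serve as the filtration \<open>r\<close>.\<close>

lemma nilpotent_lie_of_dim_lie_of_products: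
  fixes ps :: "(6 \<times> 6 \<times> ('a::field^6)) list"
  assumes "\<And>x y z. brk (lie_of_products ps) (brk (lie_of_products ps) x y) z +
    brk (lie_of_products ps) (brk (lie_of_products ps) y z) x +
    brk (lie_of_products ps) (brk (lie_of_products ps) z x) y = 0"
    and "\<forall>(i, j, v)\<in>set ps. \<forall>k. v $ k \<noteq> 0 \<longrightarrow>
      (let r = (\<lambda>k. if k = 1 then 1 else if k = 2 then 2 else if k = 3 then 3
         else if k = 4 then 4 else if k = 5 then 5 else 6 :: nat) in r i < r k \<and> r j < r k)"
  shows "nilpotent_lie_of_dim 6 (lie_of_products ps)"
  unfolding nilpotent_lie_of_dim_def
  using lie_algebra_lie_of_products[OF assms(1)] nilpotent_lie_of_products[OF assms(2)[unfolded Let_def]]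
  by (simp add: vec_dim_card del: vec.dim_UNIV)

section \<open>Isomorphisms and transport of structure\<close>

lemma lie_isomorphic_sym:
  assumes "L \<cong>\<^sub>L M"
  shows "M \<cong>\<^sub>L L"
proof -
  obtain f where f: "Vector_Spaces.linear (scl L) (scl M) f" "bij f"
      "\<And>x y. f (brk L x y) = brk M (f x) (f y)"
    using assms by (auto simp: lie_isomorphic_def)
  have inv: "inv f (f x) = x" "f (inv f y) = y" for x y
    using f(2) by (simp_all add: bij_is_inj bij_is_surj surj_f_inv_f)
  have "Vector_Spaces.linear (scl M) (scl L) (inv f)"
    using f(1) unfolding Vector_Spaces.linear_iff by (metis inv)
  moreover have "inv f (brk M x y) = brk L (inv f x) (inv f y)" for x y
    by (metis f(3) inv)
  ultimately show ?thesis
    using f(2) bij_imp_bij_inv unfolding lie_isomorphic_def by blast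
qed

lemma lie_isomorphic_trans:
  assumes "L \<cong>\<^sub>L M" "M \<cong>\<^sub>L N"
  shows "L \<cong>\<^sub>L N"
proof -
  obtain f where f: "Vector_Spaces.linear (scl L) (scl M) f" "bij f"
      "\<And>x y. f (brk L x y) = brk M (f x) (f y)"
    using assms(1) by (auto simp: lie_isomorphic_def)
  obtain g where g: "Vector_Spaces.linear (scl M) (scl N) g" "bij g"
      "\<And>x y. g (brk M x y) = brk N (g x) (g y)"
    using assms(2) by (auto simp: lie_isomorphic_def)
  show ?thesis
    unfolding lie_isomorphic_def
    using Vector_Spaces.linear_compose[OF f(1) g(1)] bij_comp[OF f(2) g(2)] f(3) g(3)
    by (intro exI[of _ "g \<circ> f"]) simp
qed

text \<open>Nothing is assumed of the target: linearity of \<open>f\<close> supplies the vector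
  space, and surjectivity lets every identity be checked on preimages. The direct sums of the list
  inherit their properties from explicit tables in this way.\<close>

lemma nilpotent_lie_of_dim_isomorphic:
  assumes "M \<cong>\<^sub>L L" "nilpotent_lie_of_dim n M"
  shows "nilpotent_lie_of_dim n L"
proof -
  obtain f where f: "Vector_Spaces.linear (scl M) (scl L) f" "bij f"
      "\<And>x y. f (brk M x y) = brk L (f x) (f y)"
    using assms by (auto simp: lie_isomorphic_def)
  interpret M: lie_algebra M
    using assms by (simp add: nilpotent_lie_of_dim_def)
  interpret f: Vector_Spaces.linear "scl M" "scl L" f by fact
  have surj: "\<exists>x'. x = f x'" for x
    using f(2) by (metis bij_pointE)
  have "lie_algebra L"
  proof (rule lie_algebra_if_jacobi)
    show "vector_space (scl L)" ..
  next
    fix x x' y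
    obtain a a' b where [simp]: "x = f a" "x' = f a'" "y = f b"
      using surj by metis
    show "brk L (x + x') y = brk L x y + brk L x' y"
      by (simp flip: f(3) f.add)
  next
    fix x y y'
    obtain a b b' where [simp]: "x = f a" "y = f b" "y' = f b'"
      using surj by metis
    show "brk L x (y + y') = brk L x y + brk L x y'"
      by (simp flip: f(3) f.add)
  next
    fix c x y
    obtain a b where [simp]: "x = f a" "y = f b"
      using surj by metis
    show "brk L (scl L c x) y = scl L c (brk L x y)" "brk L x (scl L c y) = scl L c (brk L x y)"
      by (simp_all flip: f(3) f.scale)
  next
    fix x
    obtain a where [simp]: "x = f a" using surj by metis
    show "brk L x x = 0" by (simp flip: f(3))
  next
    fix x y z
    obtain a b c where [simp]: "x = f a" "y = f b" "z = f c"
      using surj by metis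
    show "brk L (brk L x y) z + brk L (brk L y z) x + brk L (brk L z x) y = 0"
      by (simp add: M.jacobi flip: f(3) f.add)
  qed
  moreover have "lower_central L n = f ` lower_central M n" for n
  proof (induction n)
    case 0
    show ?case using f(2) by (simp add: bij_is_surj)
  next
    case (Suc n)
    have "{brk L x y | x y. y \<in> lower_central L n} = f ` {brk M x y | x y. y \<in> lower_central M n}"
      unfolding Suc.IH
    proof (intro equalityI subsetI)
      fix v
      assume "v \<in> {brk L x y | x y. y \<in> f ` lower_central M n}"
      then obtain x y where v: "v = brk L x (f y)" "y \<in> lower_central M n" by blast
      obtain a where "x = f a" using surj by blast
      with v show "v \<in> f ` {brk M x y | x y. y \<in> lower_central M n}"
        by (auto simp flip: f(3))
    next
      fix v
      assume "v \<in> f ` {brk M x y | x y. y \<in> lower_central M n}"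
      then show "v \<in> {brk L x y | x y. y \<in> f ` lower_central M n}"
        using f(3) by blast
    qed
    then show ?case
      by (simp add: f.span_image)
  qed
  then have "nilpotent_lie L"
    using assms unfolding nilpotent_lie_def nilpotent_lie_of_dim_def
    by (metis f.zero image_empty image_insert)
  moreover have "vector_space.dim (scl L) UNIV = n"
  proof -
    obtain B where B: "\<not> M.dependent B" "UNIV \<subseteq> M.span B" "card B = M.dim UNIV"
      by (rule M.basis_exists[of UNIV])
    have "card B = n"
      using B(3) assms(2) by (simp add: nilpotent_lie_of_dim_def)
    have inj: "inj f" using f(2) by (simp add: bij_is_inj)
    have "\<not> f.vs2.dependent (f ` B)"
      using B(1) inj by (simp add: f.independent_inj_image)
    moreover have "f.vs2.span (f ` B) = UNIV"
      using B(2) f(2) by (simp add: f.span_image bij_is_surj top.extremum_unique)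
    moreover have "card (f ` B) = n"
      using \<open>card B = n\<close> inj by (simp add: card_image inj_on_subset)
    ultimately show ?thesis
      using f.vs2.dim_eq_card[of "f ` B" UNIV] by simp
  qed
  ultimately show ?thesis
    by (simp add: nilpotent_lie_of_dim_def)
qed

text \<open>The linear map sending \<open>e i\<close> to the \<open>i\<close>-th vector respects
  brackets because it does so on the basis. It is surjective by the spanning assumption and hence
  injective, both dimensions being 6; so linear independence of the six vectors never has to be
  checked.\<close>

lemma iso_lie_of_products:
  fixes L :: "('a::field, 'v::ab_group_add) lie" and ps :: "(6 \<times> 6 \<times> ('a^6)) list"
  assumes L: "lie_algebra L" "vector_space.dim (scl L) UNIV = 6"
    and M: "lie_algebra (lie_of_products ps)"
    and span: "module.span (scl L) {x1, x2, x3, x4, x5, x6} = UNIV"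
    and brackets: "pair_brackets L [x1, x2, x3, x4, x5, x6] =
      map (\<lambda>v. scl L (v $ 1) x1 + scl L (v $ 2) x2 + scl L (v $ 3) x3 +
          scl L (v $ 4) x4 + scl L (v $ 5) x5 + scl L (v $ 6) x6)
        (pair_brackets (lie_of_products ps) [e 1, e 2, e 3, e 4, e 5, e 6])"
  shows "L \<cong>\<^sub>L lie_of_products ps"
proof -
  interpret L: lie_algebra L by fact
  interpret M: lie_algebra "lie_of_products ps" by fact
  define x where "x i = (if i = 1 then x1 else if i = 2 then x2 else if i = 3 then x3
    else if i = 4 then x4 else if i = 5 then x5 else x6)" for i :: 6
  define f where "f v = (\<Sum>i\<in>UNIV. scl L (v $ i) (x i))" for v :: "'a^6"
  have f: "f v = scl L (v $ 1) x1 + scl L (v $ 2) x2 + scl L (v $ 3) x3 +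
      scl L (v $ 4) x4 + scl L (v $ 5) x5 + scl L (v $ 6) x6" for v
    by (simp add: f_def sum_6 x_def)
  have lin: "Vector_Spaces.linear (*s) (scl L) f"
    unfolding Vector_Spaces.linear_iff
    using vec.vector_space_axioms L.vector_space_axioms
    by (simp add: f_def L.scale_left_distrib sum.distrib L.scale_sum_right)
  interpret f: Vector_Spaces.linear "(*s)" "scl L" f by fact
  have basis: "brk L (x i) (x j) = f (brk (lie_of_products ps) (e i) (e j))" for i j
  proof -
    \<comment> \<open>The pairs are enumerated rather than compared: the numeral 6 denotes 0 in the
      index type, whose order is therefore not the order of the names. The opposite pairs follow by
      antisymmetry.\<close>
    have less: "brk L (x i) (x j) = f (brk (lie_of_products ps) (e i) (e j))"
      if "(i, j) \<in> {(1,2),(1,3),(1,4),(1,5),(1,6),(2,3),(2,4),(2,5),(2,6),(3,4),(3,5),(3,6),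
        (4,5),(4,6),(5,6)}" for i j
      using that brackets by (elim insertE emptyE) (simp_all add: f x_def)
    consider "i = j" | "(i, j) \<in> {(1,2),(1,3),(1,4),(1,5),(1,6),(2,3),(2,4),(2,5),(2,6),(3,4),(3,5),
        (3,6),(4,5),(4,6),(5,6)}" | "(j, i) \<in> {(1,2),(1,3),(1,4),(1,5),(1,6),(2,3),(2,4),(2,5),
        (2,6),(3,4),(3,5),(3,6),(4,5),(4,6),(5,6)}"
      using exhaust_6[of i] exhaust_6[of j] by (elim disjE) simp_all
    then show ?thesis
    proof cases
      case 3
      then show ?thesis
        using less[OF 3] L.bracket_commute[of "x i" "x j"] M.bracket_commute[of "e i" "e j"]
        by (simp add: f.neg)
    qed (simp_all add: less f.zero)
  qed
  have expand: "v = (\<Sum>i\<in>UNIV. v $ i *s e i)" for v :: "'a^6"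
    by (simp add: vec_eq_iff e_nth if_distrib cong: if_cong)
  have hom: "f (brk (lie_of_products ps) v w) = brk L (f v) (f w)" for v w
  proof -
    have expand2: "brk (lie_of_products ps) v w =
        (\<Sum>i\<in>UNIV. \<Sum>j\<in>UNIV. v $ i *s (w $ j *s brk (lie_of_products ps) (e i) (e j)))"
    proof -
      have "brk (lie_of_products ps) v w = (\<Sum>i\<in>UNIV. v $ i *s brk (lie_of_products ps) (e i) w)"
        by (subst (1) expand[of v], subst M.bracket_sum_left)
          (use M.bracket_scale_left in simp)
      moreover have "brk (lie_of_products ps) (e i) w =
          (\<Sum>j\<in>UNIV. w $ j *s brk (lie_of_products ps) (e i) (e j))" for i
        by (subst (1) expand[of w], subst M.bracket_sum_right)
          (use M.bracket_scale_right in simp)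
      ultimately show ?thesis by (simp only: vec.scale_sum_right)
    qed
    show ?thesis
    proof -
      have "brk L (f v) (f w) = (\<Sum>i\<in>UNIV. scl L (v $ i) (brk L (x i) (f w)))"
        unfolding f_def[of v] L.bracket_sum_left by simp
      moreover have "brk L (x i) (f w) = (\<Sum>j\<in>UNIV. scl L (w $ j) (brk L (x i) (x j)))" for i
        unfolding f_def[of w] L.bracket_sum_right by simp
      ultimately have "brk L (f v) (f w) =
          (\<Sum>i\<in>UNIV. \<Sum>j\<in>UNIV. scl L (v $ i) (scl L (w $ j) (brk L (x i) (x j))))"
        by (simp only: L.scale_sum_right)
      then show ?thesis
        by (simp only: expand2 f.sum f.scale basis)
    qed
  qed
  have surj: "surj f"
  proof -
    have "x i \<in> range f" for i
      by (rule range_eqI[of _ _ "e i"])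
        (simp add: f_def e_nth if_distrib[of "\<lambda>c. scl L c _"] cong: if_cong)
    from this[of 1] this[of 2] this[of 3] this[of 4] this[of 5] this[of 6]
    have "{x1, x2, x3, x4, x5, x6} \<subseteq> range f"
      by (simp add: x_def)
    then have "L.span {x1, x2, x3, x4, x5, x6} \<subseteq> range f"
      using f.subspace_image[OF vec.subspace_UNIV] by (intro L.span_minimal) auto
    then show ?thesis using span by auto
  qed
  \<comment> \<open>Any basis will do: its cardinality 6 is positive, so it is finite, which the
    dimension argument for injectivity requires.\<close>
  obtain B where B: "\<not> L.dependent B" "UNIV \<subseteq> L.span B" "card B = 6"
    using L(2) by (metis L.basis_exists)
  interpret finite_dimensional_vector_space "scl L" B
    using B by unfold_locales (auto simp: card_ge_0_finite)
  interpret pair: finite_dimensional_vector_space_pair "(*s)" "cart_basis :: ('a^6) set" "scl L" B ..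
  have "inj f"
    by (rule pair.linear_surjective_imp_injective[OF lin surj]) (simp only: L(2), simp add: vec_dim_card del: vec.dim_UNIV)
  then have "lie_of_products ps \<cong>\<^sub>L L"
    unfolding lie_isomorphic_def using lin surj hom by (auto simp: bij_def)
  then show ?thesis by (rule lie_isomorphic_sym)
qed

section \<open>The algebras of the list\<close>

lemma lie_isomorphicI:
  assumes "vector_space (scl L)" "vector_space (scl M)"
    and "\<And>x y. f (x + y) = f x + f y" "\<And>c x. f (scl L c x) = scl M c (f x)"
    and "\<And>x. g (f x) = x" "\<And>y. f (g y) = y"
    and "\<And>x y. f (brk L x y) = brk M (f x) (f y)"
  shows "L \<cong>\<^sub>L M"
  unfolding lie_isomorphic_def Vector_Spaces.linear_iff
  using assms by (intro exI[of _ f]) (simp add: o_bij[of g] fun_eq_iff)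

lemma vector_space_lie_sum:
  assumes "vector_space (scl L)" "vector_space (scl M)"
  shows "vector_space (scl (L \<oplus>\<^sub>L M))"
  using assms by (auto simp: vector_space_def lie_sum_def)

lemma vector_space_line: "vector_space (scl line)"
  by (simp add: line_def vector_space_over_itself.vector_space_axioms)

lemma vector_space_lie_of_products: "vector_space (scl (lie_of_products ps))"
  by (simp add: vec.vector_space_axioms)

lemmas vector_space_lie = vector_space_lie_sum vector_space_line vector_space_lie_of_products

text \<open>The index types of sizes 5 and 6 are unrelated, so coordinates are carried over one by
  one and the sixth becomes the summand \<open>I\<close>. What remains for a concrete table is the
  equation between the brackets.\<close>

lemma lie_sum_line_5:
  fixes ps :: "(5 \<times> 5 \<times> ('a::field^5)) list" and qs :: "(6 \<times> 6 \<times> ('a^6)) list"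
  defines "f \<equiv> \<lambda>v. (\<chi> i. if i = 1 then v $ 1 else if i = 2 then v $ 2 else if i = 3 then v $ 3
    else if i = 4 then v $ 4 else v $ 5, v $ 6)"
  assumes "\<And>v w. f (brk (lie_of_products qs) v w) = brk (lie_of_products ps \<oplus>\<^sub>L line) (f v) (f w)"
  shows "lie_of_products qs \<cong>\<^sub>L lie_of_products ps \<oplus>\<^sub>L line"
proof (rule lie_isomorphicI)
  show "vector_space (scl (lie_of_products qs))" "vector_space (scl (lie_of_products ps \<oplus>\<^sub>L line))"
    by (intro vector_space_lie)+
  show "f (brk (lie_of_products qs) v w) = brk (lie_of_products ps \<oplus>\<^sub>L line) (f v) (f w)" for v w
    by fact
  let ?g = "\<lambda>p :: ('a^5) \<times> 'a. (\<chi> i. if i = 1 then fst p $ 1 else if i = 2 then fst p $ 2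
    else if i = 3 then fst p $ 3 else if i = 4 then fst p $ 4 else if i = 5 then fst p $ 5
    else snd p) :: 'a^6"
  show "?g (f x) = x" "f (?g y) = y" for x y
    by (simp_all add: f_def vec_eq_iff forall_5 forall_6 prod_eq_iff)
qed (simp_all add: f_def lie_sum_def line_def vec_eq_iff forall_5)

lemmas model_simps = lie_of_products_def lie_sum_def line_def e_nth vec_eq_iff forall_5 forall_6

text \<open>Fixes the index type, so that the numerals and \<open>e\<close> in a table are read in
  dimension 6.\<close>

abbreviation product_algebra_6 ::
    "(6 \<times> 6 \<times> ('a::field^6)) list \<Rightarrow> ('a, 'a^6) lie" where
  "product_algebra_6 \<equiv> lie_of_products"

lemma L_6_1_iso: "product_algebra_6 [] \<cong>\<^sub>L L_6_1"
  unfolding L_6_1_def L_5_1_def by (rule lie_sum_line_5) (simp add: model_simps)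

lemma L_6_2_iso: "product_algebra_6 [(1, 2, e 3)] \<cong>\<^sub>L L_6_2"
  unfolding L_6_2_def L_5_2_def L_3_2_def
  by (rule lie_isomorphicI[of _ _
        "\<lambda>v. (((\<chi> i. if i = 1 then v $ 1 else if i = 2 then v $ 2 else v $ 3, v $ 4), v $ 5), v $ 6)"
        "\<lambda>p. \<chi> i. if i = 1 then fst (fst (fst p)) $ 1 else if i = 2 then fst (fst (fst p)) $ 2
          else if i = 3 then fst (fst (fst p)) $ 3 else if i = 4 then snd (fst (fst p))
          else if i = 5 then snd (fst p) else snd p"])
    (intro vector_space_lie, intro vector_space_lie, simp_all add: model_simps forall_3 prod_eq_iff)

lemma L_6_3_iso: "product_algebra_6 [(1, 2, e 3), (1, 3, e 4)] \<cong>\<^sub>L L_6_3"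
  unfolding L_6_3_def L_5_3_def L_4_3_def
  by (rule lie_isomorphicI[of _ _
        "\<lambda>v. ((\<chi> i. if i = 1 then v $ 1 else if i = 2 then v $ 2 else if i = 3 then v $ 3 else v $ 4,
          v $ 5), v $ 6)"
        "\<lambda>p. \<chi> i. if i = 1 then fst (fst p) $ 1 else if i = 2 then fst (fst p) $ 2
          else if i = 3 then fst (fst p) $ 3 else if i = 4 then fst (fst p) $ 4
          else if i = 5 then snd (fst p) else snd p"])
    (intro vector_space_lie, intro vector_space_lie, simp_all add: model_simps forall_4 prod_eq_iff)

lemma L_6_4_iso: "product_algebra_6 [(1, 2, e 5), (3, 4, e 5)] \<cong>\<^sub>L L_6_4"
  unfolding L_6_4_def L_5_4_def by (rule lie_sum_line_5) (simp add: model_simps)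

lemma L_6_5_iso: "product_algebra_6 [(1, 2, e 3), (1, 3, e 5), (2, 4, e 5)] \<cong>\<^sub>L L_6_5"
  unfolding L_6_5_def L_5_5_def by (rule lie_sum_line_5) (simp add: model_simps)

lemma L_6_6_iso: "product_algebra_6 [(1, 2, e 3), (1, 3, e 4), (1, 4, e 5), (2, 3, e 5)] \<cong>\<^sub>L L_6_6"
  unfolding L_6_6_def L_5_6_def by (rule lie_sum_line_5) (simp add: model_simps)

lemma L_6_7_iso: "product_algebra_6 [(1, 2, e 3), (1, 3, e 4), (1, 4, e 5)] \<cong>\<^sub>L L_6_7"
  unfolding L_6_7_def L_5_7_def by (rule lie_sum_line_5) (simp add: model_simps)

lemma L_6_8_iso: "product_algebra_6 [(1, 2, e 4), (1, 3, e 5)] \<cong>\<^sub>L L_6_8"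
  unfolding L_6_8_def L_5_8_def by (rule lie_sum_line_5) (simp add: model_simps)

lemma L_6_9_iso: "product_algebra_6 [(1, 2, e 3), (1, 3, e 4), (2, 3, e 5)] \<cong>\<^sub>L L_6_9"
  unfolding L_6_9_def L_5_9_def by (rule lie_sum_line_5) (simp add: model_simps)

section \<open>Nilpotency and the CB property of the models\<close>

lemma nilpotent_lie_of_dim_models:
  fixes eps :: "'a::field"
  shows "nilpotent_lie_of_dim 6 (L_6_10 :: ('a, _) lie)"
    "nilpotent_lie_of_dim 6 (L_6_11 :: ('a, _) lie)"
    "nilpotent_lie_of_dim 6 (L_6_12 :: ('a, _) lie)"
    "nilpotent_lie_of_dim 6 (L_6_13 :: ('a, _) lie)"
    "nilpotent_lie_of_dim 6 (L_6_14 :: ('a, _) lie)"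
    "nilpotent_lie_of_dim 6 (L_6_15 :: ('a, _) lie)"
    "nilpotent_lie_of_dim 6 (L_6_16 :: ('a, _) lie)"
    "nilpotent_lie_of_dim 6 (L_6_17 :: ('a, _) lie)"
    "nilpotent_lie_of_dim 6 (L_6_18 :: ('a, _) lie)"
    "nilpotent_lie_of_dim 6 (L_6_19 eps)"
    "nilpotent_lie_of_dim 6 (L_6_20 :: ('a, _) lie)"
    "nilpotent_lie_of_dim 6 (L_6_21 eps)"
    "nilpotent_lie_of_dim 6 (L_6_22 eps)"
    "nilpotent_lie_of_dim 6 (L_6_23 :: ('a, _) lie)"
    "nilpotent_lie_of_dim 6 (L_6_24 eps)"
    "nilpotent_lie_of_dim 6 (L_6_25 :: ('a, _) lie)"
    "nilpotent_lie_of_dim 6 (L_6_26 :: ('a, _) lie)"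
  unfolding L_6_10_def L_6_11_def L_6_12_def L_6_13_def L_6_14_def L_6_15_def L_6_16_def L_6_17_def
    L_6_18_def L_6_19_def L_6_20_def L_6_21_def L_6_22_def L_6_23_def L_6_24_def L_6_25_def L_6_26_def
  by (rule nilpotent_lie_of_dim_lie_of_products; simp add: model_simps algebra_simps; fail)+

lemma nilpotent_lie_of_dim_sum_models:
  shows "nilpotent_lie_of_dim 6 (L_6_1 :: ('a::field, _) lie)"
    "nilpotent_lie_of_dim 6 (L_6_2 :: ('a::field, _) lie)"
    "nilpotent_lie_of_dim 6 (L_6_3 :: ('a::field, _) lie)"
    "nilpotent_lie_of_dim 6 (L_6_4 :: ('a::field, _) lie)"
    "nilpotent_lie_of_dim 6 (L_6_5 :: ('a::field, _) lie)"
    "nilpotent_lie_of_dim 6 (L_6_6 :: ('a::field, _) lie)"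
    "nilpotent_lie_of_dim 6 (L_6_7 :: ('a::field, _) lie)"
    "nilpotent_lie_of_dim 6 (L_6_8 :: ('a::field, _) lie)"
    "nilpotent_lie_of_dim 6 (L_6_9 :: ('a::field, _) lie)"
  by (rule nilpotent_lie_of_dim_isomorphic[OF L_6_1_iso] nilpotent_lie_of_dim_isomorphic[OF L_6_2_iso]
      nilpotent_lie_of_dim_isomorphic[OF L_6_3_iso] nilpotent_lie_of_dim_isomorphic[OF L_6_4_iso]
      nilpotent_lie_of_dim_isomorphic[OF L_6_5_iso] nilpotent_lie_of_dim_isomorphic[OF L_6_6_iso]
      nilpotent_lie_of_dim_isomorphic[OF L_6_7_iso] nilpotent_lie_of_dim_isomorphic[OF L_6_8_iso]
      nilpotent_lie_of_dim_isomorphic[OF L_6_9_iso],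
      rule nilpotent_lie_of_dim_lie_of_products; simp add: model_simps algebra_simps; fail)+

lemma CB_algebra_models:
  fixes eps :: "'a::field"
  shows "CB_algebra (L_6_1 :: ('a, _) lie)"
    "CB_algebra (L_6_2 :: ('a, _) lie)"
    "CB_algebra (L_6_4 :: ('a, _) lie)"
    "CB_algebra (L_6_8 :: ('a, _) lie)"
    "CB_algebra (L_6_22 eps)"
    "CB_algebra (L_6_26 :: ('a, _) lie)"
  by (simp_all add: CB_algebra_def L_6_1_def L_6_2_def L_6_4_def L_6_8_def L_6_22_def L_6_26_def
      L_5_1_def L_5_2_def L_5_4_def L_5_8_def L_3_2_def model_simps forall_3 zero_prod_def)

lemma not_CB_algebraI:
  assumes "brk L x x = 0" "brk L (brk L x y) x \<noteq> 0"
  shows "\<not> CB_algebra L"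
  using assms unfolding CB_algebra_def by blast

lemma not_CB_algebra_sum_models:
  shows "\<not> CB_algebra (L_6_3 :: ('a::field, _) lie)"
    "\<not> CB_algebra (L_6_5 :: ('a::field, _) lie)"
    "\<not> CB_algebra (L_6_6 :: ('a::field, _) lie)"
    "\<not> CB_algebra (L_6_7 :: ('a::field, _) lie)"
    "\<not> CB_algebra (L_6_9 :: ('a::field, _) lie)"
  by (rule not_CB_algebraI[of _ "((e 1, 0), 0)" "((e 2, 0), 0)"] not_CB_algebraI[of _ "(e 1, 0)" "(e 2, 0)"];
      simp add: L_6_3_def L_6_5_def L_6_6_def L_6_7_def L_6_9_def L_5_3_def L_5_5_def L_5_6_def
        L_5_7_def L_5_9_def L_4_3_def model_simps forall_4 zero_prod_def)+

text \<open>The choice \<open>x = e 1\<close>, \<open>y = e 2\<close> works except for 19 and 20: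
  there \<open>[e 1, e 4] = 0\<close>, and the roles of \<open>e 1\<close> and \<open>e 2\<close>
  are exchanged so that \<open>[e 2, e 4] = e 6\<close> is met.\<close>

lemma not_CB_algebra_models:
  fixes eps :: "'a::field"
  shows "\<not> CB_algebra (L_6_10 :: ('a, _) lie)"
    "\<not> CB_algebra (L_6_11 :: ('a, _) lie)"
    "\<not> CB_algebra (L_6_12 :: ('a, _) lie)"
    "\<not> CB_algebra (L_6_13 :: ('a, _) lie)"
    "\<not> CB_algebra (L_6_14 :: ('a, _) lie)"
    "\<not> CB_algebra (L_6_15 :: ('a, _) lie)"
    "\<not> CB_algebra (L_6_16 :: ('a, _) lie)"
    "\<not> CB_algebra (L_6_17 :: ('a, _) lie)"
    "\<not> CB_algebra (L_6_18 :: ('a, _) lie)"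
    "\<not> CB_algebra (L_6_19 eps)"
    "\<not> CB_algebra (L_6_20 :: ('a, _) lie)"
    "\<not> CB_algebra (L_6_21 eps)"
    "\<not> CB_algebra (L_6_23 :: ('a, _) lie)"
    "\<not> CB_algebra (L_6_24 eps)"
    "\<not> CB_algebra (L_6_25 :: ('a, _) lie)"
  by (rule not_CB_algebraI[of _ "e 1" "e 2"] not_CB_algebraI[of _ "e 2" "e 1"];
      simp add: L_6_10_def L_6_11_def L_6_12_def L_6_13_def L_6_14_def L_6_15_def L_6_16_def
        L_6_17_def L_6_18_def L_6_19_def L_6_20_def L_6_21_def L_6_23_def L_6_24_def L_6_25_def
        model_simps; fail)+

section \<open>Recognising a model by the multiplication table of a spanning list\<close>

locale lie_algebra_6 = lie_algebra L for L :: "('a::field, 'v::ab_group_add) lie" +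
  assumes dim_UNIV_6: "dim UNIV = 6"
begin

lemma lie_isomorphic_product_algebra_6:
  assumes "nilpotent_lie_of_dim 6 (product_algebra_6 ps)"
    and "span {x1, x2, x3, x4, x5, x6} = UNIV"
    and "pair_brackets L [x1, x2, x3, x4, x5, x6] =
      map (\<lambda>v. v $ 1 \<cdot> x1 + v $ 2 \<cdot> x2 + v $ 3 \<cdot> x3 + v $ 4 \<cdot> x4 + v $ 5 \<cdot> x5 + v $ 6 \<cdot> x6)
        (pair_brackets (product_algebra_6 ps) [e 1, e 2, e 3, e 4, e 5, e 6])"
  shows "L \<cong>\<^sub>L product_algebra_6 ps"
  using iso_lie_of_products[OF lie_algebra_axioms dim_UNIV_6 _ assms(2,3)] assms(1)
  by (simp add: nilpotent_lie_of_dim_def)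

text \<open>The carriers of the first nine models are nested products, so these are reached through
  their six-dimensional tables; the later models are such tables already.\<close>

lemma iso_L_6_1:
  assumes "span {x1, x2, x3, x4, x5, x6} = UNIV"
    and "pair_brackets L [x1, x2, x3, x4, x5, x6] =
      [0, 0, 0, 0, 0,
       0, 0, 0, 0,
       0, 0, 0, 0, 0, 0]"
  shows "L \<cong>\<^sub>L L_6_1"
  by (rule lie_isomorphic_trans[OF _ L_6_1_iso], rule lie_isomorphic_product_algebra_6[OF _ assms(1)],
      rule nilpotent_lie_of_dim_isomorphic[OF lie_isomorphic_sym[OF L_6_1_iso]
        nilpotent_lie_of_dim_sum_models(1)])
    (simp add: assms(2)[simplified] lie_of_products_def e_nth)

lemma iso_L_6_2:
  assumes "span {x1, x2, x3, x4, x5, x6} = UNIV"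
    and "pair_brackets L [x1, x2, x3, x4, x5, x6] =
      [x3, 0, 0, 0, 0,
       0, 0, 0, 0,
       0, 0, 0, 0, 0, 0]"
  shows "L \<cong>\<^sub>L L_6_2"
  by (rule lie_isomorphic_trans[OF _ L_6_2_iso], rule lie_isomorphic_product_algebra_6[OF _ assms(1)],
      rule nilpotent_lie_of_dim_isomorphic[OF lie_isomorphic_sym[OF L_6_2_iso]
        nilpotent_lie_of_dim_sum_models(2)])
    (simp add: assms(2)[simplified] lie_of_products_def e_nth)

lemma iso_L_6_3:
  assumes "span {x1, x2, x3, x4, x5, x6} = UNIV"
    and "pair_brackets L [x1, x2, x3, x4, x5, x6] =
      [x3, x4, 0, 0, 0,
       0, 0, 0, 0,
       0, 0, 0, 0, 0, 0]"
  shows "L \<cong>\<^sub>L L_6_3"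
  by (rule lie_isomorphic_trans[OF _ L_6_3_iso], rule lie_isomorphic_product_algebra_6[OF _ assms(1)],
      rule nilpotent_lie_of_dim_isomorphic[OF lie_isomorphic_sym[OF L_6_3_iso]
        nilpotent_lie_of_dim_sum_models(3)])
    (simp add: assms(2)[simplified] lie_of_products_def e_nth)

lemma iso_L_6_4:
  assumes "span {x1, x2, x3, x4, x5, x6} = UNIV"
    and "pair_brackets L [x1, x2, x3, x4, x5, x6] =
      [x5, 0, 0, 0, 0,
       0, 0, 0, 0,
       x5, 0, 0, 0, 0, 0]"
  shows "L \<cong>\<^sub>L L_6_4"
  by (rule lie_isomorphic_trans[OF _ L_6_4_iso], rule lie_isomorphic_product_algebra_6[OF _ assms(1)],
      rule nilpotent_lie_of_dim_isomorphic[OF lie_isomorphic_sym[OF L_6_4_iso]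
        nilpotent_lie_of_dim_sum_models(4)])
    (simp add: assms(2)[simplified] lie_of_products_def e_nth)

lemma iso_L_6_5:
  assumes "span {x1, x2, x3, x4, x5, x6} = UNIV"
    and "pair_brackets L [x1, x2, x3, x4, x5, x6] =
      [x3, x5, 0, 0, 0,
       0, x5, 0, 0,
       0, 0, 0, 0, 0, 0]"
  shows "L \<cong>\<^sub>L L_6_5"
  by (rule lie_isomorphic_trans[OF _ L_6_5_iso], rule lie_isomorphic_product_algebra_6[OF _ assms(1)],
      rule nilpotent_lie_of_dim_isomorphic[OF lie_isomorphic_sym[OF L_6_5_iso]
        nilpotent_lie_of_dim_sum_models(5)])
    (simp add: assms(2)[simplified] lie_of_products_def e_nth)

lemma iso_L_6_6:
  assumes "span {x1, x2, x3, x4, x5, x6} = UNIV"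
    and "pair_brackets L [x1, x2, x3, x4, x5, x6] =
      [x3, x4, x5, 0, 0,
       x5, 0, 0, 0,
       0, 0, 0, 0, 0, 0]"
  shows "L \<cong>\<^sub>L L_6_6"
  by (rule lie_isomorphic_trans[OF _ L_6_6_iso], rule lie_isomorphic_product_algebra_6[OF _ assms(1)],
      rule nilpotent_lie_of_dim_isomorphic[OF lie_isomorphic_sym[OF L_6_6_iso]
        nilpotent_lie_of_dim_sum_models(6)])
    (simp add: assms(2)[simplified] lie_of_products_def e_nth)

lemma iso_L_6_7:
  assumes "span {x1, x2, x3, x4, x5, x6} = UNIV"
    and "pair_brackets L [x1, x2, x3, x4, x5, x6] =
      [x3, x4, x5, 0, 0,
       0, 0, 0, 0,
       0, 0, 0, 0, 0, 0]"
  shows "L \<cong>\<^sub>L L_6_7"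
  by (rule lie_isomorphic_trans[OF _ L_6_7_iso], rule lie_isomorphic_product_algebra_6[OF _ assms(1)],
      rule nilpotent_lie_of_dim_isomorphic[OF lie_isomorphic_sym[OF L_6_7_iso]
        nilpotent_lie_of_dim_sum_models(7)])
    (simp add: assms(2)[simplified] lie_of_products_def e_nth)

lemma iso_L_6_8:
  assumes "span {x1, x2, x3, x4, x5, x6} = UNIV"
    and "pair_brackets L [x1, x2, x3, x4, x5, x6] =
      [x4, x5, 0, 0, 0,
       0, 0, 0, 0,
       0, 0, 0, 0, 0, 0]"
  shows "L \<cong>\<^sub>L L_6_8"
  by (rule lie_isomorphic_trans[OF _ L_6_8_iso], rule lie_isomorphic_product_algebra_6[OF _ assms(1)],
      rule nilpotent_lie_of_dim_isomorphic[OF lie_isomorphic_sym[OF L_6_8_iso]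
        nilpotent_lie_of_dim_sum_models(8)])
    (simp add: assms(2)[simplified] lie_of_products_def e_nth)

lemma iso_L_6_9:
  assumes "span {x1, x2, x3, x4, x5, x6} = UNIV"
    and "pair_brackets L [x1, x2, x3, x4, x5, x6] =
      [x3, x4, 0, 0, 0,
       x5, 0, 0, 0,
       0, 0, 0, 0, 0, 0]"
  shows "L \<cong>\<^sub>L L_6_9"
  by (rule lie_isomorphic_trans[OF _ L_6_9_iso], rule lie_isomorphic_product_algebra_6[OF _ assms(1)],
      rule nilpotent_lie_of_dim_isomorphic[OF lie_isomorphic_sym[OF L_6_9_iso]
        nilpotent_lie_of_dim_sum_models(9)])
    (simp add: assms(2)[simplified] lie_of_products_def e_nth)

lemma iso_L_6_10:
  assumes "span {x1, x2, x3, x4, x5, x6} = UNIV"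
    and "pair_brackets L [x1, x2, x3, x4, x5, x6] =
      [x3, x6, 0, 0, 0,
       0, 0, 0, 0,
       0, 0, 0, x6, 0, 0]"
  shows "L \<cong>\<^sub>L L_6_10"
  unfolding L_6_10_def
  by (rule lie_isomorphic_product_algebra_6[OF _ assms(1)],
      rule nilpotent_lie_of_dim_models(1)[unfolded L_6_10_def])
    (simp add: assms(2)[simplified] lie_of_products_def e_nth)

lemma iso_L_6_11:
  assumes "span {x1, x2, x3, x4, x5, x6} = UNIV"
    and "pair_brackets L [x1, x2, x3, x4, x5, x6] =
      [x3, x4, x6, 0, 0,
       x6, 0, x6, 0,
       0, 0, 0, 0, 0, 0]"
  shows "L \<cong>\<^sub>L L_6_11"
  unfolding L_6_11_def
  by (rule lie_isomorphic_product_algebra_6[OF _ assms(1)],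
      rule nilpotent_lie_of_dim_models(2)[unfolded L_6_11_def])
    (simp add: assms(2)[simplified] lie_of_products_def e_nth)

lemma iso_L_6_12:
  assumes "span {x1, x2, x3, x4, x5, x6} = UNIV"
    and "pair_brackets L [x1, x2, x3, x4, x5, x6] =
      [x3, x4, x6, 0, 0,
       0, 0, x6, 0,
       0, 0, 0, 0, 0, 0]"
  shows "L \<cong>\<^sub>L L_6_12"
  unfolding L_6_12_def
  by (rule lie_isomorphic_product_algebra_6[OF _ assms(1)],
      rule nilpotent_lie_of_dim_models(3)[unfolded L_6_12_def])
    (simp add: assms(2)[simplified] lie_of_products_def e_nth)

lemma iso_L_6_13:
  assumes "span {x1, x2, x3, x4, x5, x6} = UNIV"
    and "pair_brackets L [x1, x2, x3, x4, x5, x6] =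
      [x3, x5, 0, x6, 0,
       0, x5, 0, 0,
       x6, 0, 0, 0, 0, 0]"
  shows "L \<cong>\<^sub>L L_6_13"
  unfolding L_6_13_def
  by (rule lie_isomorphic_product_algebra_6[OF _ assms(1)],
      rule nilpotent_lie_of_dim_models(4)[unfolded L_6_13_def])
    (simp add: assms(2)[simplified] lie_of_products_def e_nth)

lemma iso_L_6_14:
  assumes "span {x1, x2, x3, x4, x5, x6} = UNIV"
    and "pair_brackets L [x1, x2, x3, x4, x5, x6] =
      [x3, x4, x5, 0, 0,
       x5, 0, x6, 0,
       - x6, 0, 0, 0, 0, 0]"
  shows "L \<cong>\<^sub>L L_6_14"
  unfolding L_6_14_def
  by (rule lie_isomorphic_product_algebra_6[OF _ assms(1)],
      rule nilpotent_lie_of_dim_models(5)[unfolded L_6_14_def])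
    (simp add: assms(2)[simplified] lie_of_products_def e_nth)

lemma iso_L_6_15:
  assumes "span {x1, x2, x3, x4, x5, x6} = UNIV"
    and "pair_brackets L [x1, x2, x3, x4, x5, x6] =
      [x3, x4, x5, x6, 0,
       x5, x6, 0, 0,
       0, 0, 0, 0, 0, 0]"
  shows "L \<cong>\<^sub>L L_6_15"
  unfolding L_6_15_def
  by (rule lie_isomorphic_product_algebra_6[OF _ assms(1)],
      rule nilpotent_lie_of_dim_models(6)[unfolded L_6_15_def])
    (simp add: assms(2)[simplified] lie_of_products_def e_nth)

lemma iso_L_6_16:
  assumes "span {x1, x2, x3, x4, x5, x6} = UNIV"
    and "pair_brackets L [x1, x2, x3, x4, x5, x6] =
      [x3, x4, x5, 0, 0,
       0, 0, x6, 0,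
       - x6, 0, 0, 0, 0, 0]"
  shows "L \<cong>\<^sub>L L_6_16"
  unfolding L_6_16_def
  by (rule lie_isomorphic_product_algebra_6[OF _ assms(1)],
      rule nilpotent_lie_of_dim_models(7)[unfolded L_6_16_def])
    (simp add: assms(2)[simplified] lie_of_products_def e_nth)

lemma iso_L_6_17:
  assumes "span {x1, x2, x3, x4, x5, x6} = UNIV"
    and "pair_brackets L [x1, x2, x3, x4, x5, x6] =
      [x3, x4, x5, x6, 0,
       x6, 0, 0, 0,
       0, 0, 0, 0, 0, 0]"
  shows "L \<cong>\<^sub>L L_6_17"
  unfolding L_6_17_def
  by (rule lie_isomorphic_product_algebra_6[OF _ assms(1)],
      rule nilpotent_lie_of_dim_models(8)[unfolded L_6_17_def])
    (simp add: assms(2)[simplified] lie_of_products_def e_nth)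

lemma iso_L_6_18:
  assumes "span {x1, x2, x3, x4, x5, x6} = UNIV"
    and "pair_brackets L [x1, x2, x3, x4, x5, x6] =
      [x3, x4, x5, x6, 0,
       0, 0, 0, 0,
       0, 0, 0, 0, 0, 0]"
  shows "L \<cong>\<^sub>L L_6_18"
  unfolding L_6_18_def
  by (rule lie_isomorphic_product_algebra_6[OF _ assms(1)],
      rule nilpotent_lie_of_dim_models(9)[unfolded L_6_18_def])
    (simp add: assms(2)[simplified] lie_of_products_def e_nth)

lemma iso_L_6_19:
  assumes "span {x1, x2, x3, x4, x5, x6} = UNIV"
    and "pair_brackets L [x1, x2, x3, x4, x5, x6] =
      [x4, x5, 0, 0, 0,
       0, x6, 0, 0,
       0, eps \<cdot> x6, 0, 0, 0, 0]"
  shows "L \<cong>\<^sub>L L_6_19 eps"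
  unfolding L_6_19_def
  by (rule lie_isomorphic_product_algebra_6[OF _ assms(1)],
      rule nilpotent_lie_of_dim_models(10)[unfolded L_6_19_def])
    (simp add: assms(2)[simplified] lie_of_products_def e_nth)

lemma iso_L_6_20:
  assumes "span {x1, x2, x3, x4, x5, x6} = UNIV"
    and "pair_brackets L [x1, x2, x3, x4, x5, x6] =
      [x4, x5, 0, x6, 0,
       0, x6, 0, 0,
       0, 0, 0, 0, 0, 0]"
  shows "L \<cong>\<^sub>L L_6_20"
  unfolding L_6_20_def
  by (rule lie_isomorphic_product_algebra_6[OF _ assms(1)],
      rule nilpotent_lie_of_dim_models(11)[unfolded L_6_20_def])
    (simp add: assms(2)[simplified] lie_of_products_def e_nth)

lemma iso_L_6_21:
  assumes "span {x1, x2, x3, x4, x5, x6} = UNIV"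
    and "pair_brackets L [x1, x2, x3, x4, x5, x6] =
      [x3, x4, x6, 0, 0,
       x5, 0, eps \<cdot> x6, 0,
       0, 0, 0, 0, 0, 0]"
  shows "L \<cong>\<^sub>L L_6_21 eps"
  unfolding L_6_21_def
  by (rule lie_isomorphic_product_algebra_6[OF _ assms(1)],
      rule nilpotent_lie_of_dim_models(12)[unfolded L_6_21_def])
    (simp add: assms(2)[simplified] lie_of_products_def e_nth)

lemma iso_L_6_22:
  assumes "span {x1, x2, x3, x4, x5, x6} = UNIV"
    and "pair_brackets L [x1, x2, x3, x4, x5, x6] =
      [x5, x6, 0, 0, 0,
       0, eps \<cdot> x6, 0, 0,
       x5, 0, 0, 0, 0, 0]"
  shows "L \<cong>\<^sub>L L_6_22 eps"
  unfolding L_6_22_def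
  by (rule lie_isomorphic_product_algebra_6[OF _ assms(1)],
      rule nilpotent_lie_of_dim_models(13)[unfolded L_6_22_def])
    (simp add: assms(2)[simplified] lie_of_products_def e_nth)

lemma iso_L_6_23:
  assumes "span {x1, x2, x3, x4, x5, x6} = UNIV"
    and "pair_brackets L [x1, x2, x3, x4, x5, x6] =
      [x3, x5, x6, 0, 0,
       0, x5, 0, 0,
       0, 0, 0, 0, 0, 0]"
  shows "L \<cong>\<^sub>L L_6_23"
  unfolding L_6_23_def
  by (rule lie_isomorphic_product_algebra_6[OF _ assms(1)],
      rule nilpotent_lie_of_dim_models(14)[unfolded L_6_23_def])
    (simp add: assms(2)[simplified] lie_of_products_def e_nth)

lemma iso_L_6_24:
  assumes "span {x1, x2, x3, x4, x5, x6} = UNIV"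
    and "pair_brackets L [x1, x2, x3, x4, x5, x6] =
      [x3, x5, eps \<cdot> x6, 0, 0,
       x6, x5, 0, 0,
       0, 0, 0, 0, 0, 0]"
  shows "L \<cong>\<^sub>L L_6_24 eps"
  unfolding L_6_24_def
  by (rule lie_isomorphic_product_algebra_6[OF _ assms(1)],
      rule nilpotent_lie_of_dim_models(15)[unfolded L_6_24_def])
    (simp add: assms(2)[simplified] lie_of_products_def e_nth)

lemma iso_L_6_25:
  assumes "span {x1, x2, x3, x4, x5, x6} = UNIV"
    and "pair_brackets L [x1, x2, x3, x4, x5, x6] =
      [x3, x5, x6, 0, 0,
       0, 0, 0, 0,
       0, 0, 0, 0, 0, 0]"
  shows "L \<cong>\<^sub>L L_6_25"
  unfolding L_6_25_def
  by (rule lie_isomorphic_product_algebra_6[OF _ assms(1)],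
      rule nilpotent_lie_of_dim_models(16)[unfolded L_6_25_def])
    (simp add: assms(2)[simplified] lie_of_products_def e_nth)

lemma iso_L_6_26:
  assumes "span {x1, x2, x3, x4, x5, x6} = UNIV"
    and "pair_brackets L [x1, x2, x3, x4, x5, x6] =
      [x4, x5, 0, 0, 0,
       x6, 0, 0, 0,
       0, 0, 0, 0, 0, 0]"
  shows "L \<cong>\<^sub>L L_6_26"
  unfolding L_6_26_def
  by (rule lie_isomorphic_product_algebra_6[OF _ assms(1)],
      rule nilpotent_lie_of_dim_models(17)[unfolded L_6_26_def])
    (simp add: assms(2)[simplified] lie_of_products_def e_nth)

end

section \<open>The lower central series\<close>

declare lower_central.simps(2) [simp del]

context lie_algebra
begin

lemma subspace_lower_central: "subspace (lower_central L n)"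
  by (cases n) (simp_all add: lower_central.simps(2))

lemma bracket_in_lower_central_Suc: "y \<in> lower_central L n \<Longrightarrow> \<langle>x, y\<rangle> \<in> lower_central L (Suc n)"
  by (auto simp: lower_central.simps(2) intro: span_base)

lemma lower_central_Suc_subset: "lower_central L (Suc n) \<subseteq> lower_central L n"
proof (induction n)
  case 0
  show ?case by simp
next
  case (Suc n)
  then have "{\<langle>x, y\<rangle> | x y. y \<in> lower_central L (Suc n)} \<subseteq> lower_central L (Suc n)"
    using bracket_in_lower_central_Suc by blast
  then show ?case
    using span_minimal[OF _ subspace_lower_central] by (subst lower_central.simps(2))
qed

lemma lower_central_antimono: "m \<le> n \<Longrightarrow> lower_central L n \<subseteq> lower_central L m"
  using lower_central_Suc_subset by (rule lift_Suc_antimono_le)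

text \<open>The series is numbered from 0, whence the successor: in the usual numbering from 1 the
  index of a bracket is the sum of the indices.\<close>

lemma bracket_lower_central:
  "x \<in> lower_central L i \<Longrightarrow> y \<in> lower_central L j \<Longrightarrow> \<langle>x, y\<rangle> \<in> lower_central L (Suc (i + j))"
proof (induction i arbitrary: x y j)
  case 0
  then show ?case by (simp add: bracket_in_lower_central_Suc)
next
  case (Suc i)
  let ?V = "{x. \<forall>y\<in>lower_central L j. \<langle>x, y\<rangle> \<in> lower_central L (Suc (Suc i + j))}"
  note sub = subspace_lower_central[of "Suc (Suc i + j)"]
  have "subspace ?V"
  proof (rule subspaceI)
    show "0 \<in> ?V"
      using subspace_0[OF sub] by simp
    show "x + y \<in> ?V" if "x \<in> ?V" "y \<in> ?V" for x y
      using subspace_add[OF sub] that by simp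
    show "c \<cdot> x \<in> ?V" if "x \<in> ?V" for c x
      using subspace_scale[OF sub] that by simp
  qed
  \<comment> \<open>By Jacobi this is \<open>[u, [w, y]] - [w, [u, y]]\<close>; the induction
    hypothesis applies to \<open>[w, y]\<close> with \<open>j\<close> and to
    \<open>[w, [u, y]]\<close> with \<open>j + 1\<close>, so \<open>j\<close> has to be
    arbitrary.\<close>
  moreover have "\<langle>\<langle>u, w\<rangle>, y\<rangle> \<in> lower_central L (Suc (Suc i + j))"
    if "w \<in> lower_central L i" "y \<in> lower_central L j" for u w y
    using bracket_in_lower_central_Suc[OF Suc.IH[OF that], of u]
      Suc.IH[OF that(1) bracket_in_lower_central_Suc[OF that(2)]]
    by (simp add: jacobi_left subspace_diff[OF subspace_lower_central])
  ultimately have "lower_central L (Suc i) \<subseteq> ?V"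
    unfolding lower_central.simps(2) by (intro span_minimal) auto
  then show ?case using Suc.prems by blast
qed

lemma bracket_in_span:
  assumes "\<And>a b. a \<in> A \<Longrightarrow> b \<in> B \<Longrightarrow> \<langle>a, b\<rangle> \<in> S" "subspace S" "x \<in> span A" "y \<in> span B"
  shows "\<langle>x, y\<rangle> \<in> S"
proof -
  have "\<langle>a, y\<rangle> \<in> S" if "a \<in> A" for a
    using assms(4)
  proof (induction rule: span_induct_alt)
    case (step c b y)
    then show ?case
      using assms(1)[OF that] assms(2) by (simp add: subspace_add subspace_scale)
  qed (simp add: assms(2) subspace_0)
  with assms(3) show ?thesis
  proof (induction rule: span_induct_alt)
    case (step c b y)
    then show ?case
      using assms(2) by (simp add: subspace_add subspace_scale)
  qed (simp add: assms(2) subspace_0)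
qed

text \<open>A layer of the series is spanned by brackets of generators with representatives of the
  layer before it: replacing the left factor by an element of \<open>lower_central L 1\<close>, or
  the right factor by one of the next term, moves the bracket one layer deeper. Every basis below is
  built by iterating this.\<close>

lemma lower_central_eq_span:
  assumes "span (A \<union> lower_central L 1) = UNIV"
    and "lower_central L n = span (B \<union> lower_central L (Suc n))"
  shows "lower_central L (Suc n) =
    span ({\<langle>a, b\<rangle> | a b. a \<in> A \<and> b \<in> B} \<union> lower_central L (Suc (Suc n)))" (is "_ = ?S")
proof
  have B: "B \<subseteq> lower_central L n"
    unfolding assms(2) by (auto intro: span_base)
  have "\<langle>x, y\<rangle> \<in> ?S" if "y \<in> lower_central L n" for x y
  proof (rule bracket_in_span)
    show "x \<in> span (A \<union> lower_central L 1)" "y \<in> span (B \<union> lower_central L (Suc n))"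
      using assms that by simp_all
    fix a b
    assume a: "a \<in> A \<union> lower_central L 1" and b: "b \<in> B \<union> lower_central L (Suc n)"
    have *: "b \<in> lower_central L n"
      using b B lower_central_Suc_subset by blast
    consider "a \<in> A" "b \<in> B" | "a \<in> lower_central L 1" | "b \<in> lower_central L (Suc n)"
      using a b by blast
    then show "\<langle>a, b\<rangle> \<in> ?S"
    proof cases
      case 2
      with * show ?thesis
        using bracket_lower_central[of a 1 b n] by (auto intro: span_base)
    next
      case 3
      then show ?thesis
        using bracket_in_lower_central_Suc by (auto intro: span_base)
    qed (auto intro: span_base)
  qed simp
  then show "lower_central L (Suc n) \<subseteq> ?S"
    unfolding lower_central.simps(2) by (intro span_minimal subspace_span) blast
  show "?S \<subseteq> lower_central L (Suc n)"
    using B lower_central_Suc_subset bracket_in_lower_central_Suc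
    by (intro span_minimal subspace_lower_central) blast
qed

section \<open>Changes of spanning sets\<close>

lemma span_Un_span_right: "span (A \<union> span B) = span (A \<union> B)"
proof (rule antisym)
  show "span (A \<union> span B) \<subseteq> span (A \<union> B)"
    by (intro span_minimal subspace_span) (use span_mono[of B "A \<union> B"] span_base in blast)
  show "span (A \<union> B) \<subseteq> span (A \<union> span B)"
    by (intro span_mono) (use span_base in blast)
qed

lemma span_insert_span: "span (insert a (span B)) = span (insert a B)"
  using span_Un_span_right[of "{a}" B] by simp

lemma mem_span_if_combination_mem:
  assumes "c \<cdot> x + w \<in> span S" "c \<noteq> 0" "w \<in> span S"
  shows "x \<in> span S"
proof -
  have "inverse c \<cdot> (c \<cdot> x + w - w) \<in> span S"
    using assms by (intro span_scale span_diff)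
  then show ?thesis using assms(2) by simp
qed

lemma mem_span_insertE:
  assumes "x \<in> span (insert a S)" "subspace S"
  obtains c where "x - c \<cdot> a \<in> S"
  using assms by (auto simp: span_breakdown_eq span_eq_iff[THEN iffD2])

text \<open>One step of triangular elimination: \<open>T\<close> is the old tail and
  \<open>S\<close> the new one with the same span, and modulo that span \<open>x'\<close> is a
  nonzero multiple of \<open>x\<close>.\<close>

lemma span_insert_cong:
  assumes "c \<noteq> 0" "x' - c \<cdot> x \<in> span T" "span S = span T"
  shows "span (insert x' S) = span (insert x T)"
proof -
  have *: "span T \<subseteq> span (insert y T)" for y by (rule span_mono) blast
  have "x' = (x' - c \<cdot> x) + c \<cdot> x" by simp
  also have "\<dots> \<in> span (insert x T)"
    using assms(2) * by (intro span_add span_scale span_base[of x]) auto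
  finally have 1: "x' \<in> span (insert x T)" .
  have "c \<cdot> x + (x' - c \<cdot> x) \<in> span (insert x' T)"
    by (simp add: span_base)
  then have "x \<in> span (insert x' T)"
    by (rule mem_span_if_combination_mem) (use assms * in auto)
  with 1 have "span (insert x' T) = span (insert x T)"
    unfolding span_eq by (auto intro: span_base)
  then show ?thesis
    using assms(3) by (metis span_insert_span)
qed

text \<open>Every change of basis below is triangular after a permutation of the basis.\<close>

lemma span_triangular_change:
  assumes "span {x1, x2, x3, x4, x5, x6} = UNIV"
    and "c1 \<noteq> 0" "c2 \<noteq> 0" "c3 \<noteq> 0" "c4 \<noteq> 0" "c5 \<noteq> 0" "c6 \<noteq> 0"
    and "y1 - c1 \<cdot> x1 \<in> span {x2, x3, x4, x5, x6}" "y2 - c2 \<cdot> x2 \<in> span {x3, x4, x5, x6}"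
    and "y3 - c3 \<cdot> x3 \<in> span {x4, x5, x6}" "y4 - c4 \<cdot> x4 \<in> span {x5, x6}"
    and "y5 - c5 \<cdot> x5 \<in> span {x6}" "y6 = c6 \<cdot> x6"
  shows "span {y1, y2, y3, y4, y5, y6} = UNIV"
proof -
  have "span {y1, y2, y3, y4, y5, y6} = span {x1, x2, x3, x4, x5, x6}"
    by (rule span_insert_cong[OF assms(2,8) span_insert_cong[OF assms(3,9)
          span_insert_cong[OF assms(4,10) span_insert_cong[OF assms(5,11)
          span_insert_cong[OF assms(6,12) span_insert_cong[OF assms(7)]]]]]])
      (simp_all add: assms(13))
  with assms(1) show ?thesis by simp
qed

lemma span_insert_uminus: "span (insert (- x) S) = span (insert x S)"
  by (rule span_insert_cong[of "-1"]) (simp_all add: span_zero)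

lemma span_Un_change:
  assumes "span (A \<union> S) = UNIV" "A \<subseteq> span (A' \<union> S)"
  shows "span (A' \<union> S) = UNIV"
proof -
  have "span (A \<union> S) \<subseteq> span (A' \<union> S)"
    using assms(2) by (intro span_minimal) (auto intro: span_base)
  with assms(1) show ?thesis by auto
qed

lemma span_generators_change:
  assumes "span ({x, y} \<union> S) = UNIV" "x \<in> span ({x', y'} \<union> S)" "y \<in> span ({x', y'} \<union> S)"
  shows "span ({x', y'} \<union> S) = UNIV"
  using span_Un_change[OF assms(1), of "{x', y'}"] assms(2,3) by simp

lemma span_three_generators_change:
  assumes "span ({x, y, z} \<union> S) = UNIV"
    and "x \<in> span ({x', y', z'} \<union> S)" "y \<in> span ({x', y', z'} \<union> S)" "z \<in> span ({x', y', z'} \<union> S)"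
  shows "span ({x', y', z'} \<union> S) = UNIV"
  using span_Un_change[OF assms(1), of "{x', y', z'}"] assms(2-4) by simp

lemma span_Un_eqI:
  assumes "A \<subseteq> span (B \<union> S)" "B \<subseteq> span (A \<union> S)"
  shows "span (A \<union> S) = span (B \<union> S)"
  unfolding span_eq using assms span_base by blast

lemma mem_span_pair:
  assumes "v \<in> span {p, q}"
  obtains a b where "v = a \<cdot> p + b \<cdot> q"
proof -
  obtain a where "v - a \<cdot> p \<in> span {q}"
    using assms by (auto simp: span_breakdown_eq[of _ p])
  then obtain b where "v - a \<cdot> p = b \<cdot> q"
    by (auto simp: span_singleton)
  then have "v = a \<cdot> p + b \<cdot> q" by (metis add.commute diff_add_cancel)
  then show ?thesis by (rule that)
qed

end

section \<open>Dimension counts\<close>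

locale finite_dimensional_lie_algebra =
  lie_algebra L + finite_dimensional_vector_space "scl L" Basis
  for L :: "('a::field, 'v::ab_group_add) lie" and Basis
begin

lemma dim_span_insert_le: "dim (span (insert a S)) \<le> dim S + 1"
  by (simp add: dim_insert)

lemma span_insert_eq_if_dim:
  assumes "subspace T" "subspace S" "a \<in> T" "a \<notin> S" "S \<subseteq> T" "dim T \<le> dim S + 1"
  shows "T = span (insert a S)"
proof -
  have "a \<notin> span S" using assms by (simp add: span_eq_iff[THEN iffD2])
  then have "dim T \<le> dim (insert a S)"
    using assms by (simp add: dim_insert)
  with dim_eq_span[of "insert a S" T] show ?thesis
    using assms by (simp add: span_eq_iff[THEN iffD2])
qed

text \<open>A list is returned so that its entries can be named by a case analysis on the
  length.\<close>

lemma obtain_complement: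
  assumes "dim UNIV = dim S + r"
  obtains xs where "length xs = r" "span (set xs \<union> S) = UNIV"
proof -
  have "\<exists>xs. length xs = r \<and> span (set xs \<union> S) = UNIV"
    using assms
  proof (induction r arbitrary: S)
    case 0
    then have "span S = span UNIV"
      by (intro dim_eq_span) simp_all
    then show ?case by simp
  next
    case (Suc r)
    then have "span S \<noteq> UNIV"
      by (metis dim_span add_Suc_right less_add_Suc1 nat_less_le)
    then obtain x where x: "x \<notin> span S" by blast
    with Suc.prems have "dim UNIV = dim (insert x S) + r"
      by (simp add: dim_insert del: dim_UNIV)
    then obtain xs where xs: "length xs = r" "span (set xs \<union> insert x S) = UNIV"
      using Suc.IH by blast
    then show ?case
      by (intro exI[of _ "x # xs"]) simp
  qed
  then show ?thesis using that by blast
qed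

lemma obtain_spanning_vector:
  assumes "subspace S" "dim S = 1"
  obtains z where "z \<noteq> 0" "S = span {z}"
proof -
  obtain z where z: "z \<in> S" "z \<noteq> 0"
    using assms by (metis dim_eq_0 subsetI singletonI zero_neq_one)
  then have "S = span (insert z {0})"
    using assms by (intro span_insert_eq_if_dim) (auto simp: subspace_0)
  then show ?thesis
    using that z by (metis insert_commute span_insert_0)
qed

text \<open>Otherwise adjoining \<open>c\<close>, \<open>b\<close> and \<open>a\<close> in turn to
  \<open>S\<close> would raise the dimension three times.\<close>

lemma dependent_triple:
  assumes "dim (span ({a, b, c} \<union> S)) \<le> dim S + 2"
  shows "c \<in> span ({a, b} \<union> S) \<or> b \<in> span ({a, c} \<union> S) \<or> a \<in> span ({b, c} \<union> S)"
proof (rule ccontr)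
  assume not: "\<not> ?thesis"
  have "span ({c} \<union> S) \<subseteq> span ({a, c} \<union> S)" "span S \<subseteq> span ({a, b} \<union> S)"
    by (rule span_mono; blast)+
  with not have "a \<notin> span ({b, c} \<union> S)" "b \<notin> span ({c} \<union> S)" "c \<notin> span S"
    by auto
  then have "dim (span ({a, b, c} \<union> S)) = dim S + 3"
    by (simp add: dim_insert)
  with assms show False by simp
qed

lemma dim_span_Un_le_card: "finite A \<Longrightarrow> dim (span (A \<union> S)) \<le> dim S + card A"
  by (induction A rule: finite_induct) (auto simp: dim_insert)

text \<open>The entries of the list are distinct, since fewer than \<open>r\<close> vectors cannot
  bridge a gap of \<open>r\<close> in dimension. As a set they can be split into the vectors picked
  for some property and the rest.\<close>

lemma obtain_complement_set:
  assumes "dim UNIV = dim S + r"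
  obtains B where "finite B" "card B = r" "span (B \<union> S) = UNIV"
proof -
  obtain xs where xs: "length xs = r" "span (set xs \<union> S) = UNIV"
    using obtain_complement[OF assms] .
  have "dim S + r \<le> dim S + card (set xs)"
    using dim_span_Un_le_card[of "set xs" S] xs(2) assms by simp
  then have "card (set xs) = r"
    using card_length[of xs] xs(1) by simp
  with xs(2) show ?thesis using that by blast
qed

end

locale nilpotent_lie_algebra = finite_dimensional_lie_algebra L Basis
  for L :: "('a::field, 'v::ab_group_add) lie" and Basis +
  assumes nilpotent: "nilpotent_lie L"
begin

text \<open>Each term determines the next, so a series that stops once stays constant; nilpotency
  makes the constant value \<open>{0}\<close>. Strict descent of the dimensions follows.\<close>

lemma lower_central_eq_0_if_stationary:
  assumes "lower_central L (Suc n) = lower_central L n"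
  shows "lower_central L n = {0}"
proof -
  have *: "lower_central L (n + m) = lower_central L n" for m
  proof (induction m)
    case (Suc m)
    then show ?case
      using assms by (simp add: lower_central.simps(2))
  qed simp
  obtain m where m: "lower_central L m = {0}"
    using nilpotent unfolding nilpotent_lie_def by blast
  have "lower_central L (n + m) \<subseteq> lower_central L m"
    by (simp add: lower_central_antimono)
  then show ?thesis
    using * m subspace_0[OF subspace_lower_central[of n]] by fastforce
qed

lemma dim_lower_central_less:
  assumes "dim (lower_central L n) \<noteq> 0"
  shows "dim (lower_central L (Suc n)) < dim (lower_central L n)"
proof -
  have "lower_central L (Suc n) \<noteq> lower_central L n"
    using lower_central_eq_0_if_stationary assms by force
  then show ?thesis
    using subspace_dim_equal[OF subspace_lower_central subspace_lower_central lower_central_Suc_subset]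
    by (meson not_le)
qed

lemma lower_central_Suc_eq_0:
  assumes "dim (lower_central L n) \<le> 1"
  shows "lower_central L (Suc n) = {0}"
proof -
  have "dim (lower_central L (Suc n)) = 0"
    using assms dim_lower_central_less[of n] dim_subset[OF lower_central_Suc_subset[of n]] by linarith
  then show ?thesis
    using subspace_0[OF subspace_lower_central] by (simp only: dim_eq_0) blast
qed

end

locale nilpotent_lie_algebra_6 = nilpotent_lie_algebra L Basis + lie_algebra_6 L
  for L :: "('a::field, 'v::ab_group_add) lie" and Basis

section \<open>The layers of the lower central series in terms of generators\<close>

context nilpotent_lie_algebra
begin

declare One_nat_def [simp del]

abbreviation D :: "nat \<Rightarrow> 'v set" where "D \<equiv> lower_central L"

lemma zero_mem_D [simp]: "0 \<in> D n"
  by (rule subspace_0[OF subspace_lower_central])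

lemma bracket_mem_D:
  assumes "x \<in> D i" "y \<in> D j" "k \<le> Suc (i + j)"
  shows "\<langle>x, y\<rangle> \<in> D k"
  using bracket_lower_central[OF assms(1,2)] lower_central_antimono[OF assms(3)] by blast

lemma bracket_mem_D_1: "\<langle>x, y\<rangle> \<in> D 1"
  by (rule bracket_mem_D[of x 0 y 0]) simp_all

lemma bracket_mem_D_2:
  "y \<in> D 1 \<Longrightarrow> \<langle>x, y\<rangle> \<in> D 2"
  "x \<in> D 1 \<Longrightarrow> \<langle>x, y\<rangle> \<in> D 2"
  by (rule bracket_mem_D[of _ 0 _ 1] bracket_mem_D[of _ 1 _ 0]; simp)+

lemma bracket_mem_D_3:
  "y \<in> D 2 \<Longrightarrow> \<langle>x, y\<rangle> \<in> D 3"
  "x \<in> D 2 \<Longrightarrow> \<langle>x, y\<rangle> \<in> D 3"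
  "x \<in> D 1 \<Longrightarrow> y \<in> D 1 \<Longrightarrow> \<langle>x, y\<rangle> \<in> D 3"
  by (rule bracket_mem_D[of _ 0 _ 2] bracket_mem_D[of _ 2 _ 0] bracket_mem_D[of _ 1 _ 1]; simp; fail)+

lemma bracket_mem_D_4:
  "y \<in> D 3 \<Longrightarrow> \<langle>x, y\<rangle> \<in> D 4"
  "x \<in> D 3 \<Longrightarrow> \<langle>x, y\<rangle> \<in> D 4"
  "x \<in> D 1 \<Longrightarrow> y \<in> D 2 \<Longrightarrow> \<langle>x, y\<rangle> \<in> D 4"
  "x \<in> D 2 \<Longrightarrow> y \<in> D 1 \<Longrightarrow> \<langle>x, y\<rangle> \<in> D 4"
  by (rule bracket_mem_D[of _ 0 _ 3] bracket_mem_D[of _ 3 _ 0] bracket_mem_D[of _ 1 _ 2]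
      bracket_mem_D[of _ 2 _ 1]; simp; fail)+

lemma bracket_mem_D_5:
  "y \<in> D 4 \<Longrightarrow> \<langle>x, y\<rangle> \<in> D 5"
  "x \<in> D 4 \<Longrightarrow> \<langle>x, y\<rangle> \<in> D 5"
  "x \<in> D 1 \<Longrightarrow> y \<in> D 3 \<Longrightarrow> \<langle>x, y\<rangle> \<in> D 5"
  "x \<in> D 3 \<Longrightarrow> y \<in> D 1 \<Longrightarrow> \<langle>x, y\<rangle> \<in> D 5"
  "x \<in> D 2 \<Longrightarrow> y \<in> D 2 \<Longrightarrow> \<langle>x, y\<rangle> \<in> D 5"
  by (rule bracket_mem_D[of _ 0 _ 4] bracket_mem_D[of _ 4 _ 0] bracket_mem_D[of _ 1 _ 3]
      bracket_mem_D[of _ 3 _ 1] bracket_mem_D[of _ 2 _ 2]; simp; fail)+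

lemmas bracket_mem = bracket_mem_D_1 bracket_mem_D_2 bracket_mem_D_3 bracket_mem_D_4 bracket_mem_D_5

lemma mem_D_antimono: "x \<in> D j \<Longrightarrow> i \<le> j \<Longrightarrow> x \<in> D i"
  using lower_central_antimono by blast

lemma D_eq_span:
  assumes "span (A \<union> D 1) = UNIV" "D n = span (B \<union> D m)" "m = Suc n" "k = Suc m"
    and "C = {\<langle>a, b\<rangle> | a b. a \<in> A \<and> b \<in> B}"
  shows "D m = span (C \<union> D k)"
  using lower_central_eq_span[of A n B] assms by simp

lemma D_1_eq_span:
  assumes "span (A \<union> D 1) = UNIV"
  shows "D 1 = span ({\<langle>a, b\<rangle> | a b. a \<in> A \<and> b \<in> A} \<union> D 2)"
  by (rule D_eq_span[OF assms, of 0]) (use assms in \<open>simp_all add: numeral_2_eq_2 One_nat_def\<close>)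

lemma D_1_two_generators:
  assumes "span ({x, y} \<union> D 1) = UNIV"
  shows "D 1 = span ({\<langle>x, y\<rangle>} \<union> D 2)"
proof -
  have "span ({\<langle>a, b\<rangle> | a b. a \<in> {x, y} \<and> b \<in> {x, y}} \<union> D 2) = span ({\<langle>x, y\<rangle>} \<union> D 2)"
    (is "span (?A \<union> _) = _")
  proof (rule span_eq[THEN iffD2], rule conjI)
    have "?A \<subseteq> span ({\<langle>x, y\<rangle>} \<union> D 2)"
      using bracket_commute[of y x] by (auto intro: span_base span_zero span_neg[OF span_base])
    then show "?A \<union> D 2 \<subseteq> span ({\<langle>x, y\<rangle>} \<union> D 2)"
      by (auto intro: span_base)
    have "\<langle>x, y\<rangle> \<in> ?A" by blast
    then show "{\<langle>x, y\<rangle>} \<union> D 2 \<subseteq> span (?A \<union> D 2)"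
      by (auto intro: span_base)
  qed
  then show ?thesis
    using D_1_eq_span[OF assms] by simp
qed

lemma D_2_two_generators:
  assumes "span ({x, y} \<union> D 1) = UNIV"
  shows "D 2 = span ({\<langle>x, \<langle>x, y\<rangle>\<rangle>, \<langle>y, \<langle>x, y\<rangle>\<rangle>} \<union> D 3)"
  by (rule D_eq_span[OF assms D_1_two_generators[OF assms]]) auto

lemma D_3_two_generators:
  assumes "span ({x, y} \<union> D 1) = UNIV"
  shows "D 3 = span ({\<langle>x, \<langle>x, \<langle>x, y\<rangle>\<rangle>\<rangle>, \<langle>x, \<langle>y, \<langle>x, y\<rangle>\<rangle>\<rangle>, \<langle>y, \<langle>x, \<langle>x, y\<rangle>\<rangle>\<rangle>,
    \<langle>y, \<langle>y, \<langle>x, y\<rangle>\<rangle>\<rangle>} \<union> D 4)"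
  by (rule D_eq_span[OF assms D_2_two_generators[OF assms]]) auto

lemma D_eq_span_insert:
  assumes "a \<in> D i" "a \<notin> D j" "i \<le> j" "dim (D i) \<le> dim (D j) + 1"
  shows "D i = span ({a} \<union> D j)"
  using span_insert_eq_if_dim[OF subspace_lower_central subspace_lower_central assms(1,2)
      lower_central_antimono[OF assms(3)] assms(4)]
  by simp

lemma D_1_three_generators:
  assumes "span ({x, y, z} \<union> D 1) = UNIV"
  shows "D 1 = span ({\<langle>x, y\<rangle>, \<langle>x, z\<rangle>, \<langle>y, z\<rangle>} \<union> D 2)"
proof -
  let ?B = "{\<langle>x, y\<rangle>, \<langle>x, z\<rangle>, \<langle>y, z\<rangle>}"
  have "span ({\<langle>a, b\<rangle> | a b. a \<in> {x, y, z} \<and> b \<in> {x, y, z}} \<union> D 2) = span (?B \<union> D 2)"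
    (is "span (?A \<union> _) = _")
  proof (rule span_Un_eqI)
    have *: "\<langle>x, y\<rangle> \<in> span (?B \<union> D 2)" "\<langle>x, z\<rangle> \<in> span (?B \<union> D 2)" "\<langle>y, z\<rangle> \<in> span (?B \<union> D 2)"
      by (simp_all add: span_base)
    from this[THEN span_neg] have
      "\<langle>y, x\<rangle> \<in> span (?B \<union> D 2)" "\<langle>z, x\<rangle> \<in> span (?B \<union> D 2)" "\<langle>z, y\<rangle> \<in> span (?B \<union> D 2)"
      unfolding bracket_commute[of y x] bracket_commute[of z x] bracket_commute[of z y] .
    with * have "\<langle>a, b\<rangle> \<in> span (?B \<union> D 2)" if "a \<in> {x, y, z}" "b \<in> {x, y, z}" for a b
      using that by (elim insertE emptyE) (simp_all only: bracket_self span_zero)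
    then show "?A \<subseteq> span (?B \<union> D 2)"
      by blast
    have "\<langle>x, y\<rangle> \<in> ?A" "\<langle>x, z\<rangle> \<in> ?A" "\<langle>y, z\<rangle> \<in> ?A" by blast+
    then show "?B \<subseteq> span (?A \<union> D 2)"
      by (simp add: span_base)
  qed
  then show ?thesis
    using D_1_eq_span[OF assms] by simp
qed

end

section \<open>Classification by the dimensions of the lower central series\<close>

text \<open>A lemma \<open>type_d0_d1_\<dots>\<close> treats the algebras with \<open>dim (D i / D (i + 1)) = d\<^sub>i\<close>.\<close>

context nilpotent_lie_algebra_6
begin

subsection \<open>Two generators\<close>

lemma obtain_two_generators:
  assumes "dim (D 1) = 4"
  obtains x y where "span ({x, y} \<union> D 1) = UNIV"
proof -
  obtain xs where "length xs = 2" "span (set xs \<union> D 1) = UNIV"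
    using obtain_complement[of "D 1" 2] assms dim_UNIV_6 by auto
  then show ?thesis
    using that by (auto simp: length_Suc_conv numeral_2_eq_2)
qed

text \<open>On the plane spanned by the generators, \<open>(a, b) \<mapsto> [a, [b, [u, v]]]\<close>
  is a bilinear form with values in the line \<open>D 3\<close>. It is symmetric because
  \<open>[[u, v], [u, v]] = 0\<close>. A non-isotropic \<open>u\<close> and a vector
  \<open>v'\<close> orthogonal to it diagonalise the form; \<epsilon> is its value at
  \<open>v'\<close> relative to its value \<open>x6\<close> at \<open>u\<close>.\<close>

lemma type_2_1_2_1:
  assumes two: "(2::'a) \<noteq> 0" and dims: "dim (D 1) = 4" "dim (D 3) = 1"
  shows "\<exists>eps. L \<cong>\<^sub>L L_6_21 eps"
proof -
  have D4: "D 4 = {0}"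
    using lower_central_Suc_eq_0[of 3] dims by simp
  obtain x y where xy: "span ({x, y} \<union> D 1) = UNIV"
    using obtain_two_generators[OF dims(1)] .
  obtain z where z: "z \<noteq> 0" "D 3 = span {z}"
    using obtain_spanning_vector[OF subspace_lower_central dims(2)] .
  have mixed: "\<langle>u, \<langle>v, \<langle>u, v\<rangle>\<rangle>\<rangle> = \<langle>v, \<langle>u, \<langle>u, v\<rangle>\<rangle>\<rangle>" for u v
    using jacobi_left[of u v "\<langle>u, v\<rangle>"] by simp
  have "\<exists>u v. span ({u, v} \<union> D 1) = UNIV \<and> \<langle>u, \<langle>u, \<langle>u, v\<rangle>\<rangle>\<rangle> \<noteq> 0"
  proof (rule ccontr)
    assume "\<not> ?thesis"
    then have *: "\<langle>u, \<langle>u, \<langle>u, v\<rangle>\<rangle>\<rangle> = 0" if "span ({u, v} \<union> D 1) = UNIV" for u v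
      using that by blast
    have 1: "\<langle>x, \<langle>x, \<langle>x, y\<rangle>\<rangle>\<rangle> = 0" using * xy .
    have "\<langle>y, \<langle>y, \<langle>y, x\<rangle>\<rangle>\<rangle> = 0"
      by (rule *) (use xy in \<open>simp add: insert_commute\<close>)
    then have 2: "\<langle>y, \<langle>y, \<langle>x, y\<rangle>\<rangle>\<rangle> = 0"
      by (simp add: bracket_commute[of y x])
    \<comment> \<open>Polarisation: \<open>[x + y, y] = [x, y]\<close>, so the form vanishing at
      \<open>x\<close>, \<open>y\<close> and \<open>x + y\<close> has twice its mixed value equal to
      zero.\<close>
    have "\<langle>x + y, \<langle>x + y, \<langle>x + y, y\<rangle>\<rangle>\<rangle> = 0"
    proof (rule *, rule span_generators_change[OF xy])
      have "x = (x + y) - y" by simp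
      also have "\<dots> \<in> span ({x + y, y} \<union> D 1)"
        by (intro span_diff span_base) simp_all
      finally show "x \<in> span ({x + y, y} \<union> D 1)" .
    qed (auto intro: span_base)
    then have "1 \<cdot> \<langle>x, \<langle>y, \<langle>x, y\<rangle>\<rangle>\<rangle> + 1 \<cdot> \<langle>x, \<langle>y, \<langle>x, y\<rangle>\<rangle>\<rangle> = 0"
      using 1 2 mixed[of x y] by simp
    then have "2 \<cdot> \<langle>x, \<langle>y, \<langle>x, y\<rangle>\<rangle>\<rangle> = 0"
      by (simp only: scale_left_distrib[symmetric] one_add_one)
    then have "\<langle>x, \<langle>y, \<langle>x, y\<rangle>\<rangle>\<rangle> = 0" using two by simp
    then have "D 3 = span ({0, 0, 0, 0} \<union> D 4)"
      using D_3_two_generators[OF xy] 1 2 mixed[of x y] by metis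
    then have "D 3 = {0}" by (simp add: D4)
    with dims show False by simp
  qed
  then obtain u v where uv: "span ({u, v} \<union> D 1) = UNIV" "\<langle>u, \<langle>u, \<langle>u, v\<rangle>\<rangle>\<rangle> \<noteq> 0"
    by blast
  define x6 where "x6 = \<langle>u, \<langle>u, \<langle>u, v\<rangle>\<rangle>\<rangle>"
  have D3: "D 3 = span {x6}"
  proof -
    have "x6 \<in> D 3" by (simp add: x6_def bracket_mem)
    with uv(2) have "D 3 = span (insert x6 {0})"
      using dims by (intro span_insert_eq_if_dim subspace_lower_central) (auto simp: x6_def)
    then show ?thesis
      by (simp add: insert_commute)
  qed
  have "\<langle>u, \<langle>v, \<langle>u, v\<rangle>\<rangle>\<rangle> \<in> D 3"
    by (simp add: bracket_mem)
  then obtain t where t: "\<langle>u, \<langle>v, \<langle>u, v\<rangle>\<rangle>\<rangle> = t \<cdot> x6"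
    using D3 by (auto simp: span_singleton)
  \<comment> \<open>Orthogonal projection along \<open>u\<close>; it leaves \<open>[u, v]\<close>,
    and with it the form, unchanged.\<close>
  define v' where "v' = v - t \<cdot> u"
  have uv': "span ({u, v'} \<union> D 1) = UNIV"
  proof (rule span_generators_change[OF uv(1)])
    have "v' + t \<cdot> u \<in> span ({u, v'} \<union> D 1)"
      by (intro span_add span_scale span_base) simp_all
    then show "v \<in> span ({u, v'} \<union> D 1)"
      by (simp add: v'_def)
  qed (auto intro: span_base)
  define x3 where "x3 = \<langle>u, v'\<rangle>"
  define x4 where "x4 = \<langle>u, x3\<rangle>"
  define x5 where "x5 = \<langle>v', x3\<rangle>"
  have x3: "x3 = \<langle>u, v\<rangle>" by (simp add: x3_def v'_def)
  have x6: "\<langle>u, x4\<rangle> = x6" by (simp add: x4_def x3 x6_def)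
  have mem: "x3 \<in> D 1" "x4 \<in> D 2" "x5 \<in> D 2" "x6 \<in> D 3"
    unfolding x3_def x4_def x5_def x6_def
    by (simp_all add: bracket_mem)
  have b: "\<langle>u, v'\<rangle> = x3" "\<langle>u, x3\<rangle> = x4" "\<langle>u, x4\<rangle> = x6" "\<langle>v', x3\<rangle> = x5"
    by (simp_all add: x6 flip: x3_def x4_def x5_def)
  have "\<langle>u, x5\<rangle> = 0"
    using t by (simp add: x5_def v'_def x3 x6_def)
  then have "\<langle>v', x4\<rangle> = 0"
    using mixed[of u v'] b by simp
  have "\<langle>v', x5\<rangle> \<in> D 3"
    using mem by (simp add: bracket_mem)
  then obtain s where "\<langle>v', x5\<rangle> = s \<cdot> x6"
    using D3 by (auto simp: span_singleton)
  have zero: "\<langle>u, x6\<rangle> = 0" "\<langle>v', x6\<rangle> = 0" "\<langle>x3, x4\<rangle> = 0" "\<langle>x3, x5\<rangle> = 0" "\<langle>x3, x6\<rangle> = 0"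
    "\<langle>x4, x5\<rangle> = 0" "\<langle>x4, x6\<rangle> = 0" "\<langle>x5, x6\<rangle> = 0"
    using mem mem_D_antimono[of x6 3 1] mem_D_antimono[of x4 2 1] by (simp_all add: bracket_mem_D_4[unfolded D4 singleton_iff])
  have "span {u, v', x3, x4, x5, x6} = UNIV"
  proof -
    have "UNIV = span ({u, v'} \<union> span ({x3} \<union> span ({x4, x5} \<union> span {x6})))"
      using uv' D_1_two_generators[OF uv'] D_2_two_generators[OF uv'] D3 by (simp add: b)
    then show ?thesis unfolding span_Un_span_right by (simp add: insert_commute)
  qed
  moreover have "pair_brackets L [u, v', x3, x4, x5, x6] =
      [x3, x4, x6, 0, 0,
       x5, 0, s \<cdot> x6, 0,
       0, 0, 0, 0, 0, 0]"
    by (simp add: b zero \<open>\<langle>u, x5\<rangle> = 0\<close> \<open>\<langle>v', x4\<rangle> = 0\<close> \<open>\<langle>v', x5\<rangle> = s \<cdot> x6\<close>)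
  ultimately show ?thesis
    using iso_L_6_21 by blast
qed

text \<open>The map \<open>L / D 1 \<rightarrow> Hom (D 1 / D 2) (D 2 / D 3)\<close> has rank 1 here, and \<open>v\<close> spans its kernel.\<close>

definition filiform_pair :: "'v \<Rightarrow> 'v \<Rightarrow> bool" where
  "filiform_pair u v \<longleftrightarrow> span ({u, v} \<union> D 1) = UNIV \<and> \<langle>u, \<langle>u, v\<rangle>\<rangle> \<notin> D 3 \<and> \<langle>v, \<langle>u, v\<rangle>\<rangle> \<in> D 3"

text \<open>The layer \<open>D 2 / D 3\<close> is a line spanned by the classes of
  \<open>[x, w]\<close> and \<open>[y, w]\<close>. A multiple of the generator with nonzero class is
  subtracted from the other one to kill its class.\<close>

lemma obtain_filiform_pair:
  assumes "dim (D 1) = 4" "dim (D 2) = 3" "dim (D 3) = 2"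
  obtains u v where "filiform_pair u v"
proof -
  obtain x y where xy: "span ({x, y} \<union> D 1) = UNIV"
    using obtain_two_generators[OF assms(1)] .
  define w where "w = \<langle>x, y\<rangle>"
  have w: "\<langle>x, y\<rangle> = w" "\<langle>y, x\<rangle> = - w" "w \<in> D 1"
    using bracket_commute[of y x] by (simp_all add: w_def bracket_mem)
  have D2: "D 2 = span ({\<langle>x, w\<rangle>, \<langle>y, w\<rangle>} \<union> D 3)"
    using D_2_two_generators[OF xy] by (simp add: w)
  show ?thesis
  proof (cases "\<langle>x, w\<rangle> \<in> D 3")
    case False
    have "D 2 = span (insert \<langle>x, w\<rangle> (D 3))"
      using False assms w by (intro span_insert_eq_if_dim subspace_lower_central)
        (auto simp: bracket_mem mem_D_antimono[of _ 3 2])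
    then have "\<langle>y, w\<rangle> \<in> span (insert \<langle>x, w\<rangle> (D 3))"
      using bracket_mem_D_2(1)[OF w(3)] by blast
    then obtain t where t: "\<langle>y, w\<rangle> - t \<cdot> \<langle>x, w\<rangle> \<in> D 3"
      using mem_span_insertE subspace_lower_central by blast
    have "span ({x, y - t \<cdot> x} \<union> D 1) = UNIV"
    proof (rule span_generators_change[OF xy])
      have "(y - t \<cdot> x) + t \<cdot> x \<in> span ({x, y - t \<cdot> x} \<union> D 1)"
        by (intro span_add span_scale span_base) simp_all
      then show "y \<in> span ({x, y - t \<cdot> x} \<union> D 1)" by simp
    qed (auto intro: span_base)
    with False t have "filiform_pair x (y - t \<cdot> x)"
      by (simp add: filiform_pair_def w)
    then show ?thesis by (rule that)
  next
    case True
    have "\<langle>y, w\<rangle> \<notin> D 3"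
    proof
      assume "\<langle>y, w\<rangle> \<in> D 3"
      with True have "D 2 = D 3"
        unfolding D2 using span_eq_iff[THEN iffD2, OF subspace_lower_central[of 3]]
        by (simp add: insert_absorb)
      with assms show False by simp
    qed
    with True have "filiform_pair y x"
      using xy subspace_neg[OF subspace_lower_central[of 3], of "- \<langle>y, w\<rangle>"]
        subspace_neg[OF subspace_lower_central[of 3], of "\<langle>x, w\<rangle>"]
      by (auto simp: filiform_pair_def w insert_commute)
    then show ?thesis by (rule that)
  qed
qed

text \<open>Only \<open>a\<close>, \<open>p\<close>, \<open>[u, x5]\<close> and
  \<open>[v, x5]\<close> remain free. Jacobi for \<open>u, v, x3\<close> gives
  \<open>[v, x4] = [u, [v, x3]]\<close>, and for \<open>u, v, x4\<close> it gives
  \<open>[x3, x4] = - [v, x5]\<close>. The last basis vector is an arbitrary nonzero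
  \<open>z\<close> in \<open>D 4\<close> because either of \<open>[u, x5]\<close>,
  \<open>[v, x5]\<close> may vanish.\<close>

lemma filiform_pair_brackets:
  assumes dims: "dim (D 1) = 4" "dim (D 2) = 3" "dim (D 3) = 2" "dim (D 4) = 1"
    and pair: "filiform_pair u v"
  defines "x3 \<equiv> \<langle>u, v\<rangle>"
  defines "x4 \<equiv> \<langle>u, x3\<rangle>"
  defines "x5 \<equiv> \<langle>u, x4\<rangle>"
  shows "z \<in> D 4 \<Longrightarrow> z \<noteq> 0 \<Longrightarrow> span {u, v, x3, x4, x5, z} = UNIV"
    and "z \<in> D 4 \<Longrightarrow> z \<noteq> 0 \<Longrightarrow> \<exists>a p. \<langle>v, x3\<rangle> = a \<cdot> x5 + p \<cdot> z \<and> \<langle>v, x4\<rangle> = a \<cdot> \<langle>u, x5\<rangle>"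
    and "\<langle>x3, x4\<rangle> = - \<langle>v, x5\<rangle>"
    and "\<langle>u, x5\<rangle> \<in> D 4" "\<langle>v, x5\<rangle> \<in> D 4" "\<langle>u, x5\<rangle> \<noteq> 0 \<or> \<langle>v, x5\<rangle> \<noteq> 0"
    and "\<langle>x3, x5\<rangle> = 0" "\<langle>x4, x5\<rangle> = 0"
    and "z \<in> D 4 \<Longrightarrow> \<langle>w, z\<rangle> = 0"
    and "D 3 = span ({x5} \<union> D 4)"
    and "x5 \<in> D 3"
proof -
  have D5: "D 5 = {0}"
    using lower_central_Suc_eq_0[of 4] dims by simp
  note zero = bracket_mem_D_5[unfolded D5 singleton_iff]
  have p: "span ({u, v} \<union> D 1) = UNIV" "x4 \<notin> D 3" "\<langle>v, x3\<rangle> \<in> D 3"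
    using pair by (simp_all add: filiform_pair_def x3_def x4_def)
  have mem: "x3 \<in> D 1" "x4 \<in> D 2" "x5 \<in> D 3"
    by (simp_all add: x3_def x4_def x5_def bracket_mem)
  show "x5 \<in> D 3" by fact
  have mem': "x5 \<in> D 1" "x5 \<in> D 2" "x4 \<in> D 1"
    using mem mem_D_antimono[of x5 3 1] mem_D_antimono[of x5 3 2] mem_D_antimono[of x4 2 1] by simp_all
  show "\<langle>x3, x5\<rangle> = 0" "\<langle>x4, x5\<rangle> = 0" "z \<in> D 4 \<Longrightarrow> \<langle>w, z\<rangle> = 0"
    using mem mem' by (simp_all add: zero)
  show ux5: "\<langle>u, x5\<rangle> \<in> D 4" and vx5: "\<langle>v, x5\<rangle> \<in> D 4"
    using mem by (simp_all add: bracket_mem)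
  have vx4: "\<langle>v, x4\<rangle> = \<langle>u, \<langle>v, x3\<rangle>\<rangle>"
    using jacobi_left[of u v x3] by (simp add: x3_def[symmetric] x4_def[symmetric])
  then have "\<langle>v, x4\<rangle> \<in> D 4"
    using p by (simp add: bracket_mem)
  have D1: "D 1 = span ({x3} \<union> D 2)"
    using D_1_two_generators[OF p(1)] by (simp add: x3_def)
  have D2: "D 2 = span ({x4} \<union> D 3)"
    using p mem dims by (intro D_eq_span_insert) simp_all
  have D3: "D 3 = span ({x5, \<langle>v, x4\<rangle>} \<union> D 4)"
    by (rule D_eq_span[OF p(1) D2]) (auto simp: x5_def)
  then show D3': "D 3 = span ({x5} \<union> D 4)"
    using \<open>\<langle>v, x4\<rangle> \<in> D 4\<close> by (simp add: insert_absorb)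
  have D4: "D 4 = span ({\<langle>u, x5\<rangle>, \<langle>v, x5\<rangle>} \<union> D 5)"
    by (rule D_eq_span[OF p(1) D3']) auto
  show "\<langle>u, x5\<rangle> \<noteq> 0 \<or> \<langle>v, x5\<rangle> \<noteq> 0"
    using D4 dims by (auto simp: D5)
  show "\<langle>x3, x4\<rangle> = - \<langle>v, x5\<rangle>"
  proof -
    have "\<langle>x3, x4\<rangle> = \<langle>u, \<langle>v, x4\<rangle>\<rangle> - \<langle>v, x5\<rangle>"
      using jacobi_left[of u v x4] by (simp add: x3_def[symmetric] x5_def[symmetric])
    then show ?thesis
      using \<open>\<langle>v, x4\<rangle> \<in> D 4\<close> by (simp add: zero)
  qed
  assume z: "z \<in> D 4" "z \<noteq> 0"
  have Dz: "D 4 = span {z}"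
    using span_insert_eq_if_dim[of "D 4" "{0}" z] z dims subspace_lower_central
    by (simp add: insert_commute)
  have "UNIV = span ({u, v} \<union> span ({x3} \<union> span ({x4} \<union> span ({x5} \<union> span {z}))))"
    using p(1) D1 D2 D3' Dz by simp
  then show "span {u, v, x3, x4, x5, z} = UNIV"
    unfolding span_Un_span_right by (simp add: insert_commute)
  have "\<langle>v, x3\<rangle> \<in> span (insert x5 (D 4))"
    using p(3) D3' by simp
  then obtain a where "\<langle>v, x3\<rangle> - a \<cdot> x5 \<in> span {z}"
    using mem_span_insertE subspace_lower_central Dz by metis
  then obtain p where "\<langle>v, x3\<rangle> - a \<cdot> x5 = p \<cdot> z"
    by (auto simp: span_singleton)
  then have *: "\<langle>v, x3\<rangle> = a \<cdot> x5 + p \<cdot> z" by (simp add: diff_eq_eq add.commute)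
  moreover have "\<langle>v, x4\<rangle> = a \<cdot> \<langle>u, x5\<rangle>"
    using z by (simp add: vx4 * zero)
  ultimately show "\<exists>a p. \<langle>v, x3\<rangle> = a \<cdot> x5 + p \<cdot> z \<and> \<langle>v, x4\<rangle> = a \<cdot> \<langle>u, x5\<rangle>"
    by blast
qed

text \<open>Counting generators would also allow the sequence 2,1,1,2. Jacobi puts
  \<open>[v, [u, [u, v]]]\<close> into \<open>D 4\<close>, so a single bracket is left to span
  \<open>D 3\<close> modulo \<open>D 4\<close>.\<close>

lemma dim_D_4_filiform:
  assumes "dim (D 1) = 4" "dim (D 3) = 2" "dim (D 2) = 3"
  shows "dim (D 4) = 1"
proof -
  obtain u v where "filiform_pair u v"
    using obtain_filiform_pair assms by blast
  then have p: "span ({u, v} \<union> D 1) = UNIV" "\<langle>u, \<langle>u, v\<rangle>\<rangle> \<notin> D 3" "\<langle>v, \<langle>u, v\<rangle>\<rangle> \<in> D 3"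
    by (simp_all add: filiform_pair_def)
  let ?x4 = "\<langle>u, \<langle>u, v\<rangle>\<rangle>"
  have "\<langle>v, ?x4\<rangle> = \<langle>u, \<langle>v, \<langle>u, v\<rangle>\<rangle>\<rangle>"
    using jacobi_left[of u v "\<langle>u, v\<rangle>"] by simp
  then have "\<langle>v, ?x4\<rangle> \<in> D 4"
    using p by (simp add: bracket_mem)
  have D2: "D 2 = span ({?x4} \<union> D 3)"
    using p assms by (intro D_eq_span_insert) (simp_all add: bracket_mem)
  have "D 3 = span ({\<langle>u, ?x4\<rangle>, \<langle>v, ?x4\<rangle>} \<union> D 4)"
    by (rule D_eq_span[OF p(1) D2]) auto
  then have "D 3 = span (insert \<langle>u, ?x4\<rangle> (D 4))"
    using \<open>\<langle>v, ?x4\<rangle> \<in> D 4\<close> by (simp add: insert_absorb)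
  then have "dim (D 3) \<le> dim (D 4) + 1"
    using dim_span_insert_le by metis
  moreover have "dim (D 4) < dim (D 3)"
    using dim_lower_central_less[of 3] assms by simp
  ultimately show ?thesis using assms by simp
qed

text \<open>Here \<open>x6 = [v, x5]\<close> is the last basis vector and \<open>u\<close> can be
  corrected to annihilate \<open>x5\<close>. The constant \<open>p\<close> is removed by shifting
  \<open>v\<close> along \<open>x4\<close>, and \<open>a\<close> is scaled to 0 or 1.\<close>

lemma filiform_16_14:
  assumes two: "(2::'a) \<noteq> 0"
    and dims: "dim (D 1) = 4" "dim (D 2) = 3" "dim (D 3) = 2" "dim (D 4) = 1"
    and pair: "filiform_pair u v" "\<langle>v, \<langle>u, \<langle>u, \<langle>u, v\<rangle>\<rangle>\<rangle>\<rangle> \<noteq> 0"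
  shows "L \<cong>\<^sub>L L_6_14 \<or> L \<cong>\<^sub>L L_6_16"
proof -
  note * = filiform_pair_brackets[OF dims]
  obtain s where s: "\<langle>u, \<langle>u, \<langle>u, \<langle>u, v\<rangle>\<rangle>\<rangle>\<rangle> = s \<cdot> \<langle>v, \<langle>u, \<langle>u, \<langle>u, v\<rangle>\<rangle>\<rangle>\<rangle>"
  proof -
    have "D 4 = span (insert \<langle>v, \<langle>u, \<langle>u, \<langle>u, v\<rangle>\<rangle>\<rangle>\<rangle> {0})"
      using pair(2) *(5)[OF pair(1)] dims
      by (intro span_insert_eq_if_dim subspace_lower_central) auto
    then show ?thesis
      using *(4)[OF pair(1)] that by (auto simp: insert_commute span_singleton)
  qed
  \<comment> \<open>The vector \<open>[u, x5]\<close> is \<open>s\<close> times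
    \<open>[v, x5]\<close>, so this combination annihilates the old \<open>x5\<close>.\<close>
  define u' where "u' = u - s \<cdot> v"
  define x3 where "x3 = \<langle>u', v\<rangle>"
  define x4 where "x4 = \<langle>u', x3\<rangle>"
  define x5 where "x5 = \<langle>u', x4\<rangle>"
  have x3: "x3 = \<langle>u, v\<rangle>" by (simp add: x3_def u'_def)
  have pair': "filiform_pair u' v"
  proof -
    have p: "span ({u, v} \<union> D 1) = UNIV" "\<langle>u, x3\<rangle> \<notin> D 3" "\<langle>v, x3\<rangle> \<in> D 3"
      using pair by (simp_all add: filiform_pair_def x3)
    have "span ({u', v} \<union> D 1) = UNIV"
    proof (rule span_generators_change[OF p(1)])
      have "u' + s \<cdot> v \<in> span ({u', v} \<union> D 1)"
        by (intro span_add span_scale span_base) simp_all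
      then show "u \<in> span ({u', v} \<union> D 1)" by (simp add: u'_def)
    qed (auto intro: span_base)
    moreover have "x4 \<notin> D 3"
    proof
      assume "x4 \<in> D 3"
      then have "x4 + s \<cdot> \<langle>v, x3\<rangle> \<in> D 3"
        using p by (intro subspace_add subspace_scale subspace_lower_central)
      then show False using p by (simp add: x4_def u'_def)
    qed
    ultimately show ?thesis
      using p by (simp add: filiform_pair_def x4_def x3_def)
  qed
  note b = filiform_pair_brackets[OF dims pair', folded x3_def, folded x4_def, folded x5_def]
  \<comment> \<open>The new \<open>x5\<close> is a multiple of the old one modulo
    \<open>D 4\<close>, and \<open>D 4\<close> is central.\<close>
  have ux5: "\<langle>u', x5\<rangle> = 0"
  proof -
    let ?y = "\<langle>u, \<langle>u, \<langle>u, v\<rangle>\<rangle>\<rangle>"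
    have "x5 \<in> span (insert ?y (D 4))"
      using b(11) *(10)[OF pair(1)] by simp
    then obtain c where "x5 - c \<cdot> ?y \<in> D 4"
      using mem_span_insertE subspace_lower_central by blast
    then have "\<langle>u', x5 - c \<cdot> ?y\<rangle> = 0" by (rule b(9))
    moreover have "\<langle>u', ?y\<rangle> = 0" using s by (simp add: u'_def)
    ultimately show ?thesis by simp
  qed
  define x6 where "x6 = \<langle>v, x5\<rangle>"
  have x6: "x6 \<in> D 4" "x6 \<noteq> 0"
    using b(5,6) ux5 by (simp_all add: x6_def)
  obtain a p where ap: "\<langle>v, x3\<rangle> = a \<cdot> x5 + p \<cdot> x6" "\<langle>v, x4\<rangle> = 0"
    using b(2)[OF x6] ux5 by auto
  have span: "span {u', v, x3, x4, x5, x6} = UNIV"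
    using b(1)[OF x6] .
  have br: "\<langle>u', v\<rangle> = x3" "\<langle>u', x3\<rangle> = x4" "\<langle>u', x4\<rangle> = x5" "\<langle>v, x5\<rangle> = x6" "\<langle>x3, x4\<rangle> = - x6"
    "\<langle>x4, x3\<rangle> = x6" "\<langle>x5, x4\<rangle> = 0" "\<langle>x5, x3\<rangle> = 0"
    using b(3,7,8) bracket_commute[of x4 x3] bracket_commute[of x5 x4] bracket_commute[of x5 x3]
    by (simp_all add: x3_def x4_def x5_def x6_def)
  note br = br ap b(7,8) b(9)[OF x6(1)] ux5
  \<comment> \<open>The bracket \<open>[v + r x4, x3 + r x5]\<close> equals
    \<open>a x5 + (p + 2 r) x6\<close>: the second \<open>r\<close> comes from
    \<open>[x4, x3] = x6\<close>.\<close>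
  define r where "r = - p / 2"
  \<comment> \<open>Scaling \<open>v\<close> by \<open>k\<close> scales \<open>x3\<close>,
    \<open>x4\<close>, \<open>x5\<close> by \<open>k\<close> as well, so \<open>a\<close> becomes
    \<open>k a\<close>.\<close>
  define k where "k = (if a = 0 then 1 else inverse a)"
  have k: "k \<noteq> 0" by (simp add: k_def)
  have r: "- r - r = p" using two by (simp add: r_def field_simps)
  let ?v = "k \<cdot> (v + r \<cdot> x4)" and ?x3 = "k \<cdot> (x3 + r \<cdot> x5)"
  have span': "span {u', ?v, ?x3, k \<cdot> x4, k \<cdot> x5, k \<cdot> k \<cdot> x6} = UNIV"
    by (rule span_triangular_change[OF span, of 1 k k k k "k * k"];
        (simp add: k span_zero scale_right_distrib)?; (intro span_scale span_base; simp)?)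
  have t: "pair_brackets L [u', ?v, ?x3, k \<cdot> x4, k \<cdot> x5, k \<cdot> k \<cdot> x6] =
      [?x3, k \<cdot> x4, k \<cdot> x5, 0, 0,
       (k * a) \<cdot> k \<cdot> x5, 0, k \<cdot> k \<cdot> x6, 0,
       - (k \<cdot> k \<cdot> x6), 0, 0, 0, 0, 0]"
  proof -
    have "p \<cdot> x6 = (- r - r) \<cdot> x6" by (simp only: r)
    then have "p \<cdot> x6 = - (r \<cdot> x6) - r \<cdot> x6"
      by (simp only: scale_left_diff_distrib scale_minus_left)
    then have "\<langle>v + r \<cdot> x4, x3 + r \<cdot> x5\<rangle> = a \<cdot> x5"
      by (simp add: br)
    then have "\<langle>?v, ?x3\<rangle> = (k * a) \<cdot> k \<cdot> x5"
      by (simp only: bracket_scale_left bracket_scale_right scale_scale mult_ac)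
    then show ?thesis by (simp add: br scale_right_distrib mult_ac)
  qed
  show ?thesis
  proof (cases "a = 0")
    case True
    then have "k * a = 0" by simp
    from iso_L_6_16[OF span' t[unfolded this scale_zero_left]] show ?thesis ..
  next
    case False
    then have "k * a = 1" by (simp add: k_def)
    from iso_L_6_14[OF span' t[unfolded this scale_one]] show ?thesis ..
  qed
qed

text \<open>Now \<open>x6 = [u, x5]\<close>. If \<open>a\<close> is nonzero, a shift of
  \<open>u\<close> along \<open>v\<close> absorbs \<open>p\<close> into \<open>x5\<close>, and
  scaling \<open>v\<close> gives 15. If \<open>a = 0\<close>, scaling turns \<open>p\<close> into 1
  (17), unless it is 0 (18).\<close>

lemma filiform_15_17_18:
  assumes two: "(2::'a) \<noteq> 0"
    and dims: "dim (D 1) = 4" "dim (D 2) = 3" "dim (D 3) = 2" "dim (D 4) = 1"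
    and pair: "filiform_pair u v" "\<langle>v, \<langle>u, \<langle>u, \<langle>u, v\<rangle>\<rangle>\<rangle>\<rangle> = 0"
  shows "L \<cong>\<^sub>L L_6_15 \<or> L \<cong>\<^sub>L L_6_17 \<or> L \<cong>\<^sub>L L_6_18"
proof -
  define x3 where "x3 = \<langle>u, v\<rangle>"
  define x4 where "x4 = \<langle>u, x3\<rangle>"
  define x5 where "x5 = \<langle>u, x4\<rangle>"
  define x6 where "x6 = \<langle>u, x5\<rangle>"
  note b = filiform_pair_brackets[OF dims pair(1), folded x3_def, folded x4_def, folded x5_def, folded x6_def]
  have vx5: "\<langle>v, x5\<rangle> = 0"
    using pair(2) by (simp add: x3_def x4_def x5_def)
  have x6: "x6 \<in> D 4" "x6 \<noteq> 0"
    using b(4,6) vx5 by simp_all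
  obtain a p where ap: "\<langle>v, x3\<rangle> = a \<cdot> x5 + p \<cdot> x6" "\<langle>v, x4\<rangle> = a \<cdot> x6"
    using b(2)[OF x6] by auto
  have span: "span {u, v, x3, x4, x5, x6} = UNIV"
    using b(1)[OF x6] .
  have br: "\<langle>u, v\<rangle> = x3" "\<langle>u, x3\<rangle> = x4" "\<langle>u, x4\<rangle> = x5" "\<langle>u, x5\<rangle> = x6" "\<langle>x3, x4\<rangle> = 0" "\<langle>x4, x3\<rangle> = 0"
    using b(3) vx5 bracket_commute[of x4 x3] by (simp_all add: x3_def x4_def x5_def x6_def)
  note br = br ap b(7,8) b(9)[OF x6(1)] vx5
  show ?thesis
  proof (cases "a = 0")
    case False
    \<comment> \<open>Replacing \<open>u\<close> by \<open>u + s v\<close> changes \<open>x5\<close>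
      into \<open>x5 + 2 s a x6\<close>. The choice of \<open>s\<close> makes \<open>a\<close> times
      this vector equal to \<open>a x5 + p x6 = [v, x3]\<close>.\<close>
    define s where "s = p / (2 * (a * a))"
    define k where "k = inverse a"
    have k: "k \<noteq> 0" "k * a = 1" using False by (simp_all add: k_def)
    have "p = s * a * a + s * a * a" using two False by (simp add: s_def field_simps)
    then have p6: "p \<cdot> x6 = (s * a * a) \<cdot> x6 + (s * a * a) \<cdot> x6"
      by (simp only: scale_left_distrib)
    have x6w: "\<langle>x6, w\<rangle> = 0" for w
      using br bracket_commute[of x6 w] by simp
    let ?u = "u + s \<cdot> v" and ?x4 = "x4 + (s * a) \<cdot> x5 + (s * s * a * a) \<cdot> x6 + (s * s * a * a) \<cdot> x6" and ?x5 = "x5 + (s * a) \<cdot> x6 + (s * a) \<cdot> x6"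
    have span': "span {?u, k \<cdot> v, k \<cdot> x3, k \<cdot> ?x4, k \<cdot> ?x5, k \<cdot> x6} = UNIV"
      by (rule span_triangular_change[OF span, of 1 k k k k k];
          (simp add: k span_zero scale_right_distrib)?; (intro span_add span_scale span_base; simp)?)
    have t: "pair_brackets L [?u, v, x3, ?x4, ?x5, x6] =
      [x3, ?x4, ?x5, x6, 0,
       a \<cdot> ?x5, a \<cdot> x6, 0, 0,
       0, 0, 0, 0, 0, 0]"
      by (simp add: br x6w p6 scale_right_distrib algebra_simps)
    have kk: "k * (k * a) = k" "k * a = 1" "k * (a * k) = k" using k by (simp_all add: mult.commute)
    have "pair_brackets L [?u, k \<cdot> v, k \<cdot> x3, k \<cdot> ?x4, k \<cdot> ?x5, k \<cdot> x6] =
      [k \<cdot> x3, k \<cdot> ?x4, k \<cdot> ?x5, k \<cdot> x6, 0,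
       k \<cdot> ?x5, k \<cdot> x6, 0, 0,
       0, 0, 0, 0, 0, 0]"
      using t by (simp only: pair_brackets.simps list.map append.simps list.inject
          bracket_scale_left bracket_scale_right scale_scale scale_zero_right kk mult_1_right simp_thms)
    with iso_L_6_15[OF span'] show ?thesis by blast
  next
    case True
    define k where "k = (if p = 0 then 1 else inverse p)"
    have k: "k \<noteq> 0" by (simp add: k_def)
    have span': "span {u, k \<cdot> v, k \<cdot> x3, k \<cdot> x4, k \<cdot> x5, k \<cdot> x6} = UNIV"
      by (rule span_triangular_change[OF span, of 1 k k k k k];
          (simp add: k span_zero)?)
    have "pair_brackets L [u, k \<cdot> v, k \<cdot> x3, k \<cdot> x4, k \<cdot> x5, k \<cdot> x6] =
      [k \<cdot> x3, k \<cdot> x4, k \<cdot> x5, k \<cdot> x6, 0,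
       (k * p) \<cdot> k \<cdot> x6, 0, 0, 0,
       0, 0, 0, 0, 0, 0]"
      using True by (simp add: br mult_ac)
    with iso_L_6_17[OF span'] iso_L_6_18[OF span'] show ?thesis
      by (cases "p = 0") (simp_all add: k_def)
  qed
qed

lemma type_2_1_1_1_1:
  assumes "(2::'a) \<noteq> 0" "dim (D 1) = 4" "dim (D 2) = 3" "dim (D 3) = 2"
  shows "L \<cong>\<^sub>L L_6_14 \<or> L \<cong>\<^sub>L L_6_15 \<or> L \<cong>\<^sub>L L_6_16 \<or> L \<cong>\<^sub>L L_6_17 \<or> L \<cong>\<^sub>L L_6_18"
proof -
  obtain u v where "filiform_pair u v"
    using obtain_filiform_pair assms by blast
  then show ?thesis
    using filiform_16_14 filiform_15_17_18 dim_D_4_filiform assms by blast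
qed

subsection \<open>Three generators\<close>

lemma obtain_three_generators:
  assumes "dim (D 1) = 3"
  obtains x y z where "span ({x, y, z} \<union> D 1) = UNIV"
proof -
  obtain xs where "length xs = 3" "span (set xs \<union> D 1) = UNIV"
    using obtain_complement[of "D 1" 3] assms dim_UNIV_6 by auto
  then show ?thesis
    using that by (auto simp: length_Suc_conv numeral_3_eq_3)
qed

text \<open>All three brackets of the generators are independent and central: this is the free
  two-step nilpotent algebra on three generators.\<close>

lemma type_3_3:
  assumes "dim (D 1) = 3" "dim (D 2) = 0"
  shows "L \<cong>\<^sub>L L_6_26"
proof -
  obtain x y z where xyz: "span ({x, y, z} \<union> D 1) = UNIV"
    using obtain_three_generators[OF assms(1)] .
  have D2: "D 2 = {0}"
    using assms(2) zero_mem_D[of 2] by (simp only: dim_eq_0) blast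
  note zero = bracket_mem_D_2[unfolded D2 singleton_iff]
  have "UNIV = span ({x, y, z} \<union> span ({\<langle>x, y\<rangle>, \<langle>x, z\<rangle>, \<langle>y, z\<rangle>} \<union> span {}))"
    using xyz D_1_three_generators[OF xyz] by (simp add: D2)
  then have span: "span {x, y, z, \<langle>x, y\<rangle>, \<langle>x, z\<rangle>, \<langle>y, z\<rangle>} = UNIV"
    unfolding span_Un_span_right by (simp add: insert_commute)
  show ?thesis
    by (rule iso_L_6_26[OF span]) (simp add: zero bracket_mem)
qed

text \<open>If \<open>dim (L / D 1) = 3\<close>, every bivector is decomposable; \<open>u \<and> v\<close> spans the kernel of the map onto
  \<open>D 1 / D 2\<close> induced by the bracket.\<close>

definition star_triple :: "'v \<Rightarrow> 'v \<Rightarrow> 'v \<Rightarrow> bool" where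
  "star_triple x u v \<longleftrightarrow> span ({x, u, v} \<union> D 1) = UNIV \<and> \<langle>u, v\<rangle> \<in> D 2 \<and>
    D 1 = span ({\<langle>x, u\<rangle>, \<langle>x, v\<rangle>} \<union> D 2)"

text \<open>A relation \<open>[y, z] = s [x, y] + t [x, z]\<close> modulo \<open>D 2\<close>
  decomposes as \<open>[y - t x, z + s x] = 0\<close> modulo \<open>D 2\<close>.\<close>

lemma star_triple_if_dependent:
  assumes "span ({x, y, z} \<union> D 1) = UNIV" "\<langle>y, z\<rangle> \<in> span ({\<langle>x, y\<rangle>, \<langle>x, z\<rangle>} \<union> D 2)"
  shows "\<exists>u v. star_triple x u v"
proof -
  have "\<langle>y, z\<rangle> \<in> span (insert \<langle>x, y\<rangle> (insert \<langle>x, z\<rangle> (D 2)))"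
    using assms(2) by simp
  then obtain s where "\<langle>y, z\<rangle> - s \<cdot> \<langle>x, y\<rangle> \<in> span (insert \<langle>x, z\<rangle> (D 2))"
    by (auto simp: span_breakdown_eq[of _ "\<langle>x, y\<rangle>"])
  then obtain t where "\<langle>y, z\<rangle> - s \<cdot> \<langle>x, y\<rangle> - t \<cdot> \<langle>x, z\<rangle> \<in> D 2"
    using mem_span_insertE subspace_lower_central by blast
  then have 1: "\<langle>y - t \<cdot> x, z + s \<cdot> x\<rangle> \<in> D 2"
    by (simp add: bracket_commute[of y x] diff_right_commute add.commute algebra_simps)
  have 2: "span ({x, y - t \<cdot> x, z + s \<cdot> x} \<union> D 1) = UNIV"
  proof (rule span_three_generators_change[OF assms(1)])
    let ?S = "span ({x, y - t \<cdot> x, z + s \<cdot> x} \<union> D 1)"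
    show "x \<in> ?S" by (simp add: span_base)
    have "(y - t \<cdot> x) + t \<cdot> x \<in> ?S" "(z + s \<cdot> x) - s \<cdot> x \<in> ?S"
      by (intro span_add[OF span_base] span_diff[OF span_base] span_scale span_base; simp)+
    then show "y \<in> ?S" "z \<in> ?S" by simp_all
  qed
  have 3: "D 1 = span ({\<langle>x, y\<rangle>, \<langle>x, z\<rangle>} \<union> D 2)"
  proof -
    have "D 1 = span (insert \<langle>y, z\<rangle> ({\<langle>x, y\<rangle>, \<langle>x, z\<rangle>} \<union> D 2))"
      using D_1_three_generators[OF assms(1)] by (simp add: insert_commute)
    then show ?thesis
      using span_redundant[OF assms(2)] by simp
  qed
  have 4: "\<langle>x, y - t \<cdot> x\<rangle> = \<langle>x, y\<rangle>" "\<langle>x, z + s \<cdot> x\<rangle> = \<langle>x, z\<rangle>"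
    by simp_all
  have "star_triple x (y - t \<cdot> x) (z + s \<cdot> x)"
    unfolding star_triple_def 4 using 1 2 3 by blast
  then show ?thesis by blast
qed

text \<open>The three brackets of the generators span a plane modulo \<open>D 2\<close>, so one of
  them depends on the other two; the generator common to those two becomes the centre
  \<open>x\<close>.\<close>

lemma obtain_star_triple:
  assumes "dim (D 1) = 3" "dim (D 2) = 1"
  obtains x u v where "star_triple x u v"
proof -
  obtain x y z where xyz: "span ({x, y, z} \<union> D 1) = UNIV"
    using obtain_three_generators[OF assms(1)] .
  have "dim (span ({\<langle>x, y\<rangle>, \<langle>x, z\<rangle>, \<langle>y, z\<rangle>} \<union> D 2)) \<le> dim (D 2) + 2"
    using D_1_three_generators[OF xyz] assms by simp
  then consider "\<langle>y, z\<rangle> \<in> span ({\<langle>x, y\<rangle>, \<langle>x, z\<rangle>} \<union> D 2)" | "\<langle>x, z\<rangle> \<in> span ({\<langle>x, y\<rangle>, \<langle>y, z\<rangle>} \<union> D 2)"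
    | "\<langle>x, y\<rangle> \<in> span ({\<langle>x, z\<rangle>, \<langle>y, z\<rangle>} \<union> D 2)"
    using dependent_triple by blast
  then have "\<exists>x u v. star_triple x u v"
  proof cases
    case 1
    then show ?thesis using star_triple_if_dependent[OF xyz] by blast
  next
    case 2
    then have "\<langle>x, z\<rangle> \<in> span ({\<langle>y, x\<rangle>, \<langle>y, z\<rangle>} \<union> D 2)"
      by (simp add: bracket_commute[of y x] span_insert_uminus)
    moreover have "span ({y, x, z} \<union> D 1) = UNIV" using xyz by (simp add: insert_commute)
    ultimately show ?thesis using star_triple_if_dependent by blast
  next
    case 3
    have "span (insert \<langle>z, x\<rangle> (insert \<langle>z, y\<rangle> (D 2))) = span (insert \<langle>x, z\<rangle> (insert \<langle>y, z\<rangle> (D 2)))"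
      unfolding bracket_commute[of z x] bracket_commute[of z y]
      by (rule span_insert_cong[of "-1"]) (simp_all add: span_zero span_insert_uminus)
    with 3 have "\<langle>x, y\<rangle> \<in> span ({\<langle>z, x\<rangle>, \<langle>z, y\<rangle>} \<union> D 2)"
      by simp
    moreover have "span ({z, x, y} \<union> D 1) = UNIV" using xyz by (simp add: insert_commute)
    ultimately show ?thesis using star_triple_if_dependent by blast
  qed
  then show ?thesis using that by blast
qed

lemma star_triple_swap: "star_triple x u v \<Longrightarrow> star_triple x v u"
  using subspace_neg[OF subspace_lower_central[of 2], of "\<langle>u, v\<rangle>"]
  unfolding star_triple_def bracket_commute[of v u] by (metis insert_commute)

lemma star_triple_add_right:
  assumes "star_triple x u v"
  shows "star_triple x u (v + t \<cdot> u)"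
proof -
  have *: "span ({x, u, v} \<union> D 1) = UNIV" "\<langle>u, v\<rangle> \<in> D 2" "D 1 = span ({\<langle>x, u\<rangle>, \<langle>x, v\<rangle>} \<union> D 2)"
    using assms unfolding star_triple_def by blast+
  have "span ({x, u, v + t \<cdot> u} \<union> D 1) = UNIV"
  proof (rule span_three_generators_change[OF *(1)])
    let ?S = "span ({x, u, v + t \<cdot> u} \<union> D 1)"
    show "x \<in> ?S" "u \<in> ?S" by (simp_all add: span_base)
    have "(v + t \<cdot> u) - t \<cdot> u \<in> ?S"
      by (intro span_diff[OF span_base] span_scale span_base; simp)
    then show "v \<in> ?S" by simp
  qed
  moreover have "span (insert \<langle>x, v + t \<cdot> u\<rangle> (insert \<langle>x, u\<rangle> (D 2))) = span (insert \<langle>x, v\<rangle> (insert \<langle>x, u\<rangle> (D 2)))"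
    by (rule span_insert_cong[of 1]) (simp_all add: span_scale span_base)
  ultimately show ?thesis
    using *(2,3) unfolding star_triple_def by (simp add: insert_commute)
qed

lemma star_triple_add_left:
  assumes "star_triple x u v"
  shows "star_triple (x + t \<cdot> u) u v"
proof -
  have *: "span ({x, u, v} \<union> D 1) = UNIV" "\<langle>u, v\<rangle> \<in> D 2" "D 1 = span ({\<langle>x, u\<rangle>, \<langle>x, v\<rangle>} \<union> D 2)"
    using assms unfolding star_triple_def by blast+
  have "span ({x + t \<cdot> u, u, v} \<union> D 1) = UNIV"
  proof (rule span_three_generators_change[OF *(1)])
    let ?S = "span ({x + t \<cdot> u, u, v} \<union> D 1)"
    show "u \<in> ?S" "v \<in> ?S" by (simp_all add: span_base)
    have "(x + t \<cdot> u) - t \<cdot> u \<in> ?S"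
      by (intro span_diff[OF span_base] span_scale span_base; simp)
    then show "x \<in> ?S" by simp
  qed
  moreover have "span (insert \<langle>x, u\<rangle> (insert \<langle>x + t \<cdot> u, v\<rangle> (D 2))) = span (insert \<langle>x, u\<rangle> (insert \<langle>x, v\<rangle> (D 2)))"
    by (rule span_insert_cong[of 1], simp, simp add: span_zero, rule span_insert_cong[of 1])
      (simp_all add: span_scale span_base *)
  ultimately show ?thesis
    using *(2,3) unfolding star_triple_def by simp
qed

text \<open>Since \<open>[u, v]\<close> lies in the central line \<open>D 2\<close>, Jacobi makes
  \<open>(a, b) \<mapsto> [a, [x, b]]\<close> a symmetric form on the plane of \<open>u\<close> and
  \<open>v\<close>. Whether it vanishes separates 19, 20 from 23, 25.\<close>

lemma star_triple_brackets:
  assumes dims: "dim (D 1) = 3" "dim (D 2) = 1" and triple: "star_triple x u v"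
  shows "\<langle>v, \<langle>x, u\<rangle>\<rangle> = \<langle>u, \<langle>x, v\<rangle>\<rangle>"
    and "y \<in> D 2 \<Longrightarrow> \<langle>w, y\<rangle> = 0" "y \<in> D 2 \<Longrightarrow> \<langle>y, w\<rangle> = 0"
    and "\<langle>\<langle>w, w'\<rangle>, \<langle>y, y'\<rangle>\<rangle> = 0"
    and "z \<in> D 2 \<Longrightarrow> z \<noteq> 0 \<Longrightarrow> D 2 = span {z}"
    and "z \<in> D 2 \<Longrightarrow> z \<noteq> 0 \<Longrightarrow> span {x, u, v, \<langle>x, u\<rangle>, \<langle>x, v\<rangle>, z} = UNIV"
    and "D 2 = span {\<langle>x, \<langle>x, u\<rangle>\<rangle>, \<langle>x, \<langle>x, v\<rangle>\<rangle>, \<langle>u, \<langle>x, u\<rangle>\<rangle>, \<langle>u, \<langle>x, v\<rangle>\<rangle>, \<langle>v, \<langle>x, v\<rangle>\<rangle>}"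
proof -
  have D3: "D 3 = {0}"
    using lower_central_Suc_eq_0[of 2] dims by simp
  note zero = bracket_mem_D_3[unfolded D3 singleton_iff]
  have *: "span ({x, u, v} \<union> D 1) = UNIV" "\<langle>u, v\<rangle> \<in> D 2" "D 1 = span ({\<langle>x, u\<rangle>, \<langle>x, v\<rangle>} \<union> D 2)"
    using triple unfolding star_triple_def by blast+
  show central: "y \<in> D 2 \<Longrightarrow> \<langle>w, y\<rangle> = 0" "y \<in> D 2 \<Longrightarrow> \<langle>y, w\<rangle> = 0"
    "\<langle>\<langle>w, w'\<rangle>, \<langle>y, y'\<rangle>\<rangle> = 0" for y w
    by (simp_all add: zero bracket_mem)
  show jac: "\<langle>v, \<langle>x, u\<rangle>\<rangle> = \<langle>u, \<langle>x, v\<rangle>\<rangle>"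
    using jacobi_left[of u v x] central(2)[OF *(2)]
    by (simp add: bracket_commute[of v x] bracket_commute[of u x])
  have "D 2 = span ({\<langle>a, b\<rangle> | a b. a \<in> {x, u, v} \<and> b \<in> {\<langle>x, u\<rangle>, \<langle>x, v\<rangle>}} \<union> D 3)"
    by (rule D_eq_span[OF *(1,3)]) simp_all
  also have "{\<langle>a, b\<rangle> | a b. a \<in> {x, u, v} \<and> b \<in> {\<langle>x, u\<rangle>, \<langle>x, v\<rangle>}} \<union> D 3 =
    {0, \<langle>x, \<langle>x, u\<rangle>\<rangle>, \<langle>x, \<langle>x, v\<rangle>\<rangle>, \<langle>u, \<langle>x, u\<rangle>\<rangle>, \<langle>u, \<langle>x, v\<rangle>\<rangle>, \<langle>v, \<langle>x, v\<rangle>\<rangle>}"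
    using jac by (auto simp: D3)
  finally show "D 2 = span {\<langle>x, \<langle>x, u\<rangle>\<rangle>, \<langle>x, \<langle>x, v\<rangle>\<rangle>, \<langle>u, \<langle>x, u\<rangle>\<rangle>, \<langle>u, \<langle>x, v\<rangle>\<rangle>, \<langle>v, \<langle>x, v\<rangle>\<rangle>}"
    by simp
  assume z: "z \<in> D 2" "z \<noteq> 0"
  show D2: "D 2 = span {z}"
    using z dims D_eq_span_insert[of z 2 3] by (simp add: D3 insert_commute)
  have "UNIV = span ({x, u, v} \<union> span ({\<langle>x, u\<rangle>, \<langle>x, v\<rangle>} \<union> span {z}))"
    using * D2 by simp
  then show "span {x, u, v, \<langle>x, u\<rangle>, \<langle>x, v\<rangle>, z} = UNIV"
    unfolding span_Un_span_right by (simp add: insert_commute)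
qed

text \<open>A non-isotropic \<open>u\<close> is found by polarisation, \<open>v\<close> is made
  orthogonal to it, and \<open>x\<close> is shifted along \<open>u\<close> to kill
  \<open>[x, [x, u]]\<close>. The last shift changes \<open>[x, v]\<close> only by a multiple of the
  central vector \<open>[u, v]\<close>, so orthogonality survives.\<close>

lemma star_triple_symmetric_form:
  assumes two: "(2::'a) \<noteq> 0" and dims: "dim (D 1) = 3" "dim (D 2) = 1"
    and triple: "star_triple x u v" "\<langle>u, \<langle>x, u\<rangle>\<rangle> \<noteq> 0 \<or> \<langle>u, \<langle>x, v\<rangle>\<rangle> \<noteq> 0 \<or> \<langle>v, \<langle>x, v\<rangle>\<rangle> \<noteq> 0"
  shows "\<exists>x u v. star_triple x u v \<and> \<langle>u, \<langle>x, u\<rangle>\<rangle> \<noteq> 0 \<and> \<langle>u, \<langle>x, v\<rangle>\<rangle> = 0 \<and> \<langle>x, \<langle>x, u\<rangle>\<rangle> = 0"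
proof -
  have "\<exists>x u v. star_triple x u v \<and> \<langle>u, \<langle>x, u\<rangle>\<rangle> \<noteq> 0"
  proof (cases "\<langle>u, \<langle>x, u\<rangle>\<rangle> = 0 \<and> \<langle>v, \<langle>x, v\<rangle>\<rangle> = 0")
    case True
    have "star_triple x (u + 1 \<cdot> v) v"
      using star_triple_swap star_triple_add_right triple(1) by blast
    moreover have "\<langle>u + 1 \<cdot> v, \<langle>x, u + 1 \<cdot> v\<rangle>\<rangle> \<noteq> 0"
    proof -
      have "\<langle>u + 1 \<cdot> v, \<langle>x, u + 1 \<cdot> v\<rangle>\<rangle> = 1 \<cdot> \<langle>u, \<langle>x, v\<rangle>\<rangle> + 1 \<cdot> \<langle>u, \<langle>x, v\<rangle>\<rangle>"
        using True star_triple_brackets(1)[OF dims triple(1)] by simp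
      also have "\<dots> = 2 \<cdot> \<langle>u, \<langle>x, v\<rangle>\<rangle>"
        by (simp only: scale_left_distrib[symmetric] one_add_one)
      finally show ?thesis using True two triple(2) by simp
    qed
    ultimately show ?thesis by blast
  next
    case False
    then show ?thesis using triple(1) star_triple_swap by blast
  qed
  then obtain x u v where t: "star_triple x u v" and nz: "\<langle>u, \<langle>x, u\<rangle>\<rangle> \<noteq> 0"
    by blast
  let ?z = "\<langle>u, \<langle>x, u\<rangle>\<rangle>"
  note b = star_triple_brackets[OF dims]
  have D2: "D 2 = span {?z}"
    by (rule b(5)[OF t _ nz]) (simp add: bracket_mem)
  have "\<langle>u, \<langle>x, v\<rangle>\<rangle> \<in> D 2" "\<langle>x, \<langle>x, u\<rangle>\<rangle> \<in> D 2"
    by (simp_all add: bracket_mem)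
  then obtain r s where rs: "\<langle>u, \<langle>x, v\<rangle>\<rangle> = r \<cdot> ?z" "\<langle>x, \<langle>x, u\<rangle>\<rangle> = s \<cdot> ?z"
    unfolding D2 span_singleton by blast
  define x' where "x' = x + (- s) \<cdot> u"
  define v' where "v' = v + (- r) \<cdot> u"
  have "star_triple x u v'"
    unfolding v'_def by (rule star_triple_add_right[OF t])
  then have "\<langle>u, v'\<rangle> \<in> D 2" unfolding star_triple_def by blast
  then have "\<langle>u, \<langle>u, v'\<rangle>\<rangle> = 0" by (rule b(2)[OF t])
  moreover have "star_triple x' u v'"
    unfolding x'_def by (rule star_triple_add_left) fact
  moreover have "\<langle>x', u\<rangle> = \<langle>x, u\<rangle>" "\<langle>x', v'\<rangle> = \<langle>x, v'\<rangle> - s \<cdot> \<langle>u, v'\<rangle>" "\<langle>u, \<langle>x, v'\<rangle>\<rangle> = 0"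
    using rs by (simp_all add: x'_def v'_def)
  ultimately have "star_triple x' u v' \<and> \<langle>u, \<langle>x', u\<rangle>\<rangle> \<noteq> 0 \<and> \<langle>u, \<langle>x', v'\<rangle>\<rangle> = 0 \<and> \<langle>x', \<langle>x', u\<rangle>\<rangle> = 0"
    using nz rs by (simp add: x'_def)
  then show ?thesis by blast
qed

text \<open>The constants left are \<open>p\<close>, \<open>q\<close> and \<open>d\<close>,
  belonging to \<open>[x, x5]\<close>, \<open>[v, x5]\<close> and \<open>[u, v]\<close>. Subtracting
  \<open>d x4\<close> from \<open>v\<close> kills \<open>d\<close>. If \<open>q\<close> is nonzero,
  a shift of \<open>x\<close> along \<open>v\<close> kills \<open>p\<close> and \<epsilon> is
  \<open>q\<close>; if \<open>q = 0\<close>, then \<open>p\<close> decides between \<epsilon> = 0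
  and 20.\<close>

lemma star_triple_19_20:
  assumes dims: "dim (D 1) = 3" "dim (D 2) = 1"
    and triple: "star_triple x u v" "\<langle>u, \<langle>x, u\<rangle>\<rangle> \<noteq> 0" "\<langle>u, \<langle>x, v\<rangle>\<rangle> = 0" "\<langle>x, \<langle>x, u\<rangle>\<rangle> = 0"
  shows "(\<exists>eps. L \<cong>\<^sub>L L_6_19 eps) \<or> L \<cong>\<^sub>L L_6_20"
proof -
  define x4 where "x4 = \<langle>x, u\<rangle>"
  define x5 where "x5 = \<langle>x, v\<rangle>"
  define x6 where "x6 = \<langle>u, x4\<rangle>"
  note b = star_triple_brackets[OF dims triple(1), folded x4_def x5_def]
  have x6: "x6 \<in> D 2" "x6 \<noteq> 0"
    using triple by (simp_all add: x6_def x4_def bracket_mem)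
  have D2: "D 2 = span {x6}" and span: "span {x, u, v, x4, x5, x6} = UNIV"
    using b(5,6)[OF x6] .
  have "\<langle>u, v\<rangle> \<in> D 2"
    using triple(1) unfolding star_triple_def by blast
  moreover have "\<langle>x, x5\<rangle> \<in> D 2" "\<langle>v, x5\<rangle> \<in> D 2"
    by (simp_all add: x5_def bracket_mem)
  ultimately obtain p q d where pqd: "\<langle>x, x5\<rangle> = p \<cdot> x6" "\<langle>v, x5\<rangle> = q \<cdot> x6" "\<langle>u, v\<rangle> = d \<cdot> x6"
    unfolding D2 span_singleton by blast
  have mem: "x4 \<in> D 1" "x5 \<in> D 1" "x6 \<in> D 1"
    by (simp_all add: x4_def x5_def x6_def bracket_mem)
  have "D 3 = {0}"
    using lower_central_Suc_eq_0[of 2] dims by simp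
  note zero = bracket_mem_D_3(3)[unfolded this singleton_iff, OF mem(1) mem(2)]
    bracket_mem_D_3(3)[unfolded this singleton_iff, OF mem(2) mem(1)]
    b(2)[OF x6(1)] b(3)[OF x6(1)]
  have br: "\<langle>x, u\<rangle> = x4" "\<langle>u, x\<rangle> = - x4" "\<langle>x, v\<rangle> = x5" "\<langle>v, x\<rangle> = - x5" "\<langle>u, x4\<rangle> = x6" "\<langle>u, x5\<rangle> = 0"
    "\<langle>v, x4\<rangle> = 0" "\<langle>x, x4\<rangle> = 0" "\<langle>v, u\<rangle> = - (d \<cdot> x6)" "\<langle>x4, u\<rangle> = - x6" "\<langle>x4, v\<rangle> = 0"
    using triple b(1) pqd bracket_commute[of u x] bracket_commute[of v x] bracket_commute[of v u]
      bracket_commute[of x4 u] bracket_commute[of x4 v]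
    by (simp_all add: x4_def x5_def x6_def)
  \<comment> \<open>The shifted \<open>x\<close> sends \<open>x5\<close> to
    \<open>(p - m q) x6\<close>. The factor \<open>k\<close> makes this coefficient 1 in the case
    \<open>q = 0\<close>, \<open>p\<close> nonzero, and is 1 otherwise.\<close>
  define m where "m = (if q = 0 then 0 else p / q)"
  define k where "k = (if q = 0 \<and> p \<noteq> 0 then inverse p else 1)"
  have k: "k \<noteq> 0" by (simp add: k_def)
  let ?v = "v - d \<cdot> x4"
  let ?x = "x - m \<cdot> ?v"
  have span': "span {?x, u, k \<cdot> ?v, x4, k \<cdot> x5, x6} = UNIV"
  proof -
    have "span {x - m \<cdot> ?v, k \<cdot> ?v, u, x4, k \<cdot> x5, x6} = UNIV"
      by (rule span_triangular_change[of x v u x4 x5 x6 1 k 1 1 k 1];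
          (simp add: k span_zero scale_right_diff_distrib)?;
          (intro span_add span_diff span_neg span_scale span_base; simp)?)
        (use span in \<open>simp add: insert_commute\<close>)
    then show ?thesis by (simp add: insert_commute)
  qed
  have t: "pair_brackets L [?x, u, k \<cdot> ?v, x4, k \<cdot> x5, x6] =
      [x4, k \<cdot> x5, 0, (k * (p - m * q)) \<cdot> x6, 0,
       0, x6, 0, 0,
       0, (k * k * q) \<cdot> x6, 0, 0, 0, 0]"
    by (simp add: br pqd zero algebra_simps)
  show ?thesis
  proof (cases "q = 0 \<and> p \<noteq> 0")
    case True
    then have "k * (p - m * q) = 1" "k * k * q = 0" by (simp_all add: k_def)
    from iso_L_6_20[OF span' t[unfolded this scale_one scale_zero_left]] show ?thesis ..
  next
    case False
    then have "k * (p - m * q) = 0" by (auto simp: m_def)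
    from iso_L_6_19[OF span' t[unfolded this scale_one scale_zero_left]] show ?thesis by blast
  qed
qed

text \<open>When the form vanishes, \<open>D 2\<close> is spanned by the values of the functional
  \<open>b \<mapsto> [x, [x, b]]\<close> on the plane of \<open>u\<close> and \<open>v\<close>. It
  is nonzero, so \<open>u\<close> can be taken outside its kernel and \<open>v\<close> moved into
  it; the only constant left belongs to \<open>[u, v]\<close>, scaled to 0 (25) or 1 (23).\<close>

lemma star_triple_23_25:
  assumes dims: "dim (D 1) = 3" "dim (D 2) = 1"
    and triple: "star_triple x u v" "\<langle>u, \<langle>x, u\<rangle>\<rangle> = 0" "\<langle>u, \<langle>x, v\<rangle>\<rangle> = 0" "\<langle>v, \<langle>x, v\<rangle>\<rangle> = 0"
  shows "L \<cong>\<^sub>L L_6_23 \<or> L \<cong>\<^sub>L L_6_25"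
proof -
  have main: "L \<cong>\<^sub>L L_6_23 \<or> L \<cong>\<^sub>L L_6_25"
    if triple: "star_triple x u v" "\<langle>u, \<langle>x, u\<rangle>\<rangle> = 0" "\<langle>u, \<langle>x, v\<rangle>\<rangle> = 0" "\<langle>v, \<langle>x, v\<rangle>\<rangle> = 0"
      and nz: "\<langle>x, \<langle>x, u\<rangle>\<rangle> \<noteq> 0" for x u v
  proof -
    define x4 where "x4 = \<langle>x, u\<rangle>"
    define x5 where "x5 = \<langle>x, v\<rangle>"
    define x6 where "x6 = \<langle>x, x4\<rangle>"
    note b = star_triple_brackets[OF dims triple(1), folded x4_def x5_def]
    have x6: "x6 \<in> D 2" "x6 \<noteq> 0"
      using nz by (simp_all add: x6_def x4_def bracket_mem)
    have D2: "D 2 = span {x6}" and span: "span {x, u, v, x4, x5, x6} = UNIV"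
      using b(5,6)[OF x6] .
    have "\<langle>u, v\<rangle> \<in> D 2"
      using triple(1) unfolding star_triple_def by blast
    moreover have "\<langle>x, x5\<rangle> \<in> D 2"
      by (simp add: x5_def bracket_mem)
    ultimately obtain r d where rd: "\<langle>x, x5\<rangle> = r \<cdot> x6" "\<langle>u, v\<rangle> = d \<cdot> x6"
      unfolding D2 span_singleton by blast
    have zero: "\<langle>x4, x5\<rangle> = 0"
      by (simp add: b(4) x4_def x5_def)
    have br: "\<langle>x, u\<rangle> = x4" "\<langle>x, v\<rangle> = x5" "\<langle>u, x4\<rangle> = 0" "\<langle>u, x5\<rangle> = 0" "\<langle>v, x4\<rangle> = 0" "\<langle>v, x5\<rangle> = 0"
      "\<langle>x, x4\<rangle> = x6" "\<langle>x4, u\<rangle> = 0" "\<langle>x4, v\<rangle> = 0"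
      using triple b(1) bracket_commute[of x4 u] bracket_commute[of x4 v]
      by (simp_all add: x4_def x5_def x6_def)
    note br = br rd zero b(2)[OF x6(1)] b(3)[OF x6(1)]
    define k where "k = (if d = 0 then 1 else inverse d)"
    have k: "k \<noteq> 0" by (simp add: k_def)
    \<comment> \<open>This vector lies in the kernel of the functional, so its bracket
      \<open>?x5\<close> with \<open>x\<close> is central and takes the last place of the
      basis.\<close>
    let ?v = "v - r \<cdot> u" and ?x5 = "x5 - r \<cdot> x4"
    have span': "span {x, u, x4, k \<cdot> ?v, x6, k \<cdot> ?x5} = UNIV"
    proof -
      have "span {x, k \<cdot> ?v, u, k \<cdot> ?x5, x4, x6} = UNIV"
        by (rule span_triangular_change[of x v u x5 x4 x6 1 k 1 k 1 1];
            (simp add: k span_zero scale_right_diff_distrib)?;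
            (intro span_add span_diff span_neg span_scale span_base; simp)?)
          (use span in \<open>simp add: insert_commute\<close>)
      then show ?thesis by (simp add: insert_commute)
    qed
    have t: "pair_brackets L [x, u, x4, k \<cdot> ?v, x6, k \<cdot> ?x5] =
        [x4, x6, k \<cdot> ?x5, 0, 0,
         0, (k * d) \<cdot> x6, 0, 0,
         0, 0, 0, 0, 0, 0]"
      by (simp add: br algebra_simps)
    show ?thesis
    proof (cases "d = 0")
      case True
      then have "k * d = 0" by simp
      from iso_L_6_25[OF _ t[unfolded this scale_zero_left]] span' show ?thesis by blast
    next
      case False
      then have "k * d = 1" by (simp add: k_def)
      from iso_L_6_23[OF _ t[unfolded this scale_one]] span' show ?thesis by blast
    qed
  qed
  have "\<not> (\<langle>x, \<langle>x, u\<rangle>\<rangle> = 0 \<and> \<langle>x, \<langle>x, v\<rangle>\<rangle> = 0)"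
  proof
    assume "\<langle>x, \<langle>x, u\<rangle>\<rangle> = 0 \<and> \<langle>x, \<langle>x, v\<rangle>\<rangle> = 0"
    then have "D 2 = {0}"
      using star_triple_brackets(7)[OF dims triple(1)] triple by simp
    with dims show False by simp
  qed
  moreover have "\<langle>v, \<langle>x, u\<rangle>\<rangle> = 0"
    using star_triple_brackets(1)[OF dims triple(1)] triple by simp
  ultimately show ?thesis
    using main[OF triple] main[OF star_triple_swap[OF triple(1)] triple(4) _ triple(2)] by blast
qed

lemma type_3_2_1:
  assumes two: "(2::'a) \<noteq> 0" and dims: "dim (D 1) = 3" "dim (D 2) = 1"
  shows "(\<exists>eps. L \<cong>\<^sub>L L_6_19 eps) \<or> L \<cong>\<^sub>L L_6_20 \<or> L \<cong>\<^sub>L L_6_23 \<or> L \<cong>\<^sub>L L_6_25"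
proof -
  obtain x u v where t: "star_triple x u v"
    using obtain_star_triple[OF dims] .
  show ?thesis
  proof (cases "\<langle>u, \<langle>x, u\<rangle>\<rangle> = 0 \<and> \<langle>u, \<langle>x, v\<rangle>\<rangle> = 0 \<and> \<langle>v, \<langle>x, v\<rangle>\<rangle> = 0")
    case True
    then show ?thesis using star_triple_23_25[OF dims t] by blast
  next
    case False
    then show ?thesis
      using star_triple_symmetric_form[OF two dims t] star_triple_19_20[OF dims] by blast
  qed
qed

text \<open>The bracket induces an alternating form with values in the line \<open>D 1 / D 2\<close>; \<open>w\<close> spans its radical.\<close>

definition radical_triple :: "'v \<Rightarrow> 'v \<Rightarrow> 'v \<Rightarrow> bool" where
  "radical_triple x y w \<longleftrightarrow> span ({x, y, w} \<union> D 1) = UNIV \<and> D 1 = span ({\<langle>x, y\<rangle>} \<union> D 2) \<and>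
    \<langle>x, w\<rangle> \<in> D 2 \<and> \<langle>y, w\<rangle> \<in> D 2"

text \<open>The form is non-degenerate on the plane of \<open>x\<close> and \<open>y\<close>, so
  \<open>z\<close> can be projected onto the orthogonal complement of that plane.\<close>

lemma radical_triple_if_bracket_not_mem:
  assumes dims: "dim (D 1) = 3" "dim (D 2) = 2"
    and "span ({x, y, z} \<union> D 1) = UNIV" "\<langle>x, y\<rangle> \<notin> D 2"
  shows "\<exists>w. radical_triple x y w"
proof -
  have D1: "D 1 = span ({\<langle>x, y\<rangle>} \<union> D 2)"
    using assms by (intro D_eq_span_insert) (simp_all add: bracket_mem)
  have "\<langle>x, z\<rangle> \<in> span (insert \<langle>x, y\<rangle> (D 2))" "\<langle>y, z\<rangle> \<in> span (insert \<langle>x, y\<rangle> (D 2))"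
    using bracket_mem_D_1 D1 by (metis insert_is_Un)+
  then obtain s t where st: "\<langle>x, z\<rangle> - s \<cdot> \<langle>x, y\<rangle> \<in> D 2" "\<langle>y, z\<rangle> - t \<cdot> \<langle>x, y\<rangle> \<in> D 2"
    using mem_span_insertE subspace_lower_central by metis
  let ?w = "z - s \<cdot> y + t \<cdot> x"
  have "\<langle>x, ?w\<rangle> \<in> D 2" "\<langle>y, ?w\<rangle> \<in> D 2"
    using st by (simp_all add: bracket_commute[of y x])
  moreover have "span ({x, y, ?w} \<union> D 1) = UNIV"
  proof (rule span_three_generators_change[OF assms(3)])
    let ?S = "span ({x, y, ?w} \<union> D 1)"
    show "x \<in> ?S" "y \<in> ?S" by (simp_all add: span_base)
    have "?w - t \<cdot> x \<in> ?S"
      by (intro span_diff[OF span_base] span_scale span_base; simp)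
    then have "?w - t \<cdot> x + s \<cdot> y \<in> ?S"
      by (rule span_add) (intro span_scale span_base; simp)
    then show "z \<in> ?S" by simp
  qed
  ultimately have "radical_triple x y ?w"
    unfolding radical_triple_def using D1 by blast
  then show ?thesis by blast
qed

lemma obtain_radical_triple:
  assumes dims: "dim (D 1) = 3" "dim (D 2) = 2"
  obtains x y w where "radical_triple x y w"
proof -
  obtain x y z where xyz: "span ({x, y, z} \<union> D 1) = UNIV"
    using obtain_three_generators[OF assms(1)] .
  have "\<langle>x, y\<rangle> \<notin> D 2 \<or> \<langle>x, z\<rangle> \<notin> D 2 \<or> \<langle>y, z\<rangle> \<notin> D 2"
  proof (rule ccontr)
    assume "\<not> ?thesis"
    then have "span ({\<langle>x, y\<rangle>, \<langle>x, z\<rangle>, \<langle>y, z\<rangle>} \<union> D 2) = span (D 2)"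
      by (simp add: insert_absorb)
    then have "D 1 = D 2"
      using D_1_three_generators[OF xyz] span_eq_iff[THEN iffD2, OF subspace_lower_central] by metis
    with dims show False by simp
  qed
  moreover have "span ({x, z, y} \<union> D 1) = UNIV" "span ({y, z, x} \<union> D 1) = UNIV"
    using xyz by (simp_all add: insert_commute)
  ultimately show ?thesis
    using radical_triple_if_bracket_not_mem[OF dims] xyz that by metis
qed

lemma radical_triple_swap:
  assumes "radical_triple x y w"
  shows "radical_triple y x w"
proof -
  have "span ({\<langle>y, x\<rangle>} \<union> D 2) = span ({\<langle>x, y\<rangle>} \<union> D 2)"
    unfolding bracket_commute[of y x] by (simp add: span_insert_uminus)
  then show ?thesis
    using assms unfolding radical_triple_def by (metis insert_commute)
qed

lemma radical_triple_add:
  assumes "radical_triple x y w"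
  shows "radical_triple x (y + t \<cdot> x) w"
proof -
  have *: "span ({x, y, w} \<union> D 1) = UNIV" "D 1 = span ({\<langle>x, y\<rangle>} \<union> D 2)" "\<langle>x, w\<rangle> \<in> D 2" "\<langle>y, w\<rangle> \<in> D 2"
    using assms unfolding radical_triple_def by blast+
  have "span ({x, y + t \<cdot> x, w} \<union> D 1) = UNIV"
  proof (rule span_three_generators_change[OF *(1)])
    let ?S = "span ({x, y + t \<cdot> x, w} \<union> D 1)"
    show "x \<in> ?S" "w \<in> ?S" by (simp_all add: span_base)
    have "(y + t \<cdot> x) - t \<cdot> x \<in> ?S"
      by (intro span_diff[OF span_base] span_scale span_base; simp)
    then show "y \<in> ?S" by simp
  qed
  moreover have "\<langle>y + t \<cdot> x, w\<rangle> \<in> D 2"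
    using *(3,4) by (simp add: subspace_add subspace_scale subspace_lower_central)
  moreover have "\<langle>x, y + t \<cdot> x\<rangle> = \<langle>x, y\<rangle>" by simp
  ultimately show ?thesis
    using *(2,3) unfolding radical_triple_def by metis
qed

text \<open>Jacobi gives \<open>[[x, y], w] = [x, [y, w]] - [y, [x, w]]\<close>, and both inner
  brackets lie in \<open>D 2\<close>.\<close>

lemma radical_triple_brackets:
  assumes "radical_triple x y w"
  shows "\<langle>w, \<langle>x, y\<rangle>\<rangle> \<in> D 3" "D 2 = span ({\<langle>x, \<langle>x, y\<rangle>\<rangle>, \<langle>y, \<langle>x, y\<rangle>\<rangle>} \<union> D 3)"
proof -
  have *: "span ({x, y, w} \<union> D 1) = UNIV" "D 1 = span ({\<langle>x, y\<rangle>} \<union> D 2)" "\<langle>x, w\<rangle> \<in> D 2" "\<langle>y, w\<rangle> \<in> D 2"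
    using assms unfolding radical_triple_def by blast+
  have "\<langle>\<langle>x, y\<rangle>, w\<rangle> \<in> D 3"
    unfolding jacobi_left by (intro subspace_diff subspace_lower_central) (simp_all add: bracket_mem *)
  then show w: "\<langle>w, \<langle>x, y\<rangle>\<rangle> \<in> D 3"
    using subspace_neg[OF subspace_lower_central] by (subst bracket_commute) blast
  have "D 2 = span ({\<langle>w, \<langle>x, y\<rangle>\<rangle>, \<langle>x, \<langle>x, y\<rangle>\<rangle>, \<langle>y, \<langle>x, y\<rangle>\<rangle>} \<union> D 3)"
    by (rule D_eq_span[OF *(1,2)]) auto
  then show "D 2 = span ({\<langle>x, \<langle>x, y\<rangle>\<rangle>, \<langle>y, \<langle>x, y\<rangle>\<rangle>} \<union> D 3)"
    using w by (simp add: insert_absorb insert_commute)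
qed

text \<open>Bracketing with \<open>x3 = [x, y]\<close> identifies the plane of \<open>x\<close> and
  \<open>y\<close> with \<open>D 2\<close>, so \<open>v \<mapsto> [v, w]\<close> becomes an operator
  \<open>M\<close> on that plane, with entries \<open>a, b, c, d\<close>. Replacing \<open>w\<close>
  by \<open>w - m x3\<close> subtracts \<open>m\<close> from \<open>M\<close>.\<close>

lemma type_3_1_2:
  assumes two: "(2::'a) \<noteq> 0" and dims: "dim (D 1) = 3" "dim (D 2) = 2" "dim (D 3) = 0"
  shows "L \<cong>\<^sub>L L_6_9 \<or> (\<exists>eps. L \<cong>\<^sub>L L_6_24 eps)"
proof -
  have D3: "D 3 = {0}"
    using dims(3) zero_mem_D[of 3] by (simp only: dim_eq_0) blast
  note zero = bracket_mem_D_3[unfolded D3 singleton_iff]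
  have coords: "\<exists>a b c d. \<langle>x, w\<rangle> = a \<cdot> \<langle>x, \<langle>x, y\<rangle>\<rangle> + b \<cdot> \<langle>y, \<langle>x, y\<rangle>\<rangle> \<and> \<langle>y, w\<rangle> = c \<cdot> \<langle>x, \<langle>x, y\<rangle>\<rangle> + d \<cdot> \<langle>y, \<langle>x, y\<rangle>\<rangle>"
    if "radical_triple x y w" for x y w
  proof -
    have "D 2 = span {\<langle>x, \<langle>x, y\<rangle>\<rangle>, \<langle>y, \<langle>x, y\<rangle>\<rangle>}"
      using radical_triple_brackets(2)[OF that] D3 by (simp add: insert_commute)
    moreover have "\<exists>a b. v = a \<cdot> p + b \<cdot> q" if "v \<in> span {p, q}" for v p q
      using that by (rule mem_span_pair) blast
    ultimately show ?thesis
      using that unfolding radical_triple_def by metis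
  qed
  have span: "span {x, y, w, \<langle>x, y\<rangle>, \<langle>x, \<langle>x, y\<rangle>\<rangle>, \<langle>y, \<langle>x, y\<rangle>\<rangle>} = UNIV" and w: "\<langle>w, \<langle>x, y\<rangle>\<rangle> = 0"
    if "radical_triple x y w" for x y w
  proof -
    have "UNIV = span ({x, y, w} \<union> span ({\<langle>x, y\<rangle>} \<union> span ({\<langle>x, \<langle>x, y\<rangle>\<rangle>, \<langle>y, \<langle>x, y\<rangle>\<rangle>} \<union> D 3)))"
      using that radical_triple_brackets(2)[OF that] unfolding radical_triple_def by metis
    then show "span {x, y, w, \<langle>x, y\<rangle>, \<langle>x, \<langle>x, y\<rangle>\<rangle>, \<langle>y, \<langle>x, y\<rangle>\<rangle>} = UNIV"
      unfolding span_Un_span_right D3 by (simp add: insert_commute)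
    show "\<langle>w, \<langle>x, y\<rangle>\<rangle> = 0"
      using radical_triple_brackets(1)[OF that] D3 by simp
  qed
  have main: "\<exists>eps. L \<cong>\<^sub>L L_6_24 eps"
    if t: "radical_triple x y w" and abcd: "\<langle>x, w\<rangle> = a \<cdot> \<langle>x, \<langle>x, y\<rangle>\<rangle> + b \<cdot> \<langle>y, \<langle>x, y\<rangle>\<rangle>"
      "\<langle>y, w\<rangle> = c \<cdot> \<langle>x, \<langle>x, y\<rangle>\<rangle> + d \<cdot> \<langle>y, \<langle>x, y\<rangle>\<rangle>" and c: "c \<noteq> 0" for x y w a b c d
  proof -
    define x3 where "x3 = \<langle>x, y\<rangle>"
    define x5 where "x5 = \<langle>x, x3\<rangle>"
    define x6 where "x6 = \<langle>y, x3\<rangle>"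
    have mem: "x3 \<in> D 1" "x5 \<in> D 2" "x6 \<in> D 2"
      by (simp_all add: x3_def x5_def x6_def bracket_mem)
    have br: "\<langle>x, y\<rangle> = x3" "\<langle>y, x\<rangle> = - x3" "\<langle>x, x3\<rangle> = x5" "\<langle>y, x3\<rangle> = x6" "\<langle>w, x3\<rangle> = 0" "\<langle>x3, w\<rangle> = 0"
      "\<langle>x3, x\<rangle> = - x5" "\<langle>x3, y\<rangle> = - x6"
      "\<langle>x, w\<rangle> = a \<cdot> x5 + b \<cdot> x6" "\<langle>y, w\<rangle> = c \<cdot> x5 + d \<cdot> x6"
      using abcd w[OF t] bracket_commute[of y x] bracket_commute[of x3 w]
        bracket_commute[of x3 x] bracket_commute[of x3 y]
      by (simp_all add: x3_def x5_def x6_def)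
    \<comment> \<open>With half the trace \<open>m = a + r\<close> removed, \<open>M\<close> sends
      \<open>x\<close> to \<open>- r x + b y\<close> and \<open>y\<close> to
      \<open>c x + r y\<close>. Its square is the scalar \<open>b c + r r\<close>, the future
      \<epsilon>.\<close>
    define r where "r = (d - a) / 2"
    have r: "d - (a + r) = r" using two by (simp add: r_def field_simps)
    define m where "m = a + r"
    have m: "d - m = r" "a - m = - r" using r by (simp_all add: m_def)
    \<comment> \<open>The new \<open>x\<close> is \<open>M y\<close>. Then
      \<open>[?x, y] = c x3\<close>, so the identification is scaled by \<open>c\<close>, and
      \<open>w\<close> is scaled by \<open>c\<close> to match.\<close>
    let ?x = "c \<cdot> x + r \<cdot> y" and ?w = "c \<cdot> (w - m \<cdot> x3)" and ?x5 = "c \<cdot> (c \<cdot> x5 + r \<cdot> x6)"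
    have span': "span {?x, y, c \<cdot> x3, ?w, ?x5, c \<cdot> x6} = UNIV"
    proof -
      have "span {?x, y, ?w, c \<cdot> x3, ?x5, c \<cdot> x6} = UNIV"
        by (rule span_triangular_change[OF span[OF t, folded x3_def, folded x5_def x6_def], of c 1 c c "c * c" c];
            (simp add: c span_zero scale_right_diff_distrib scale_right_distrib)?;
            (intro span_add span_diff span_neg span_scale span_base; simp)?)
      then show ?thesis by (simp add: insert_commute)
    qed
    have yw: "\<langle>y, w - m \<cdot> x3\<rangle> = c \<cdot> x5 + r \<cdot> x6"
    proof -
      have "\<langle>y, w - m \<cdot> x3\<rangle> = c \<cdot> x5 + (d - m) \<cdot> x6"
        by (simp add: br scale_left_diff_distrib)
      then show ?thesis by (simp only: m)
    qed
    have xw: "\<langle>x, w - m \<cdot> x3\<rangle> = - (r \<cdot> x5) + b \<cdot> x6"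
    proof -
      have "\<langle>x, w - m \<cdot> x3\<rangle> = (a - m) \<cdot> x5 + b \<cdot> x6"
        by (simp add: br scale_left_diff_distrib)
      then show ?thesis by (simp only: m scale_minus_left)
    qed
    have "\<langle>?x, ?w\<rangle> = (c * c) \<cdot> \<langle>x, w - m \<cdot> x3\<rangle> + (c * r) \<cdot> \<langle>y, w - m \<cdot> x3\<rangle>"
      by (simp only: bracket_add_left bracket_scale_left bracket_scale_right scale_right_distrib scale_scale)
    also have "\<dots> = (b * c + r * r) \<cdot> c \<cdot> x6"
      unfolding xw yw by (simp add: scale_right_distrib scale_left_distrib algebra_simps)
    finally have "\<langle>?x, ?w\<rangle> = (b * c + r * r) \<cdot> c \<cdot> x6" .
    moreover have "\<langle>y, ?w\<rangle> = ?x5"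
      unfolding bracket_scale_right yw ..
    moreover have "\<langle>c \<cdot> x3, ?w\<rangle> = 0"
      by (simp add: br)
    moreover have "\<langle>?x, c \<cdot> x3\<rangle> = ?x5"
      by (simp add: br scale_right_distrib mult.commute)
    moreover have central: "\<langle>v, x5\<rangle> = 0" "\<langle>v, x6\<rangle> = 0" for v
      using mem by (simp_all add: zero)
    ultimately have "pair_brackets L [?x, y, c \<cdot> x3, ?w, ?x5, c \<cdot> x6] =
        [c \<cdot> x3, ?x5, (b * c + r * r) \<cdot> c \<cdot> x6, 0, 0,
         c \<cdot> x6, ?x5, 0, 0,
         0, 0, 0, 0, 0, 0]"
      by (simp only: pair_brackets.simps list.map append.simps list.inject simp_thms)
        (simp add: br central)
    with iso_L_6_24[OF span'] show ?thesis by blast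
  qed
  obtain x y w where t: "radical_triple x y w"
    using obtain_radical_triple[OF dims(1,2)] .
  obtain a b c d where abcd: "\<langle>x, w\<rangle> = a \<cdot> \<langle>x, \<langle>x, y\<rangle>\<rangle> + b \<cdot> \<langle>y, \<langle>x, y\<rangle>\<rangle>" "\<langle>y, w\<rangle> = c \<cdot> \<langle>x, \<langle>x, y\<rangle>\<rangle> + d \<cdot> \<langle>y, \<langle>x, y\<rangle>\<rangle>"
    using coords[OF t] by blast
  \<comment> \<open>The condition \<open>c\<close> nonzero says that \<open>y\<close> is not an
    eigenvector of \<open>M\<close>. If \<open>y\<close> is one, then \<open>x\<close> or
    \<open>x + y\<close> serves instead, unless \<open>M\<close> is scalar.\<close>
  consider "c \<noteq> 0" | "b \<noteq> 0" | "b = 0" "c = 0" "a \<noteq> d" | "b = 0" "c = 0" "a = d" by blast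
  then show ?thesis
  proof cases
    case 1
    then show ?thesis using main[OF t abcd] by blast
  next
    case 2
    have "\<langle>y, w\<rangle> = (- d) \<cdot> \<langle>y, \<langle>y, x\<rangle>\<rangle> + (- c) \<cdot> \<langle>x, \<langle>y, x\<rangle>\<rangle>" "\<langle>x, w\<rangle> = (- b) \<cdot> \<langle>y, \<langle>y, x\<rangle>\<rangle> + (- a) \<cdot> \<langle>x, \<langle>y, x\<rangle>\<rangle>"
      unfolding abcd bracket_commute[of y x] by simp_all
    from main[OF radical_triple_swap[OF t] this] 2 show ?thesis by simp
  next
    case 3
    have "\<langle>x, w\<rangle> = a \<cdot> \<langle>x, \<langle>x, y + 1 \<cdot> x\<rangle>\<rangle> + 0 \<cdot> \<langle>y + 1 \<cdot> x, \<langle>x, y + 1 \<cdot> x\<rangle>\<rangle>"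
      "\<langle>y + 1 \<cdot> x, w\<rangle> = (a - d) \<cdot> \<langle>x, \<langle>x, y + 1 \<cdot> x\<rangle>\<rangle> + d \<cdot> \<langle>y + 1 \<cdot> x, \<langle>x, y + 1 \<cdot> x\<rangle>\<rangle>"
      using 3 by (simp_all add: abcd scale_right_distrib scale_left_diff_distrib)
    from main[OF radical_triple_add[OF t] this] 3 show ?thesis by simp
  next
    case 4
    define x3 where "x3 = \<langle>x, y\<rangle>"
    define x5 where "x5 = \<langle>x, x3\<rangle>"
    define x6 where "x6 = \<langle>y, x3\<rangle>"
    have mem: "x3 \<in> D 1" "x5 \<in> D 2" "x6 \<in> D 2"
      by (simp_all add: x3_def x5_def x6_def bracket_mem)
    have br: "\<langle>x, y\<rangle> = x3" "\<langle>x, x3\<rangle> = x5" "\<langle>y, x3\<rangle> = x6" "\<langle>x3, w\<rangle> = 0"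
      "\<langle>x, w\<rangle> = a \<cdot> x5" "\<langle>y, w\<rangle> = a \<cdot> x6" "\<langle>x5, w\<rangle> = 0" "\<langle>x6, w\<rangle> = 0"
      using 4 abcd w[OF t] bracket_commute[of x3 w] mem
      by (simp_all add: x3_def x5_def x6_def zero bracket_mem)
    have central: "\<langle>v, x5\<rangle> = 0" "\<langle>v, x6\<rangle> = 0" "\<langle>x5, v\<rangle> = 0" "\<langle>x6, v\<rangle> = 0" for v
      using mem by (simp_all add: zero)
    \<comment> \<open>For scalar \<open>M = a\<close> the corrected vector \<open>w - a x3\<close>
      is central and spans the summand \<open>I\<close>.\<close>
    have span': "span {x, y, x3, x5, x6, w - a \<cdot> x3} = UNIV"
    proof -
      have "span {x, y, w - a \<cdot> x3, x3, x5, x6} = UNIV"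
        by (rule span_triangular_change[OF span[OF t, folded x3_def, folded x5_def x6_def], of 1 1 1 1 1 1];
            (simp add: span_zero)?; (intro span_neg span_scale span_base; simp)?)
      then show ?thesis by (simp add: insert_commute)
    qed
    have "L \<cong>\<^sub>L L_6_9"
      by (rule iso_L_6_9[OF span']) (simp add: br central)
    then show ?thesis ..
  qed
qed

text \<open>After \<open>w\<close> is made to commute with \<open>x\<close>, the constants are
  \<open>a\<close> in \<open>[y, x3]\<close> and \<open>d\<close>, \<open>g\<close> in
  \<open>[y, w]\<close>; Jacobi gives \<open>[x3, w] = d x6\<close>. If \<open>d\<close> is nonzero,
  both other constants can be removed and 13 results; if \<open>d = 0\<close>, scaling
  \<open>y\<close> and \<open>w\<close> brings \<open>a\<close> and \<open>g\<close> to 0 or 1, and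
  the four possibilities are 7, 6, 12 and 11.\<close>

lemma type_3_1_1_1:
  assumes two: "(2::'a) \<noteq> 0" and dims: "dim (D 1) = 3" "dim (D 2) = 2" "dim (D 3) = 1"
  shows "L \<cong>\<^sub>L L_6_6 \<or> L \<cong>\<^sub>L L_6_7 \<or> L \<cong>\<^sub>L L_6_11 \<or> L \<cong>\<^sub>L L_6_12 \<or> L \<cong>\<^sub>L L_6_13"
proof -
  have D4: "D 4 = {0}"
    using lower_central_Suc_eq_0[of 3] dims by simp
  note zero = bracket_mem_D_4[unfolded D4 singleton_iff]
  have "\<exists>x y w. radical_triple x y w \<and> \<langle>x, \<langle>x, y\<rangle>\<rangle> \<notin> D 3 \<and> \<langle>y, \<langle>x, y\<rangle>\<rangle> \<in> D 3"
  proof -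
    \<comment> \<open>As with filiform pairs, \<open>y\<close> is shifted along \<open>x\<close>
      until its bracket with \<open>[x, y]\<close> falls into \<open>D 3\<close>.\<close>
    have main: ?thesis if t: "radical_triple x y w" and nm: "\<langle>x, \<langle>x, y\<rangle>\<rangle> \<notin> D 3" for x y w
    proof -
      have "D 2 = span ({\<langle>x, \<langle>x, y\<rangle>\<rangle>} \<union> D 3)"
        using nm dims by (intro D_eq_span_insert) (simp_all add: bracket_mem)
      then have "\<langle>y, \<langle>x, y\<rangle>\<rangle> \<in> span (insert \<langle>x, \<langle>x, y\<rangle>\<rangle> (D 3))"
        using bracket_mem_D_2(1)[OF bracket_mem_D_1] by (metis insert_is_Un)
      then obtain c where c: "\<langle>y, \<langle>x, y\<rangle>\<rangle> - c \<cdot> \<langle>x, \<langle>x, y\<rangle>\<rangle> \<in> D 3"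
        using mem_span_insertE subspace_lower_central by metis
      have "radical_triple x (y + (- c) \<cdot> x) w"
        by (rule radical_triple_add[OF t])
      moreover have "\<langle>x, \<langle>x, y + (- c) \<cdot> x\<rangle>\<rangle> \<notin> D 3" "\<langle>y + (- c) \<cdot> x, \<langle>x, y + (- c) \<cdot> x\<rangle>\<rangle> \<in> D 3"
        using nm c by simp_all
      ultimately show ?thesis by blast
    qed
    obtain x y w where t: "radical_triple x y w"
      using obtain_radical_triple[OF dims(1,2)] .
    have "\<langle>x, \<langle>x, y\<rangle>\<rangle> \<notin> D 3 \<or> \<langle>y, \<langle>x, y\<rangle>\<rangle> \<notin> D 3"
    proof (rule ccontr)
      assume "\<not> ?thesis"
      then have "span ({\<langle>x, \<langle>x, y\<rangle>\<rangle>, \<langle>y, \<langle>x, y\<rangle>\<rangle>} \<union> D 3) = span (D 3)"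
        by (simp add: insert_absorb)
      then have "D 2 = D 3"
        using radical_triple_brackets(2)[OF t] span_eq_iff[THEN iffD2, OF subspace_lower_central] by metis
      with dims show False by simp
    qed
    moreover have "\<langle>y, \<langle>y, x\<rangle>\<rangle> \<notin> D 3" if "\<langle>y, \<langle>x, y\<rangle>\<rangle> \<notin> D 3"
    proof
      assume "\<langle>y, \<langle>y, x\<rangle>\<rangle> \<in> D 3"
      then have "- \<langle>y, \<langle>y, x\<rangle>\<rangle> \<in> D 3" by (rule subspace_neg[OF subspace_lower_central])
      with that show False unfolding bracket_commute[of y x] by simp
    qed
    ultimately show ?thesis
      using main[OF t] main[OF radical_triple_swap[OF t]] by blast
  qed
  then obtain x y w0 where t: "radical_triple x y w0"
    and p: "\<langle>x, \<langle>x, y\<rangle>\<rangle> \<notin> D 3" "\<langle>y, \<langle>x, y\<rangle>\<rangle> \<in> D 3" by blast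
  have *: "span ({x, y, w0} \<union> D 1) = UNIV" "D 1 = span ({\<langle>x, y\<rangle>} \<union> D 2)" "\<langle>x, w0\<rangle> \<in> D 2" "\<langle>y, w0\<rangle> \<in> D 2"
    using t unfolding radical_triple_def by blast+
  define x3 where "x3 = \<langle>x, y\<rangle>"
  define x5 where "x5 = \<langle>x, x3\<rangle>"
  define x6 where "x6 = \<langle>x, x5\<rangle>"
  have mem: "x3 \<in> D 1" "x5 \<in> D 2" "x6 \<in> D 3" "\<langle>y, x3\<rangle> \<in> D 3" "\<langle>w0, x3\<rangle> \<in> D 3"
    using p(2) radical_triple_brackets(1)[OF t] by (simp_all add: x3_def x5_def x6_def bracket_mem)
  have mem1: "x5 \<in> D 1" "x6 \<in> D 1" "x6 \<in> D 2"
    using mem mem_D_antimono[of x5 2 1] mem_D_antimono[of x6 3 1] mem_D_antimono[of x6 3 2] by simp_all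
  have yx5: "\<langle>y, x5\<rangle> = 0"
    using jacobi_left[of x y x3] mem by (simp add: zero flip: x3_def x5_def)
  have w0x5: "\<langle>w0, x5\<rangle> = 0"
  proof -
    have "\<langle>\<langle>x, w0\<rangle>, x3\<rangle> = \<langle>x, \<langle>w0, x3\<rangle>\<rangle> - \<langle>w0, x5\<rangle>"
      using jacobi_left[of x w0 x3] by (simp flip: x5_def)
    then show ?thesis
      using * mem by (simp add: zero)
  qed
  have D2: "D 2 = span ({x5} \<union> D 3)"
    using p dims mem by (intro D_eq_span_insert) (simp_all add: x3_def x5_def)
  have "D 3 = span ({x6, \<langle>y, x5\<rangle>, \<langle>w0, x5\<rangle>} \<union> D 4)"
    by (rule D_eq_span[OF *(1) D2]) (auto simp: x6_def)
  then have D3: "D 3 = span {x6}"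
    by (simp add: D4 yx5 w0x5 insert_commute)
  then have x6: "x6 \<noteq> 0" using dims by auto
  have coords: "\<exists>b c. v = b \<cdot> x5 + c \<cdot> x6" if "v \<in> D 2" for v
  proof -
    have "v \<in> span (insert x5 (D 3))" using that D2 by simp
    then obtain b where "v - b \<cdot> x5 \<in> D 3"
      using mem_span_insertE subspace_lower_central by metis
    then obtain c where "v - b \<cdot> x5 = c \<cdot> x6"
      unfolding D3 span_singleton by blast
    then show ?thesis by (metis add.commute diff_add_cancel)
  qed
  obtain b c where bc: "\<langle>x, w0\<rangle> = b \<cdot> x5 + c \<cdot> x6"
    using coords[OF *(3)] by blast
  \<comment> \<open>The value \<open>b x5 + c x6\<close> of \<open>[x, w0]\<close> is also
    \<open>[x, b x3 + c x5]\<close>, so it can be subtracted.\<close>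
  define w where "w = w0 - b \<cdot> x3 - c \<cdot> x5"
  have xw: "\<langle>x, w\<rangle> = 0"
    by (simp add: w_def bc flip: x5_def x6_def)
  have "\<langle>y, w\<rangle> \<in> D 2"
    unfolding w_def bracket_diff_right bracket_scale_right using *(4) mem
    by (intro subspace_diff subspace_scale subspace_lower_central) (simp_all add: bracket_mem yx5)
  then obtain d g where yw: "\<langle>y, w\<rangle> = d \<cdot> x5 + g \<cdot> x6"
    using coords by blast
  have x3w: "\<langle>x3, w\<rangle> = d \<cdot> x6"
    using jacobi_left[of x y w] mem by (simp add: xw yw zero flip: x3_def x6_def)
  obtain a where a: "\<langle>y, x3\<rangle> = a \<cdot> x6"
    using mem(4) unfolding D3 span_singleton by blast
  have "UNIV = span ({x, y, w0} \<union> span ({x3} \<union> span ({x5} \<union> span {x6})))"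
    using *(1,2) D2 D3 x3_def by metis
  then have span0: "span {x, y, w0, x3, x5, x6} = UNIV"
    unfolding span_Un_span_right by (simp add: insert_commute)
  have "w - 1 \<cdot> w0 = - (b \<cdot> x3 + c \<cdot> x5)"
    by (simp add: w_def)
  moreover have "- (b \<cdot> x3 + c \<cdot> x5) \<in> span {x3, x5, x6}"
    by (intro span_neg span_add span_scale span_base) simp_all
  ultimately have span: "span {x, y, w, x3, x5, x6} = UNIV"
    by (intro span_triangular_change[OF span0, of 1 1 1 1 1 1]) (simp_all add: span_zero)
  have central: "\<langle>v, x6\<rangle> = 0" "\<langle>x6, v\<rangle> = 0" for v
    using mem by (simp_all add: zero)
  have br: "\<langle>x, y\<rangle> = x3" "\<langle>x, x3\<rangle> = x5" "\<langle>x, x5\<rangle> = x6"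
    by (simp_all flip: x3_def x5_def x6_def)
  have x35: "\<langle>x3, x5\<rangle> = 0" "\<langle>x5, x3\<rangle> = 0"
    using mem by (simp_all add: zero)
  have wx5: "\<langle>w, x5\<rangle> = 0"
    by (simp add: w_def w0x5 x35)
  have "\<langle>x5, w\<rangle> = 0" "\<langle>x5, y\<rangle> = 0" "\<langle>w, y\<rangle> = - (d \<cdot> x5) - g \<cdot> x6" "\<langle>w, x3\<rangle> = - (d \<cdot> x6)"
    unfolding bracket_commute[of x5 w] bracket_commute[of x5 y] bracket_commute[of w y]
      bracket_commute[of w x3] yw x3w
    by (simp_all add: wx5 yx5)
  note br = br this x35 wx5
  note br = br xw yw x3w a yx5 central
  show ?thesis
  proof (cases "d = 0")
    case False
    \<comment> \<open>Here \<open>[?y, ?w] = x5 + (g / d) x6\<close>, while replacing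
      \<open>x\<close> by \<open>x + r ?w\<close> turns \<open>[x, [x, y]]\<close> into
      \<open>x5 - 2 r x6\<close>. This \<open>r\<close> makes the two agree, as 13 requires. The
      shift of \<open>y\<close> by \<open>(a / d) w\<close> has already cancelled
      \<open>a\<close>.\<close>
    define r where "r = - (g / d) / 2"
    have r: "- r - r = g / d" using two by (simp add: r_def field_simps)
    let ?y = "y + (a / d) \<cdot> w" and ?w = "inverse d \<cdot> w"
    have g6: "(g / d) \<cdot> x6 = - (r \<cdot> x6) - r \<cdot> x6"
      unfolding r[symmetric] by (simp only: scale_left_diff_distrib scale_minus_left)
    have 1: "\<langle>?y, ?w\<rangle> = x5 - r \<cdot> x6 - r \<cdot> x6" "\<langle>?y, x3\<rangle> = 0" "\<langle>?y, x5\<rangle> = 0" "\<langle>x, ?y\<rangle> = x3" "\<langle>x3, ?w\<rangle> = x6"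
    proof -
      have "\<langle>?y, ?w\<rangle> = x5 + (g / d) \<cdot> x6"
        using False by (simp add: br scale_right_distrib divide_inverse mult.commute)
      then show "\<langle>?y, ?w\<rangle> = x5 - r \<cdot> x6 - r \<cdot> x6" unfolding g6 by simp
    qed (use False in \<open>simp_all add: br\<close>)
    let ?x = "x + r \<cdot> ?w" and ?x3 = "x3 - r \<cdot> (x5 - r \<cdot> x6 - r \<cdot> x6)" and ?x5 = "x5 - r \<cdot> x6 - r \<cdot> x6"
    have wy: "\<langle>?w, ?y\<rangle> = - ?x5"
      using 1(1) by (subst bracket_commute) simp
    have wx3: "\<langle>?w, x3\<rangle> = - x6"
      using 1(5) by (subst bracket_commute) simp
    have span': "span {?x, ?y, ?x3, ?w, ?x5, x6} = UNIV"
    proof -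
      have "span {?x, ?y, ?w, ?x3, ?x5, x6} = UNIV"
        by (rule span_triangular_change[OF span, of 1 1 "inverse d" 1 1 1];
            (simp add: span_zero False)?;
            (intro span_add span_diff span_neg span_scale span_base; simp)?)
      then show ?thesis by (simp add: insert_commute)
    qed
    have "\<langle>?x, ?y\<rangle> = ?x3"
      unfolding bracket_add_left[of x] bracket_scale_left[of r] 1 wy
      by (simp only: scale_minus_right add_uminus_conv_diff)
    moreover have "\<langle>?x, ?x3\<rangle> = ?x5"
      using wx3 False by (simp add: br)
    moreover have "\<langle>?y, ?x3\<rangle> = 0"
      unfolding bracket_diff_right bracket_scale_right 1 by (simp add: br)
    moreover have "\<langle>?y, ?x5\<rangle> = 0"
      unfolding bracket_diff_right bracket_scale_right 1 by (simp add: br)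
    moreover have "\<langle>?x3, ?w\<rangle> = x6" "\<langle>?x, ?w\<rangle> = 0" "\<langle>?x, ?x5\<rangle> = x6" "\<langle>?x3, ?x5\<rangle> = 0" "\<langle>?w, ?x5\<rangle> = 0"
      using False by (simp_all add: br)
    ultimately have "pair_brackets L [?x, ?y, ?x3, ?w, ?x5, x6] =
        [?x3, ?x5, 0, x6, 0,
         0, ?x5, 0, 0,
         x6, 0, 0, 0, 0, 0]"
      using 1(1) by (simp only: pair_brackets.simps list.map append.simps list.inject simp_thms central)
    with iso_L_6_13[OF span'] show ?thesis by blast
  next
    case True
    define k where "k = (if a = 0 then 1 else inverse a)"
    have k: "k \<noteq> 0" by (simp add: k_def)
    define h where "h = (if g = 0 then 1 else inverse g)"
    have h: "h \<noteq> 0" by (simp add: h_def)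
    have span': "span {x, k \<cdot> y, h \<cdot> w, k \<cdot> x3, k \<cdot> x5, k \<cdot> x6} = UNIV"
      by (rule span_triangular_change[OF span, of 1 k h k k k];
          (simp add: span_zero k h)?)
    \<comment> \<open>If \<open>g\<close> is nonzero, \<open>w\<close> is the fifth basis vector and
      \<open>x6\<close> the last; if \<open>g = 0\<close>, then \<open>w\<close> is central and
      comes last as the summand \<open>I\<close>.\<close>
    then have span1: "span {x, k \<cdot> y, k \<cdot> x3, k \<cdot> x5, h \<cdot> w, k \<cdot> x6} = UNIV"
      and span2: "span {x, k \<cdot> y, k \<cdot> x3, k \<cdot> x5, k \<cdot> x6, h \<cdot> w} = UNIV"
      by (simp_all add: insert_commute)
    have t1: "pair_brackets L [x, k \<cdot> y, k \<cdot> x3, k \<cdot> x5, h \<cdot> w, k \<cdot> x6] =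
        [k \<cdot> x3, k \<cdot> x5, k \<cdot> x6, 0, 0,
         (k * a) \<cdot> k \<cdot> x6, 0, (h * g) \<cdot> k \<cdot> x6, 0,
         0, 0, 0, 0, 0, 0]"
      using True by (simp add: br mult_ac)
    have t2: "pair_brackets L [x, k \<cdot> y, k \<cdot> x3, k \<cdot> x5, k \<cdot> x6, h \<cdot> w] =
        [k \<cdot> x3, k \<cdot> x5, k \<cdot> x6, 0, 0,
         (k * a) \<cdot> k \<cdot> x6, 0, 0, (h * g) \<cdot> k \<cdot> x6,
         0, 0, 0, 0, 0, 0]"
      using True by (simp add: br mult_ac)
    have ka: "k * a = (if a = 0 then 0 else 1)" and hg: "h * g = (if g = 0 then 0 else 1)"
      by (simp_all add: k_def h_def)
    consider "a = 0" "g = 0" | "a \<noteq> 0" "g = 0" | "a = 0" "g \<noteq> 0" | "a \<noteq> 0" "g \<noteq> 0" by blast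
    then show ?thesis
    proof cases
      case 1
      then have "k * a = 0" "h * g = 0" by simp_all
      from iso_L_6_7[OF span2 t2[unfolded this scale_zero_left]] show ?thesis by blast
    next
      case 2
      then have "k * a = 1" "h * g = 0" by (simp_all add: ka)
      from iso_L_6_6[OF span2 t2[unfolded this scale_zero_left scale_one]] show ?thesis by blast
    next
      case 3
      then have "k * a = 0" "h * g = 1" by (simp_all add: hg)
      from iso_L_6_12[OF span1 t1[unfolded this scale_zero_left scale_one]] show ?thesis by blast
    next
      case 4
      then have "k * a = 1" "h * g = 1" by (simp_all add: ka hg)
      from iso_L_6_11[OF span1 t1[unfolded this scale_one]] show ?thesis by blast
    qed
  qed
qed

subsection \<open>Four and more generators\<close>

lemma type_6:
  assumes "dim (D 1) = 0"
  shows "L \<cong>\<^sub>L L_6_1"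
proof -
  have D1: "D 1 = {0}"
    using assms zero_mem_D[of 1] by (simp only: dim_eq_0) blast
  obtain xs where xs: "length xs = 6" "span (set xs \<union> {}) = UNIV"
    using obtain_complement[of "{}" 6] dim_UNIV_6 by auto
  then obtain x1 x2 x3 x4 x5 x6 where "xs = [x1, x2, x3, x4, x5, x6]"
    by (auto simp: length_Suc_conv numeral_eq_Suc)
  with xs(2) have span: "span {x1, x2, x3, x4, x5, x6} = UNIV"
    by (simp add: insert_commute)
  have "\<langle>x, y\<rangle> = 0" for x y
    using bracket_mem_D_1 D1 by blast
  then show ?thesis
    by (intro iso_L_6_1[OF span]) simp
qed

text \<open>The bracket is an alternating form with values in the line of \<open>z\<close>; a pair
  with nonzero bracket spans a non-degenerate plane, along which \<open>c\<close> is
  projected.\<close>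

lemma orthogonal_shift:
  assumes "D 1 = span {z}" "\<langle>a, b\<rangle> \<noteq> 0"
  obtains s t where "\<langle>a, c + s \<cdot> a + t \<cdot> b\<rangle> = 0" "\<langle>b, c + s \<cdot> a + t \<cdot> b\<rangle> = 0"
proof -
  have "\<exists>k. \<langle>x, y\<rangle> = k \<cdot> z" for x y
    using bracket_mem_D_1[of x y] unfolding assms(1) span_singleton by blast
  then obtain p q r where pqr: "\<langle>a, b\<rangle> = p \<cdot> z" "\<langle>a, c\<rangle> = q \<cdot> z" "\<langle>b, c\<rangle> = r \<cdot> z"
    by metis
  with assms(2) have "p \<noteq> 0" by auto
  then show ?thesis
    using that[of "r / p" "- q / p"] pqr bracket_commute[of b a]
    by (simp add: scale_left_distrib[symmetric])
qed

text \<open>This is the normal form of a nonzero alternating form on the five-dimensional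
  \<open>L / D 1\<close>: its rank is 2 or 4, so at most two hyperbolic pairs split off.\<close>

lemma type_5_1:
  assumes dims: "dim (D 1) = 1"
  shows "L \<cong>\<^sub>L L_6_2 \<or> L \<cong>\<^sub>L L_6_4"
proof -
  have D2: "D 2 = {0}"
    using lower_central_Suc_eq_0[of 1] dims by (simp add: numeral_2_eq_2 One_nat_def)
  obtain B where B: "finite B" "card B = 5" "span (B \<union> D 1) = UNIV"
    using obtain_complement_set[of "D 1" 5] dims dim_UNIV_6 by auto
  have "\<exists>a\<in>B. \<exists>b\<in>B. \<langle>a, b\<rangle> \<noteq> 0"
  proof (rule ccontr)
    assume "\<not> ?thesis"
    then have "{\<langle>a, b\<rangle> | a b. a \<in> B \<and> b \<in> B} \<union> D 2 \<subseteq> {0}"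
      using D2 by auto
    then have "D 1 \<subseteq> {0}"
      using D_1_eq_span[OF B(3)] span_minimal[of _ "{0}"] by simp
    with dims show False using dim_subset[of "D 1" "{0}"] by simp
  qed
  then obtain a b where ab: "a \<in> B" "b \<in> B" "\<langle>a, b\<rangle> \<noteq> 0" by blast
  then have "a \<noteq> b" by auto
  with ab B have "card (B - {a, b}) = 3" by simp
  then obtain c d f where cdf: "B - {a, b} = {c, d, f}"
    by (auto simp: card_3_iff)
  then have "B = {a, b, c, d, f}" using ab by blast
  define z where "z = \<langle>a, b\<rangle>"
  have z: "z \<noteq> 0" "z \<in> D 1" using ab by (simp_all add: z_def bracket_mem)
  have D1: "D 1 = span {z}"
    using D_eq_span_insert[of z 1 2] z dims by (simp add: D2 insert_commute)
  have coeff: "\<exists>k. \<langle>x, y\<rangle> = k \<cdot> z" for x y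
    using bracket_mem_D_1[of x y] unfolding D1 span_singleton by blast
  have "UNIV = span ({a, b, c, d, f} \<union> span {z})"
    using B(3) D1 \<open>B = _\<close> by simp
  then have span: "span {c, d, f, a, b, z} = UNIV"
    unfolding span_Un_span_right by (simp add: insert_commute)
  obtain s1 t1 where 1: "\<langle>a, c + s1 \<cdot> a + t1 \<cdot> b\<rangle> = 0" "\<langle>b, c + s1 \<cdot> a + t1 \<cdot> b\<rangle> = 0"
    using orthogonal_shift[OF D1 ab(3)] .
  obtain s2 t2 where 2: "\<langle>a, d + s2 \<cdot> a + t2 \<cdot> b\<rangle> = 0" "\<langle>b, d + s2 \<cdot> a + t2 \<cdot> b\<rangle> = 0"
    using orthogonal_shift[OF D1 ab(3)] .
  obtain s3 t3 where 3: "\<langle>a, f + s3 \<cdot> a + t3 \<cdot> b\<rangle> = 0" "\<langle>b, f + s3 \<cdot> a + t3 \<cdot> b\<rangle> = 0"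
    using orthogonal_shift[OF D1 ab(3)] .
  define c' where "c' = c + s1 \<cdot> a + t1 \<cdot> b"
  define d' where "d' = d + s2 \<cdot> a + t2 \<cdot> b"
  define f' where "f' = f + s3 \<cdot> a + t3 \<cdot> b"
  have span': "span {c', d', f', a, b, z} = UNIV"
    by (rule span_triangular_change[OF span, of 1 1 1 1 1 1];
        (simp add: c'_def d'_def f'_def span_zero)?; (intro span_add span_scale span_base; simp)?)
  have zero: "\<langle>x, z\<rangle> = 0" "\<langle>z, x\<rangle> = 0" for x
    using bracket_mem_D_2[unfolded D2 singleton_iff] z by simp_all
  \<comment> \<open>The pair \<open>c\<close>, \<open>d\<close> is a second hyperbolic pair
    orthogonal to \<open>a\<close>, \<open>b\<close>; the remaining vector, projected along it, is
    central.\<close>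
  have main: ?thesis
    if sp: "span {c, d, f, a, b, z} = UNIV" and cd: "\<langle>c, d\<rangle> \<noteq> 0"
      and o: "\<langle>a, c\<rangle> = 0" "\<langle>b, c\<rangle> = 0" "\<langle>a, d\<rangle> = 0" "\<langle>b, d\<rangle> = 0" "\<langle>a, f\<rangle> = 0" "\<langle>b, f\<rangle> = 0" for c d f
  proof -
    obtain s t where st: "\<langle>c, f + s \<cdot> c + t \<cdot> d\<rangle> = 0" "\<langle>d, f + s \<cdot> c + t \<cdot> d\<rangle> = 0"
      using orthogonal_shift[OF D1 cd] .
    define g where "g = f + s \<cdot> c + t \<cdot> d"
    obtain q where q: "\<langle>c, d\<rangle> = q \<cdot> z" using coeff by blast
    with cd have q0: "q \<noteq> 0" by auto
    have "span {f, c, d, a, b, z} = UNIV" using sp by (simp add: insert_commute)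
    then have "span {g, c, inverse q \<cdot> d, a, b, z} = UNIV"
      by (rule span_triangular_change[of f c d a b z 1 1 "inverse q" 1 1 1])
        (simp_all add: g_def q0 span_zero span_add span_scale span_base)
    then have span'': "span {a, b, c, inverse q \<cdot> d, z, g} = UNIV"
      by (simp add: insert_commute)
    have "L \<cong>\<^sub>L L_6_4"
      by (rule iso_L_6_4[OF span'']) (simp add: z_def[symmetric] o q q0 zero st[folded g_def], simp add: g_def o)
    then show ?thesis ..
  qed
  have o: "\<langle>a, c'\<rangle> = 0" "\<langle>b, c'\<rangle> = 0" "\<langle>a, d'\<rangle> = 0" "\<langle>b, d'\<rangle> = 0" "\<langle>a, f'\<rangle> = 0" "\<langle>b, f'\<rangle> = 0"
    using 1 2 3 by (simp_all only: c'_def d'_def f'_def)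
  consider "\<langle>c', d'\<rangle> \<noteq> 0" | "\<langle>c', f'\<rangle> \<noteq> 0" | "\<langle>d', f'\<rangle> \<noteq> 0"
    | "\<langle>c', d'\<rangle> = 0" "\<langle>c', f'\<rangle> = 0" "\<langle>d', f'\<rangle> = 0" by blast
  then show ?thesis
  proof cases
    case 1
    then show ?thesis using main[OF span'] o by blast
  next
    case 2
    moreover have "span {c', f', d', a, b, z} = UNIV" using span' by (simp add: insert_commute)
    ultimately show ?thesis using main o by blast
  next
    case 3
    moreover have "span {d', f', c', a, b, z} = UNIV" using span' by (simp add: insert_commute)
    ultimately show ?thesis using main o by blast
  next
    case 4
    have "span {a, b, z, c', d', f'} = UNIV" using span' by (simp add: insert_commute)
    then have "L \<cong>\<^sub>L L_6_2"
      by (rule iso_L_6_2) (simp add: z_def[symmetric] o 4 zero)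
    then show ?thesis ..
  qed
qed

text \<open>If \<open>[a, b]\<close> and \<open>[c, d]\<close> are independent and no \<open>ad x\<close> has rank 2, then \<open>[a, d]\<close> and \<open>[c, b]\<close> lie in
  two distinct lines and vanish, so \<open>a + c\<close> has rank 2 after all.\<close>

lemma exists_rank_two:
  assumes "dim (D 1) = 2"
  shows "\<exists>x u v. \<langle>x, u\<rangle> \<noteq> 0 \<and> \<langle>x, v\<rangle> \<notin> span {\<langle>x, u\<rangle>}"
proof (rule ccontr)
  assume neg: "\<not> ?thesis"
  have D1: "D 1 = span {\<langle>x, y\<rangle> | x y. True}"
    using lower_central.simps(2)[of L 0] by (simp add: One_nat_def)
  obtain a b where ab: "\<langle>a, b\<rangle> \<noteq> 0"
  proof (rule ccontr)
    assume "\<not> thesis"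
    then have "{\<langle>x, y\<rangle> | x y. True} \<subseteq> {0}" using that by blast
    then have "D 1 \<subseteq> {0}" unfolding D1 by (rule span_minimal) simp
    with assms show False using dim_subset[of "D 1" "{0}"] by simp
  qed
  obtain c d where cd: "\<langle>c, d\<rangle> \<notin> span {\<langle>a, b\<rangle>}"
  proof (rule ccontr)
    assume "\<not> thesis"
    then have "{\<langle>x, y\<rangle> | x y. True} \<subseteq> span {\<langle>a, b\<rangle>}" using that by blast
    then have "D 1 \<subseteq> span {\<langle>a, b\<rangle>}" unfolding D1 by (rule span_minimal) simp
    then have "dim (D 1) \<le> dim (span {\<langle>a, b\<rangle>})" by (rule dim_subset)
    with assms ab show False by simp
  qed
  then have cd0: "\<langle>c, d\<rangle> \<noteq> 0" using span_zero by metis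
  have disjoint: "v = 0" if v: "v \<in> span {\<langle>a, b\<rangle>}" "v \<in> span {\<langle>c, d\<rangle>}" for v
  proof (rule ccontr)
    assume "v \<noteq> 0"
    obtain k where "v = k \<cdot> \<langle>c, d\<rangle>" using v(2) by (auto simp: span_singleton)
    with \<open>v \<noteq> 0\<close> have "\<langle>c, d\<rangle> = inverse k \<cdot> v" by auto
    with v(1) cd show False by (simp add: span_scale)
  qed
  have R: "\<langle>x, v\<rangle> \<in> span {\<langle>x, u\<rangle>}" if "\<langle>x, u\<rangle> \<noteq> 0" for x u v
    using neg that by blast
  have R': "\<langle>v, x\<rangle> \<in> span {\<langle>x, u\<rangle>}" "\<langle>x, v\<rangle> \<in> span {\<langle>u, x\<rangle>}" "\<langle>v, x\<rangle> \<in> span {\<langle>u, x\<rangle>}"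
    if "\<langle>x, u\<rangle> \<noteq> 0" for x u v
    using R[OF that, of v] span_neg span_insert_uminus[of "\<langle>x, u\<rangle>" "{}"]
    unfolding bracket_commute[of v x] bracket_commute[of u x] by auto
  have ba: "\<langle>b, a\<rangle> \<noteq> 0" and dc: "\<langle>d, c\<rangle> \<noteq> 0"
    using ab cd0 bracket_commute[of b a] bracket_commute[of d c] by simp_all
  have "\<langle>c, b\<rangle> = 0"
    by (rule disjoint) (use R'(3)[OF ba] R[OF cd0] in blast)+
  moreover have "\<langle>a, d\<rangle> = 0"
    by (rule disjoint) (use R[OF ab] R'(3)[OF dc] in blast)+
  ultimately have "\<langle>a + c, b\<rangle> \<noteq> 0" "\<langle>a + c, d\<rangle> \<notin> span {\<langle>a + c, b\<rangle>}"
    using ab cd by simp_all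
  with neg show False by blast
qed

text \<open>The two coordinates of the bracket form a pencil of alternating forms on the
  four-dimensional \<open>L / D 1\<close>. Here \<open>ad x\<close> maps the plane of
  \<open>u\<close> and \<open>v\<close> isomorphically onto \<open>D 1\<close>, and only
  \<open>[u, w]\<close> and \<open>[v, w]\<close> remain free.\<close>

definition pencil_basis :: "'v \<Rightarrow> 'v \<Rightarrow> 'v \<Rightarrow> 'v \<Rightarrow> bool" where
  "pencil_basis x u v w \<longleftrightarrow> span {x, u, v, w, \<langle>x, u\<rangle>, \<langle>x, v\<rangle>} = UNIV \<and>
    D 1 = span {\<langle>x, u\<rangle>, \<langle>x, v\<rangle>} \<and> \<langle>x, w\<rangle> = 0 \<and> \<langle>u, v\<rangle> = 0"

lemma obtain_pencil_basis:
  assumes dims: "dim (D 1) = 2" "dim (D 2) = 0"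
  obtains x u v w where "pencil_basis x u v w"
proof -
  have D2: "D 2 = {0}"
    using dims(2) zero_mem_D[of 2] by (simp only: dim_eq_0) blast
  note zero = bracket_mem_D_2[unfolded D2 singleton_iff]
  obtain x u v where xuv: "\<langle>x, u\<rangle> \<noteq> 0" "\<langle>x, v\<rangle> \<notin> span {\<langle>x, u\<rangle>}"
    using exists_rank_two[OF dims(1)] by blast
  have D1: "D 1 = span {\<langle>x, u\<rangle>, \<langle>x, v\<rangle>}"
  proof -
    have "span {\<langle>x, v\<rangle>, \<langle>x, u\<rangle>} \<subseteq> D 1"
      by (intro span_minimal subspace_lower_central) (simp add: bracket_mem)
    moreover have "dim (D 1) \<le> dim (span {\<langle>x, v\<rangle>, \<langle>x, u\<rangle>})"
      using dims xuv by (simp add: dim_insert)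
    ultimately have "span {\<langle>x, v\<rangle>, \<langle>x, u\<rangle>} = D 1"
      by (intro subspace_dim_equal) (simp_all add: subspace_lower_central)
    then show ?thesis by (simp add: insert_commute)
  qed
  \<comment> \<open>The kernel of \<open>ad x\<close> contains \<open>x\<close> and
    \<open>D 1\<close>, while \<open>u\<close> and \<open>v\<close> are independent modulo it. These
    account for dimension 5, and \<open>w\<close> is the missing sixth vector.\<close>
  have ker: "\<langle>x, y\<rangle> = 0" if "y \<in> span (insert x (D 1))" for y
  proof -
    have "span (insert x (D 1)) \<subseteq> {y. \<langle>x, y\<rangle> = 0}"
      by (rule span_minimal) (auto simp: zero subspace_def)
    with that show ?thesis by blast
  qed
  have "x \<notin> span (D 1)"
    using xuv(1) by (metis bracket_commute neg_equal_0_iff_equal span_eq_iff subspace_lower_central zero(1))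
  moreover have "u \<notin> span (insert x (D 1))"
    using ker xuv(1) by blast
  moreover have "v \<notin> span (insert u (insert x (D 1)))"
  proof
    assume "v \<in> span (insert u (insert x (D 1)))"
    then obtain k where "v - k \<cdot> u \<in> span (insert x (D 1))"
      by (auto simp: span_breakdown_eq[of _ u])
    then have "\<langle>x, v - k \<cdot> u\<rangle> = 0" by (rule ker)
    then have "\<langle>x, v\<rangle> = k \<cdot> \<langle>x, u\<rangle>" by simp
    with xuv(2) show False by (simp add: span_scale span_base)
  qed
  ultimately have "dim (insert v (insert u (insert x (D 1)))) = 5"
    using dims by (simp add: dim_insert)
  then obtain ws where "length ws = 1" "span (set ws \<union> insert v (insert u (insert x (D 1)))) = UNIV"
    using obtain_complement[of "insert v (insert u (insert x (D 1)))" 1] dim_UNIV_6 by auto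
  then obtain w where "span ({w} \<union> insert v (insert u (insert x (D 1)))) = UNIV"
    by (auto simp: length_Suc_conv One_nat_def)
  then have "UNIV = span ({w, v, u, x} \<union> span {\<langle>x, u\<rangle>, \<langle>x, v\<rangle>})"
    using D1 by (simp add: insert_commute)
  then have span: "span {w, v, u, x, \<langle>x, u\<rangle>, \<langle>x, v\<rangle>} = UNIV"
    unfolding span_Un_span_right by (simp add: insert_commute)
  have "\<langle>x, w\<rangle> \<in> span {\<langle>x, u\<rangle>, \<langle>x, v\<rangle>}" "\<langle>u, v\<rangle> \<in> span {\<langle>x, u\<rangle>, \<langle>x, v\<rangle>}"
    using bracket_mem_D_1 D1 by blast+
  then obtain p q s t where pq: "\<langle>x, w\<rangle> = p \<cdot> \<langle>x, u\<rangle> + q \<cdot> \<langle>x, v\<rangle>" and st: "\<langle>u, v\<rangle> = s \<cdot> \<langle>x, u\<rangle> + t \<cdot> \<langle>x, v\<rangle>"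
    using mem_span_pair by metis
  \<comment> \<open>Shifts along \<open>x\<close> leave \<open>[x, u]\<close> and
    \<open>[x, v]\<close> unchanged and alter \<open>[u, v]\<close> by any prescribed element of
    \<open>D 1\<close>.\<close>
  define u' where "u' = u - t \<cdot> x"
  define v' where "v' = v + s \<cdot> x"
  define w' where "w' = w - q \<cdot> v - p \<cdot> u"
  have xuv': "\<langle>x, u'\<rangle> = \<langle>x, u\<rangle>" "\<langle>x, v'\<rangle> = \<langle>x, v\<rangle>" by (simp_all add: u'_def v'_def)
  have "w' - 1 \<cdot> w = - (q \<cdot> v + p \<cdot> u)" by (simp add: w'_def)
  moreover have "- (q \<cdot> v + p \<cdot> u) \<in> span {v, u, x, \<langle>x, u\<rangle>, \<langle>x, v\<rangle>}"
    by (intro span_neg span_add span_scale span_base) simp_all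
  ultimately have "span {w', v', u', x, \<langle>x, u\<rangle>, \<langle>x, v\<rangle>} = UNIV"
    by (intro span_triangular_change[OF span, of 1 1 1 1 1 1])
      (simp_all add: v'_def u'_def span_zero span_neg span_scale span_base)
  then have "span {x, u', v', w', \<langle>x, u'\<rangle>, \<langle>x, v'\<rangle>} = UNIV"
    unfolding xuv' by (simp add: insert_commute)
  moreover have "\<langle>x, w'\<rangle> = 0" by (simp add: w'_def pq)
  moreover have "\<langle>u', v'\<rangle> = 0"
    by (simp add: u'_def v'_def st bracket_commute[of u x])
  ultimately have "pencil_basis x u' v' w'"
    unfolding pencil_basis_def xuv' using D1 by blast
  then show ?thesis by (rule that)
qed

text \<open>Via \<open>ad x\<close> the map \<open>y \<mapsto> [y, w]\<close> becomes an operator on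
  the plane of \<open>u\<close> and \<open>v\<close>, with entries \<open>a, b, c, d\<close>, and
  adding \<open>m x\<close> to \<open>w\<close> subtracts \<open>m\<close> from it. The new
  \<open>u\<close> is the trace-free operator applied to \<open>v\<close>; \<open>w\<close> needs no
  scaling, since \<open>x\<close>, and thus the identification, is kept.\<close>

lemma type_4_2:
  assumes two: "(2::'a) \<noteq> 0" and dims: "dim (D 1) = 2" "dim (D 2) = 0"
  shows "L \<cong>\<^sub>L L_6_8 \<or> (\<exists>eps. L \<cong>\<^sub>L L_6_22 eps)"
proof -
  have D2: "D 2 = {0}"
    using dims(2) zero_mem_D[of 2] by (simp only: dim_eq_0) blast
  note zero = bracket_mem_D_2[unfolded D2 singleton_iff]
  have main: "\<exists>eps. L \<cong>\<^sub>L L_6_22 eps"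
    if t: "pencil_basis x u v w" and abcd: "\<langle>u, w\<rangle> = a \<cdot> \<langle>x, u\<rangle> + b \<cdot> \<langle>x, v\<rangle>"
      "\<langle>v, w\<rangle> = c \<cdot> \<langle>x, u\<rangle> + d \<cdot> \<langle>x, v\<rangle>" and c: "c \<noteq> 0" for x u v w a b c d
  proof -
    define x5 where "x5 = \<langle>x, u\<rangle>"
    define x6 where "x6 = \<langle>x, v\<rangle>"
    have span: "span {x, u, v, w, x5, x6} = UNIV" and xw: "\<langle>x, w\<rangle> = 0" and uv: "\<langle>u, v\<rangle> = 0"
      using t unfolding pencil_basis_def x5_def x6_def by blast+
    have br: "\<langle>x, u\<rangle> = x5" "\<langle>x, v\<rangle> = x6" "\<langle>u, x\<rangle> = - x5" "\<langle>v, x\<rangle> = - x6"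
      "\<langle>u, w\<rangle> = a \<cdot> x5 + b \<cdot> x6" "\<langle>v, w\<rangle> = c \<cdot> x5 + d \<cdot> x6"
      using abcd bracket_commute[of u x] bracket_commute[of v x] by (simp_all add: x5_def x6_def)
    have central: "\<langle>y, x5\<rangle> = 0" "\<langle>y, x6\<rangle> = 0" "\<langle>x5, y\<rangle> = 0" for y
      by (simp_all add: x5_def x6_def zero bracket_mem)
    define r where "r = (d - a) / 2"
    have "d - (a + r) = r" using two by (simp add: r_def field_simps)
    define m where "m = a + r"
    have m: "d - m = r" "a - m = - r" using \<open>d - (a + r) = r\<close> by (simp_all add: m_def)
    let ?u = "c \<cdot> u + r \<cdot> v" and ?w = "w + m \<cdot> x" and ?x5 = "c \<cdot> x5 + r \<cdot> x6"
    have span': "span {x, ?u, v, ?w, ?x5, x6} = UNIV"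
    proof -
      have "span {w, x, u, v, x5, x6} = UNIV" using span by (simp add: insert_commute)
      then have "span {?w, x, ?u, v, ?x5, x6} = UNIV"
        by (rule span_triangular_change[of w x u v x5 x6 1 1 c 1 c 1])
          (simp_all add: c span_zero span_scale span_base)
      then show ?thesis by (simp add: insert_commute)
    qed
    have vw: "\<langle>v, ?w\<rangle> = ?x5"
    proof -
      have "\<langle>v, ?w\<rangle> = c \<cdot> x5 + (d - m) \<cdot> x6"
        by (simp add: br scale_left_diff_distrib)
      then show ?thesis by (simp only: m)
    qed
    have uw: "\<langle>u, ?w\<rangle> = - (r \<cdot> x5) + b \<cdot> x6"
    proof -
      have "\<langle>u, ?w\<rangle> = (a - m) \<cdot> x5 + b \<cdot> x6"
        by (simp add: br scale_left_diff_distrib)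
      then show ?thesis by (simp only: m scale_minus_left)
    qed
    have "\<langle>?u, ?w\<rangle> = c \<cdot> \<langle>u, ?w\<rangle> + r \<cdot> \<langle>v, ?w\<rangle>"
      by (simp only: bracket_add_left bracket_scale_left)
    also have "\<dots> = (b * c + r * r) \<cdot> x6"
      unfolding uw vw by (simp add: scale_right_distrib scale_left_distrib algebra_simps)
    finally have "\<langle>?u, ?w\<rangle> = (b * c + r * r) \<cdot> x6" .
    moreover have "\<langle>x, ?w\<rangle> = 0" "\<langle>x, ?u\<rangle> = ?x5" "\<langle>?u, v\<rangle> = 0"
      by (simp_all add: xw br uv)
    ultimately have "pair_brackets L [x, ?u, v, ?w, ?x5, x6] =
        [?x5, x6, 0, 0, 0,
         0, (b * c + r * r) \<cdot> x6, 0, 0,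
         ?x5, 0, 0, 0, 0, 0]"
      by (simp only: pair_brackets.simps list.map append.simps list.inject simp_thms br(2) vw)
        (simp add: central)
    with iso_L_6_22[OF span'] show ?thesis by blast
  qed
  obtain x u v w where t: "pencil_basis x u v w"
    using obtain_pencil_basis[OF dims] .
  then have t': "span {x, u, v, w, \<langle>x, u\<rangle>, \<langle>x, v\<rangle>} = UNIV" "D 1 = span {\<langle>x, u\<rangle>, \<langle>x, v\<rangle>}" "\<langle>x, w\<rangle> = 0" "\<langle>u, v\<rangle> = 0"
    unfolding pencil_basis_def by blast+
  have "\<langle>u, w\<rangle> \<in> span {\<langle>x, u\<rangle>, \<langle>x, v\<rangle>}" "\<langle>v, w\<rangle> \<in> span {\<langle>x, u\<rangle>, \<langle>x, v\<rangle>}"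
    using t'(2) bracket_mem_D_1 by blast+
  then obtain a b c d where abcd: "\<langle>u, w\<rangle> = a \<cdot> \<langle>x, u\<rangle> + b \<cdot> \<langle>x, v\<rangle>" "\<langle>v, w\<rangle> = c \<cdot> \<langle>x, u\<rangle> + d \<cdot> \<langle>x, v\<rangle>"
    using mem_span_pair by metis
  consider "c \<noteq> 0" | "b \<noteq> 0" | "b = 0" "c = 0" "a \<noteq> d" | "b = 0" "c = 0" "a = d" by blast
  then show ?thesis
  proof cases
    case 1
    then show ?thesis using main[OF t abcd] by blast
  next
    case 2
    have "pencil_basis x v u w"
      using t' bracket_commute[of v u] unfolding pencil_basis_def
      by (simp add: insert_commute)
    moreover have "\<langle>v, w\<rangle> = d \<cdot> \<langle>x, v\<rangle> + c \<cdot> \<langle>x, u\<rangle>" "\<langle>u, w\<rangle> = b \<cdot> \<langle>x, v\<rangle> + a \<cdot> \<langle>x, u\<rangle>"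
      using abcd by (simp_all add: add.commute)
    ultimately show ?thesis using main 2 by blast
  next
    case 3
    have "pencil_basis x u (v + u) w"
    proof -
      have "span {x, v, u, w, \<langle>x, v\<rangle>, \<langle>x, u\<rangle>} = UNIV" using t'(1) by (simp add: insert_commute)
      then have "span {x, v + u, u, w, \<langle>x, v\<rangle> + \<langle>x, u\<rangle>, \<langle>x, u\<rangle>} = UNIV"
        by (rule span_triangular_change[of x v u w "\<langle>x, v\<rangle>" "\<langle>x, u\<rangle>" 1 1 1 1 1 1])
          (simp_all add: span_zero span_base)
      moreover have "span {\<langle>x, v\<rangle> + \<langle>x, u\<rangle>, \<langle>x, u\<rangle>} = span {\<langle>x, v\<rangle>, \<langle>x, u\<rangle>}"
        by (rule span_insert_cong[of 1]) (simp_all add: span_base)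
      ultimately show ?thesis
        using t'(2-4) unfolding pencil_basis_def by (simp add: insert_commute)
    qed
    moreover have "\<langle>u, w\<rangle> = a \<cdot> \<langle>x, u\<rangle> + 0 \<cdot> \<langle>x, v + u\<rangle>"
      "\<langle>v + u, w\<rangle> = (a - d) \<cdot> \<langle>x, u\<rangle> + d \<cdot> \<langle>x, v + u\<rangle>"
      using 3 by (simp_all add: abcd scale_right_distrib scale_left_diff_distrib)
    ultimately show ?thesis using main 3 by (metis right_minus_eq)
  next
    case 4
    have central: "\<langle>y, \<langle>x, z\<rangle>\<rangle> = 0" "\<langle>\<langle>x, z\<rangle>, y\<rangle> = 0" for y z
      by (simp_all add: zero bracket_mem)
    \<comment> \<open>For a scalar operator \<open>w + a x\<close> is central and spans the summand
      \<open>I\<close>.\<close>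
    have span': "span {x, u, v, \<langle>x, u\<rangle>, \<langle>x, v\<rangle>, w + a \<cdot> x} = UNIV"
    proof -
      have "span {w, x, u, v, \<langle>x, u\<rangle>, \<langle>x, v\<rangle>} = UNIV" using t'(1) by (simp add: insert_commute)
      then have "span {w + a \<cdot> x, x, u, v, \<langle>x, u\<rangle>, \<langle>x, v\<rangle>} = UNIV"
        by (rule span_triangular_change[of w x u v _ _ 1 1 1 1 1 1])
          (simp_all add: span_zero span_scale span_base)
      then show ?thesis by (simp add: insert_commute)
    qed
    have "L \<cong>\<^sub>L L_6_8"
      by (rule iso_L_6_8[OF span'])
        (simp add: t'(3,4) abcd 4 central bracket_commute[of u x] bracket_commute[of v x])
    then show ?thesis ..
  qed
qed

text \<open>An element \<open>y\<close> of \<open>D 1\<close> outside \<open>D 2\<close> gives a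
  functional \<open>v \<mapsto> [v, y]\<close> into the line \<open>D 2\<close>; \<open>x\<close> is
  chosen outside its kernel and the other generators inside. The brackets in the kernel form an
  alternating form on \<open>p\<close>, \<open>q1\<close>, \<open>r1\<close> with values in
  \<open>D 2\<close>. It is zero (3), or has rank 2 with its radical inside the plane of
  \<open>q1\<close>, \<open>r1\<close> (5) or transversal to that plane (10).\<close>

lemma type_4_1_1:
  assumes dims: "dim (D 1) = 2" "dim (D 2) = 1"
  shows "L \<cong>\<^sub>L L_6_3 \<or> L \<cong>\<^sub>L L_6_5 \<or> L \<cong>\<^sub>L L_6_10"
proof -
  have D3: "D 3 = {0}"
    using lower_central_Suc_eq_0[of 2] dims by simp
  note zero = bracket_mem_D_3[unfolded D3 singleton_iff]
  obtain B where B: "finite B" "card B = 4" "span (B \<union> D 1) = UNIV"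
    using obtain_complement_set[of "D 1" 4] dims dim_UNIV_6 by auto
  obtain y where y: "y \<in> D 1" "y \<notin> D 2"
    using dims lower_central_antimono[of 1 2] by (metis nat_neq_iff one_less_numeral_iff semiring_norm(76) subsetI subset_antisym one_le_numeral)
  have D1: "D 1 = span ({y} \<union> D 2)"
    using y dims by (intro D_eq_span_insert) simp_all
  have "\<exists>x\<in>B. \<langle>x, y\<rangle> \<noteq> 0"
  proof (rule ccontr)
    assume "\<not> ?thesis"
    then have "{\<langle>a, b\<rangle> | a b. a \<in> B \<and> b \<in> {y}} \<union> D 3 \<subseteq> {0}"
      using D3 by auto
    moreover have "D 2 = span ({\<langle>a, b\<rangle> | a b. a \<in> B \<and> b \<in> {y}} \<union> D 3)"
      by (rule D_eq_span[OF B(3) D1]) simp_all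
    ultimately have "D 2 \<subseteq> {0}"
      using span_minimal[of _ "{0}"] by simp
    with dims show False using dim_subset[of "D 2" "{0}"] by simp
  qed
  then obtain x where x: "x \<in> B" "\<langle>x, y\<rangle> \<noteq> 0" by blast
  define z where "z = \<langle>x, y\<rangle>"
  have z: "z \<in> D 2" "z \<noteq> 0"
    using x y by (simp_all add: z_def bracket_mem)
  have D2: "D 2 = span {z}"
    using D_eq_span_insert[of z 2 3] z dims by (simp add: D3 insert_commute)
  have "card (B - {x}) = 3" using x B by simp
  then obtain p q r where "B - {x} = {p, q, r}"
    by (auto simp: card_3_iff)
  then have B': "B = {x, p, q, r}" using x by blast
  have shift: "\<exists>k. \<langle>v + k \<cdot> x, y\<rangle> = 0" for v
  proof -
    have "\<langle>v, y\<rangle> \<in> D 2" using y by (simp add: bracket_mem)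
    then obtain k where "\<langle>v, y\<rangle> = k \<cdot> z" unfolding D2 span_singleton by blast
    then show ?thesis by (intro exI[of _ "- k"]) (simp add: z_def)
  qed
  obtain k1 k2 k3 where k: "\<langle>p + k1 \<cdot> x, y\<rangle> = 0" "\<langle>q + k2 \<cdot> x, y\<rangle> = 0" "\<langle>r + k3 \<cdot> x, y\<rangle> = 0"
    using shift by metis
  define p1 where "p1 = p + k1 \<cdot> x"
  define q1 where "q1 = q + k2 \<cdot> x"
  define r1 where "r1 = r + k3 \<cdot> x"
  have ky: "\<langle>p1, y\<rangle> = 0" "\<langle>q1, y\<rangle> = 0" "\<langle>r1, y\<rangle> = 0"
    using k by (simp_all only: p1_def q1_def r1_def)
  have span1: "span ({x, p1, q1, r1} \<union> D 1) = UNIV"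
  proof (rule span_Un_change[OF B(3)])
    let ?S = "span ({x, p1, q1, r1} \<union> D 1)"
    have "x \<in> ?S" by (simp add: span_base)
    moreover have "p1 - k1 \<cdot> x \<in> ?S" "q1 - k2 \<cdot> x \<in> ?S" "r1 - k3 \<cdot> x \<in> ?S"
      by (intro span_diff span_scale span_base; simp)+
    ultimately show "B \<subseteq> ?S"
      unfolding B' by (simp add: p1_def q1_def r1_def)
  qed
  have central: "\<langle>v, w\<rangle> = 0" "\<langle>w, v\<rangle> = 0" if "w \<in> D 2" for v w
    using that by (simp_all add: zero)
  \<comment> \<open>Since \<open>D 2\<close> is central and \<open>y\<close> spans
    \<open>D 1\<close> modulo \<open>D 2\<close>, commuting with \<open>y\<close> means commuting
    with all of \<open>D 1\<close>.\<close>
  have kills: "\<langle>v, w\<rangle> = 0" "\<langle>w, v\<rangle> = 0" if v: "\<langle>v, y\<rangle> = 0" and "w \<in> D 1" for v w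
  proof -
    obtain c where "w - c \<cdot> y \<in> D 2"
      using \<open>w \<in> D 1\<close> D1 mem_span_insertE[of w y "D 2"] subspace_lower_central by auto
    then have "\<langle>v, w - c \<cdot> y\<rangle> = 0" by (rule central)
    then show "\<langle>v, w\<rangle> = 0" by (simp add: v)
    then show "\<langle>w, v\<rangle> = 0" using bracket_commute[of w v] by simp
  qed
  \<comment> \<open>The Jacobi identity forces the bracket modulo \<open>D 2\<close> to vanish on the annihilator of \<open>y\<close>.\<close>
  have inner: "\<langle>u, v\<rangle> \<in> D 2" if uv: "\<langle>u, y\<rangle> = 0" "\<langle>v, y\<rangle> = 0" for u v
  proof -
    have "\<langle>x, \<langle>u, v\<rangle>\<rangle> = \<langle>\<langle>x, u\<rangle>, v\<rangle> + \<langle>u, \<langle>x, v\<rangle>\<rangle>"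
      by (simp add: jacobi_left)
    also have "\<dots> = 0"
      using kills uv by (simp add: bracket_mem)
    finally have "\<langle>x, \<langle>u, v\<rangle>\<rangle> = 0" .
    obtain c where c: "\<langle>u, v\<rangle> - c \<cdot> y \<in> D 2"
      using bracket_mem_D_1[of u v] D1 mem_span_insertE[of _ y "D 2"] subspace_lower_central by auto
    then have "\<langle>x, \<langle>u, v\<rangle> - c \<cdot> y\<rangle> = 0" by (rule central)
    with \<open>\<langle>x, \<langle>u, v\<rangle>\<rangle> = 0\<close> x(2) have "c = 0" by simp
    with c show ?thesis by simp
  qed
  have main: ?thesis
    if sp: "span ({x, p, q, r} \<union> D 1) = UNIV" and k: "\<langle>p, y\<rangle> = 0" "\<langle>q, y\<rangle> = 0" "\<langle>r, y\<rangle> = 0"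
      and xp: "\<langle>x, p\<rangle> \<notin> D 2" for p q r
  proof -
    define x3 where "x3 = \<langle>x, p\<rangle>"
    define x6 where "x6 = \<langle>x, x3\<rangle>"
    have mem: "x3 \<in> D 1" "x6 \<in> D 2" by (simp_all add: x3_def x6_def bracket_mem)
    have D1': "D 1 = span ({x3} \<union> D 2)"
      using mem xp dims by (intro D_eq_span_insert) (simp_all add: x3_def)
    have x6: "x6 \<noteq> 0"
    proof
      assume "x6 = 0"
      obtain c where "y - c \<cdot> x3 \<in> D 2"
        using y(1) D1' mem_span_insertE[of y x3 "D 2"] subspace_lower_central by auto
      then have "\<langle>x, y - c \<cdot> x3\<rangle> = 0" by (rule central)
      with x(2) \<open>x6 = 0\<close> show False by (simp add: x6_def)
    qed
    have D2': "D 2 = span {x6}"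
      using D_eq_span_insert[of x6 2 3] x6 mem dims by (simp add: D3 insert_commute)
    have coords: "\<exists>s t. \<langle>x, v\<rangle> = s \<cdot> x3 + t \<cdot> x6" for v
    proof -
      have "\<langle>x, v\<rangle> \<in> span ({x3} \<union> span {x6})"
        using bracket_mem_D_1 D1' D2' by metis
      then have "\<langle>x, v\<rangle> \<in> span {x3, x6}" unfolding span_Un_span_right by (simp add: insert_commute)
      then show ?thesis by (rule mem_span_pair) blast
    qed
    obtain s t s' t' where st: "\<langle>x, q\<rangle> = s \<cdot> x3 + t \<cdot> x6" "\<langle>x, r\<rangle> = s' \<cdot> x3 + t' \<cdot> x6"
      using coords by metis
    define q1 where "q1 = q - (s \<cdot> p + t \<cdot> x3)"
    define r1 where "r1 = r - (s' \<cdot> p + t' \<cdot> x3)"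
    have px3: "\<langle>p, x3\<rangle> = 0" "\<langle>q, x3\<rangle> = 0" "\<langle>r, x3\<rangle> = 0" "\<langle>x3, q\<rangle> = 0" "\<langle>x3, r\<rangle> = 0" "\<langle>x3, p\<rangle> = 0"
      using kills k mem by simp_all
    have x3y: "\<langle>x3, y\<rangle> = 0" using mem y by (simp add: zero)
    have "\<langle>q1, y\<rangle> = 0" "\<langle>r1, y\<rangle> = 0"
      by (simp_all add: q1_def r1_def k x3y)
    then have "\<langle>p, q1\<rangle> \<in> D 2" "\<langle>p, r1\<rangle> \<in> D 2" "\<langle>q1, r1\<rangle> \<in> D 2"
      using inner k by simp_all
    then obtain a b c where abc: "\<langle>p, q1\<rangle> = a \<cdot> x6" "\<langle>p, r1\<rangle> = b \<cdot> x6" "\<langle>q1, r1\<rangle> = c \<cdot> x6"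
      unfolding D2' span_singleton by blast
    have xq: "\<langle>x, q1\<rangle> = 0" "\<langle>x, r1\<rangle> = 0"
      by (simp_all add: q1_def r1_def st flip: x3_def x6_def)
    have br: "\<langle>x, p\<rangle> = x3" "\<langle>x, x3\<rangle> = x6" "\<langle>p, x3\<rangle> = 0" "\<langle>x3, p\<rangle> = 0"
      using px3 by (simp_all flip: x3_def x6_def)
    have x3q: "\<langle>x3, q1\<rangle> = 0" "\<langle>x3, r1\<rangle> = 0" "\<langle>q1, x3\<rangle> = 0" "\<langle>r1, x3\<rangle> = 0"
      by (simp_all add: q1_def r1_def px3)
    have cent: "\<langle>v, x6\<rangle> = 0" "\<langle>x6, v\<rangle> = 0" for v
      using central mem by simp_all
    have comm: "\<langle>q1, p\<rangle> = - (a \<cdot> x6)" "\<langle>r1, p\<rangle> = - (b \<cdot> x6)" "\<langle>r1, q1\<rangle> = - (c \<cdot> x6)"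
      using abc bracket_commute[of q1 p] bracket_commute[of r1 p] bracket_commute[of r1 q1] by simp_all
    note br = br x3q cent xq abc comm
    have "UNIV = span ({x, p, q, r} \<union> span ({x3} \<union> span {x6}))"
      using sp D1' D2' by metis
    then have span0: "span {q, r, x, p, x3, x6} = UNIV"
      unfolding span_Un_span_right by (simp add: insert_commute)
    have span: "span {q1, r1, x, p, x3, x6} = UNIV"
    proof (rule span_triangular_change[OF span0, of 1 1 1 1 1 1])
      have "- (s \<cdot> p + t \<cdot> x3) \<in> span {r, x, p, x3, x6}" "- (s' \<cdot> p + t' \<cdot> x3) \<in> span {x, p, x3, x6}"
        by (intro span_neg span_add span_scale span_base; simp)+
      then show "q1 - 1 \<cdot> q \<in> span {r, x, p, x3, x6}" "r1 - 1 \<cdot> r \<in> span {x, p, x3, x6}"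
        by (simp_all add: q1_def r1_def)
    qed (simp_all add: span_zero)
    \<comment> \<open>The vector \<open>r - (b / a) q\<close> spans the radical of the form and is
      central.\<close>
    have five: "L \<cong>\<^sub>L L_6_5" if sp: "span {x, p, x3, q, r, x6} = UNIV" and q: "\<langle>p, q\<rangle> = a \<cdot> x6" "\<langle>p, r\<rangle> = b \<cdot> x6" "a \<noteq> 0"
      "\<langle>q, r\<rangle> = 0" "\<langle>x, q\<rangle> = 0" "\<langle>x, r\<rangle> = 0" "\<langle>x3, q\<rangle> = 0" "\<langle>x3, r\<rangle> = 0" for q r a b
    proof -
      have "span {r, x, p, x3, q, x6} = UNIV" using sp by (simp add: insert_commute)
      then have "span {r + (- b / a) \<cdot> q, x, p, x3, inverse a \<cdot> q, x6} = UNIV"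
        by (rule span_triangular_change[of r x p x3 q x6 1 1 1 1 "inverse a" 1])
          (use q in \<open>simp_all add: span_zero span_neg span_scale span_base\<close>)
      then have span'': "span {x, p, x3, inverse a \<cdot> q, x6, r + (- b / a) \<cdot> q} = UNIV"
        by (simp add: insert_commute)
      show ?thesis
        by (rule iso_L_6_5[OF span'']) (use q in \<open>simp add: br\<close>)
    qed
    consider "c \<noteq> 0" | "c = 0" "a \<noteq> 0" | "c = 0" "b \<noteq> 0" | "a = 0" "b = 0" "c = 0" by blast
    then show ?thesis
    proof cases
      case 1
      \<comment> \<open>The projection of \<open>p\<close> along the non-degenerate plane of
        \<open>q1\<close> and \<open>r1\<close>; both commute with \<open>x\<close>, so
        \<open>[x, p] = x3\<close> is kept.\<close>
      let ?p = "p + (- b / c) \<cdot> q1 + (a / c) \<cdot> r1"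
      have "span {p, q1, r1, x, x3, x6} = UNIV" using span by (simp add: insert_commute)
      then have "span {?p, q1, inverse c \<cdot> r1, x, x3, x6} = UNIV"
        by (rule span_triangular_change[of p q1 r1 x x3 x6 1 1 "inverse c" 1 1 1];
            (simp add: 1 span_zero)?; (intro span_add span_diff span_neg span_scale span_base; simp)?)
      then have span': "span {x, ?p, x3, q1, inverse c \<cdot> r1, x6} = UNIV"
        by (simp add: insert_commute)
      have "L \<cong>\<^sub>L L_6_10"
        by (rule iso_L_6_10[OF span']) (use 1 in \<open>simp add: br\<close>)
      then show ?thesis by blast
    next
      case 2
      have "span {x, p, x3, q1, r1, x6} = UNIV" using span by (simp add: insert_commute)
      then show ?thesis using five[of q1 r1 a b] 2 br by simp
    next
      case 3
      have "span {x, p, x3, r1, q1, x6} = UNIV" using span by (simp add: insert_commute)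
      then show ?thesis using five[of r1 q1 b a] 3 br by simp
    next
      case 4
      have "span {x, p, x3, x6, q1, r1} = UNIV" using span by (simp add: insert_commute)
      then have "L \<cong>\<^sub>L L_6_3"
        by (rule iso_L_6_3) (simp add: br 4)
      then show ?thesis ..
    qed
  qed
  \<comment> \<open>If all three brackets lay in \<open>D 2\<close>, so would every bracket of
    generators, and \<open>D 1\<close> would equal \<open>D 2\<close>.\<close>
  have "\<langle>x, p1\<rangle> \<notin> D 2 \<or> \<langle>x, q1\<rangle> \<notin> D 2 \<or> \<langle>x, r1\<rangle> \<notin> D 2"
  proof (rule ccontr)
    assume "\<not> ?thesis"
    then have out: "\<langle>x, b\<rangle> \<in> D 2" if "b \<in> {x, p1, q1, r1}" for b
      using that by auto
    have inn: "\<langle>a, b\<rangle> \<in> D 2" if "a \<in> {p1, q1, r1}" "b \<in> {p1, q1, r1}" for a b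
      using that ky by (intro inner) auto
    have "\<langle>a, b\<rangle> \<in> D 2" if a: "a \<in> {x, p1, q1, r1}" and b: "b \<in> {x, p1, q1, r1}" for a b
    proof -
      consider "a = x" | "b = x" | "a \<in> {p1, q1, r1}" "b \<in> {p1, q1, r1}" using a b by blast
      then show ?thesis
      proof cases
        case 2
        then show ?thesis
          using out[OF a] subspace_neg[OF subspace_lower_central] bracket_commute[of a x] by metis
      qed (use out[OF b] inn in auto)
    qed
    then have "{\<langle>a, b\<rangle> | a b. a \<in> {x, p1, q1, r1} \<and> b \<in> {x, p1, q1, r1}} \<union> D 2 \<subseteq> D 2" by blast
    then have "D 1 \<subseteq> D 2"
      by (subst D_1_eq_span[OF span1]) (rule span_minimal[OF _ subspace_lower_central])
    with y show False by blast
  qed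
  moreover have "span ({x, q1, p1, r1} \<union> D 1) = UNIV" "span ({x, r1, p1, q1} \<union> D 1) = UNIV"
    using span1 by (simp_all add: insert_commute)
  ultimately show ?thesis
    using main span1 ky by blast
qed

section \<open>Assembling the cases\<close>

lemma classification:
  assumes two: "(2::'a) \<noteq> 0"
  shows "L \<cong>\<^sub>L L_6_1 \<or> L \<cong>\<^sub>L L_6_2 \<or> L \<cong>\<^sub>L L_6_3 \<or> L \<cong>\<^sub>L L_6_4 \<or> L \<cong>\<^sub>L L_6_5 \<or> L \<cong>\<^sub>L L_6_6 \<or>
    L \<cong>\<^sub>L L_6_7 \<or> L \<cong>\<^sub>L L_6_8 \<or> L \<cong>\<^sub>L L_6_9 \<or> L \<cong>\<^sub>L L_6_10 \<or> L \<cong>\<^sub>L L_6_11 \<or> L \<cong>\<^sub>L L_6_12 \<or>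
    L \<cong>\<^sub>L L_6_13 \<or> L \<cong>\<^sub>L L_6_14 \<or> L \<cong>\<^sub>L L_6_15 \<or> L \<cong>\<^sub>L L_6_16 \<or> L \<cong>\<^sub>L L_6_17 \<or> L \<cong>\<^sub>L L_6_18 \<or>
    (\<exists>\<epsilon>. L \<cong>\<^sub>L L_6_19 \<epsilon>) \<or> L \<cong>\<^sub>L L_6_20 \<or> (\<exists>\<epsilon>. L \<cong>\<^sub>L L_6_21 \<epsilon>) \<or> (\<exists>\<epsilon>. L \<cong>\<^sub>L L_6_22 \<epsilon>) \<or>
    L \<cong>\<^sub>L L_6_23 \<or> (\<exists>\<epsilon>. L \<cong>\<^sub>L L_6_24 \<epsilon>) \<or> L \<cong>\<^sub>L L_6_25 \<or> L \<cong>\<^sub>L L_6_26"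
proof -
  have less: "dim (D m) < dim (D n)" if "dim (D n) \<noteq> 0" "m = Suc n" for m n
    using dim_lower_central_less that by blast
  have less_2: "dim (D 2) < dim (D 1)" if "dim (D 1) \<noteq> 0"
    by (rule less[OF that]) (simp add: numeral_2_eq_2 One_nat_def)
  have less_3: "dim (D 3) < dim (D 2)" if "dim (D 2) \<noteq> 0"
    by (rule less[OF that]) simp
  have d1_less: "dim (D 1) < 6"
    using dim_lower_central_less[of 0] dim_UNIV_6 by (simp add: One_nat_def)
  have "dim (D 1) \<noteq> 5"
  proof
    assume d1: "dim (D 1) = 5"
    with dim_UNIV_6 have "dim UNIV = dim (D 1) + 1" by simp
    then obtain xs where "length xs = 1" "span (set xs \<union> D 1) = UNIV"
      by (rule obtain_complement)
    \<comment> \<open>A single generator is counted twice: its only bracket is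
      \<open>[x, x] = 0\<close>, so \<open>D 1\<close> would equal \<open>D 2\<close>.\<close>
    then obtain x where "span ({x, x} \<union> D 1) = UNIV"
      by (auto simp: length_Suc_conv One_nat_def)
    then have "D 1 = span (D 2)"
      using D_1_two_generators[of x x] by simp
    then have "dim (D 1) = dim (D 2)" by simp
    with less_2 d1 show False by linarith
  qed
  then consider "dim (D 1) = 0" | "dim (D 1) = 1" | "dim (D 1) = 2" | "dim (D 1) = 3" | "dim (D 1) = 4"
    using d1_less by linarith
  then show ?thesis
  proof cases
    case 1
    then show ?thesis using type_6 by simp
  next
    case 2
    then show ?thesis using type_5_1[OF 2] by (elim disjE; simp)
  next
    case 3
    then have "dim (D 2) < 2" using less_2 by linarith
    then consider "dim (D 2) = 0" | "dim (D 2) = 1" by linarith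
    then show ?thesis
    proof cases
      case 1
      show ?thesis using type_4_2[OF two 3 1] by (elim disjE; simp)
    next
      case 2
      show ?thesis using type_4_1_1[OF 3 2] by (elim disjE; simp)
    qed
  next
    case 4
    then have "dim (D 2) < 3" using less_2 by linarith
    then consider "dim (D 2) = 0" | "dim (D 2) = 1" | "dim (D 2) = 2" by linarith
    then show ?thesis
    proof cases
      case 1
      then show ?thesis using type_3_3[OF 4] by simp
    next
      case 2
      show ?thesis using type_3_2_1[OF two 4 2] by (elim disjE; simp)
    next
      case 3
      then have "dim (D 3) < 2" using less_3 by linarith
      then consider "dim (D 3) = 0" | "dim (D 3) = 1" by linarith
      then show ?thesis
      proof cases
        case 1
        show ?thesis using type_3_1_2[OF two 4 3 1] by (elim disjE; simp)
      next
        case 2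
        show ?thesis using type_3_1_1_1[OF two 4 3 2] by (elim disjE; simp)
      qed
    qed
  next
    case 5
    obtain x y where xy: "span ({x, y} \<union> D 1) = UNIV"
      using obtain_two_generators[OF 5] .
    have "dim (D 1) \<le> dim (D 2) + 1"
      using D_1_two_generators[OF xy] dim_span_Un_le_card[of "{\<langle>x, y\<rangle>}" "D 2"] by simp
    then have d2: "dim (D 2) = 3"
      using less_2 5 by linarith
    have "dim (D 2) \<le> dim (D 3) + card {\<langle>x, \<langle>x, y\<rangle>\<rangle>, \<langle>y, \<langle>x, y\<rangle>\<rangle>}"
      using D_2_two_generators[OF xy] dim_span_Un_le_card[of "{\<langle>x, \<langle>x, y\<rangle>\<rangle>, \<langle>y, \<langle>x, y\<rangle>\<rangle>}" "D 3"] by simp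
    \<comment> \<open>The two brackets may coincide, so their number is only bounded. With one
      bracket for the second layer and at most two for the third, \<open>dim (D 3)\<close> is 1 or
      2.\<close>
    also have "card {\<langle>x, \<langle>x, y\<rangle>\<rangle>, \<langle>y, \<langle>x, y\<rangle>\<rangle>} \<le> 2"
      by (simp add: card_insert_if)
    finally have "1 \<le> dim (D 3)" using d2 by simp
    moreover have "dim (D 3) < 3" using less_3 d2 by linarith
    ultimately consider "dim (D 3) = 1" | "dim (D 3) = 2" by linarith
    then show ?thesis
    proof cases
      case 1
      show ?thesis using type_2_1_2_1[OF two 5 1] by simp
    next
      case 2
      show ?thesis using type_2_1_1_1_1[OF two 5 d2 2] by (elim disjE; simp)
    qed
  qed
qed

end

lemma nilpotent_lie_6_classification:
  fixes L :: "('a::field, 'v::ab_group_add) lie"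
  assumes "(2::'a) \<noteq> 0" "nilpotent_lie_of_dim 6 L"
  shows "L \<cong>\<^sub>L L_6_1 \<or> L \<cong>\<^sub>L L_6_2 \<or> L \<cong>\<^sub>L L_6_3 \<or> L \<cong>\<^sub>L L_6_4 \<or> L \<cong>\<^sub>L L_6_5 \<or> L \<cong>\<^sub>L L_6_6 \<or>
    L \<cong>\<^sub>L L_6_7 \<or> L \<cong>\<^sub>L L_6_8 \<or> L \<cong>\<^sub>L L_6_9 \<or> L \<cong>\<^sub>L L_6_10 \<or> L \<cong>\<^sub>L L_6_11 \<or> L \<cong>\<^sub>L L_6_12 \<or>
    L \<cong>\<^sub>L L_6_13 \<or> L \<cong>\<^sub>L L_6_14 \<or> L \<cong>\<^sub>L L_6_15 \<or> L \<cong>\<^sub>L L_6_16 \<or> L \<cong>\<^sub>L L_6_17 \<or> L \<cong>\<^sub>L L_6_18 \<or>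
    (\<exists>\<epsilon>. L \<cong>\<^sub>L L_6_19 \<epsilon>) \<or> L \<cong>\<^sub>L L_6_20 \<or> (\<exists>\<epsilon>. L \<cong>\<^sub>L L_6_21 \<epsilon>) \<or> (\<exists>\<epsilon>. L \<cong>\<^sub>L L_6_22 \<epsilon>) \<or>
    L \<cong>\<^sub>L L_6_23 \<or> (\<exists>\<epsilon>. L \<cong>\<^sub>L L_6_24 \<epsilon>) \<or> L \<cong>\<^sub>L L_6_25 \<or> L \<cong>\<^sub>L L_6_26"
proof -
  interpret lie_algebra L
    using assms(2) by (simp add: nilpotent_lie_of_dim_def)
  obtain B where B: "independent B" "UNIV \<subseteq> span B" "card B = dim UNIV"
    by (rule basis_exists[of UNIV])
  have dim: "dim UNIV = 6" and nil: "nilpotent_lie L"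
    using assms(2) by (simp_all add: nilpotent_lie_of_dim_def)
  interpret finite_dimensional_vector_space "scl L" B
    using B dim by unfold_locales (auto simp: card_ge_0_finite)
  interpret nilpotent_lie_algebra_6 L B
    using dim nil by unfold_locales
  show ?thesis
    by (rule classification[OF assms(1)])
qed

theorem proposition5p4:
  assumes "CHAR('a::field) \<noteq> 2"
  shows
    "(\<forall>L :: ('a, 'v::ab_group_add) lie. nilpotent_lie_of_dim 6 L \<longrightarrow>
          (L \<cong>\<^sub>L L_6_1 \<or>
           L \<cong>\<^sub>L L_6_2 \<or>
           L \<cong>\<^sub>L L_6_3 \<or>
           L \<cong>\<^sub>L L_6_4 \<or>
           L \<cong>\<^sub>L L_6_5 \<or>
           L \<cong>\<^sub>L L_6_6 \<or>
           L \<cong>\<^sub>L L_6_7 \<or>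
           L \<cong>\<^sub>L L_6_8 \<or>
           L \<cong>\<^sub>L L_6_9 \<or>
           L \<cong>\<^sub>L L_6_10 \<or>
           L \<cong>\<^sub>L L_6_11 \<or>
           L \<cong>\<^sub>L L_6_12 \<or>
           L \<cong>\<^sub>L L_6_13 \<or>
           L \<cong>\<^sub>L L_6_14 \<or>
           L \<cong>\<^sub>L L_6_15 \<or>
           L \<cong>\<^sub>L L_6_16 \<or>
           L \<cong>\<^sub>L L_6_17 \<or>
           L \<cong>\<^sub>L L_6_18 \<or>
           (\<exists>\<epsilon>. L \<cong>\<^sub>L L_6_19 \<epsilon>) \<or>
           L \<cong>\<^sub>L L_6_20 \<or>
           (\<exists>\<epsilon>. L \<cong>\<^sub>L L_6_21 \<epsilon>) \<or>
           (\<exists>\<epsilon>. L \<cong>\<^sub>L L_6_22 \<epsilon>) \<or>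
           L \<cong>\<^sub>L L_6_23 \<or>
           (\<exists>\<epsilon>. L \<cong>\<^sub>L L_6_24 \<epsilon>) \<or>
           L \<cong>\<^sub>L L_6_25 \<or>
           L \<cong>\<^sub>L L_6_26)) \<and>
     nilpotent_lie_of_dim 6 (L_6_1 :: ('a, _) lie) \<and>
     nilpotent_lie_of_dim 6 (L_6_2 :: ('a, _) lie) \<and>
     nilpotent_lie_of_dim 6 (L_6_3 :: ('a, _) lie) \<and>
     nilpotent_lie_of_dim 6 (L_6_4 :: ('a, _) lie) \<and>
     nilpotent_lie_of_dim 6 (L_6_5 :: ('a, _) lie) \<and>
     nilpotent_lie_of_dim 6 (L_6_6 :: ('a, _) lie) \<and>
     nilpotent_lie_of_dim 6 (L_6_7 :: ('a, _) lie) \<and>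
     nilpotent_lie_of_dim 6 (L_6_8 :: ('a, _) lie) \<and>
     nilpotent_lie_of_dim 6 (L_6_9 :: ('a, _) lie) \<and>
     nilpotent_lie_of_dim 6 (L_6_10 :: ('a, _) lie) \<and>
     nilpotent_lie_of_dim 6 (L_6_11 :: ('a, _) lie) \<and>
     nilpotent_lie_of_dim 6 (L_6_12 :: ('a, _) lie) \<and>
     nilpotent_lie_of_dim 6 (L_6_13 :: ('a, _) lie) \<and>
     nilpotent_lie_of_dim 6 (L_6_14 :: ('a, _) lie) \<and>
     nilpotent_lie_of_dim 6 (L_6_15 :: ('a, _) lie) \<and>
     nilpotent_lie_of_dim 6 (L_6_16 :: ('a, _) lie) \<and>
     nilpotent_lie_of_dim 6 (L_6_17 :: ('a, _) lie) \<and>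
     nilpotent_lie_of_dim 6 (L_6_18 :: ('a, _) lie) \<and>
     (\<forall>\<epsilon>::'a. nilpotent_lie_of_dim 6 (L_6_19 \<epsilon>)) \<and>
     nilpotent_lie_of_dim 6 (L_6_20 :: ('a, _) lie) \<and>
     (\<forall>\<epsilon>::'a. nilpotent_lie_of_dim 6 (L_6_21 \<epsilon>)) \<and>
     (\<forall>\<epsilon>::'a. nilpotent_lie_of_dim 6 (L_6_22 \<epsilon>)) \<and>
     nilpotent_lie_of_dim 6 (L_6_23 :: ('a, _) lie) \<and>
     (\<forall>\<epsilon>::'a. nilpotent_lie_of_dim 6 (L_6_24 \<epsilon>)) \<and>
     nilpotent_lie_of_dim 6 (L_6_25 :: ('a, _) lie) \<and>
     nilpotent_lie_of_dim 6 (L_6_26 :: ('a, _) lie) \<and>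
     CB_algebra (L_6_1 :: ('a, _) lie) \<and>
     CB_algebra (L_6_2 :: ('a, _) lie) \<and>
     CB_algebra (L_6_4 :: ('a, _) lie) \<and>
     CB_algebra (L_6_8 :: ('a, _) lie) \<and>
     (\<forall>\<epsilon>::'a. CB_algebra (L_6_22 \<epsilon>)) \<and>
     CB_algebra (L_6_26 :: ('a, _) lie) \<and>
     \<not> CB_algebra (L_6_3 :: ('a, _) lie) \<and>
     \<not> CB_algebra (L_6_5 :: ('a, _) lie) \<and>
     \<not> CB_algebra (L_6_6 :: ('a, _) lie) \<and>
     \<not> CB_algebra (L_6_7 :: ('a, _) lie) \<and>
     \<not> CB_algebra (L_6_9 :: ('a, _) lie) \<and>
     \<not> CB_algebra (L_6_10 :: ('a, _) lie) \<and>
     \<not> CB_algebra (L_6_11 :: ('a, _) lie) \<and>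
     \<not> CB_algebra (L_6_12 :: ('a, _) lie) \<and>
     \<not> CB_algebra (L_6_13 :: ('a, _) lie) \<and>
     \<not> CB_algebra (L_6_14 :: ('a, _) lie) \<and>
     \<not> CB_algebra (L_6_15 :: ('a, _) lie) \<and>
     \<not> CB_algebra (L_6_16 :: ('a, _) lie) \<and>
     \<not> CB_algebra (L_6_17 :: ('a, _) lie) \<and>
     \<not> CB_algebra (L_6_18 :: ('a, _) lie) \<and>
     (\<forall>\<epsilon>::'a. \<not> CB_algebra (L_6_19 \<epsilon>)) \<and>
     \<not> CB_algebra (L_6_20 :: ('a, _) lie) \<and>
     (\<forall>\<epsilon>::'a. \<not> CB_algebra (L_6_21 \<epsilon>)) \<and>
     \<not> CB_algebra (L_6_23 :: ('a, _) lie) \<and>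
     (\<forall>\<epsilon>::'a. \<not> CB_algebra (L_6_24 \<epsilon>)) \<and>
     \<not> CB_algebra (L_6_25 :: ('a, _) lie)"
proof -
  have two: "(2 :: 'a) \<noteq> 0"
  proof
    assume "(2 :: 'a) = 0"
    then have "CHAR('a) dvd 2"
      using of_nat_eq_0_iff_char_dvd[of 2, where ?'a = 'a] by simp
    then have "CHAR('a) = 1 \<or> CHAR('a) = 2"
      using two_is_prime_nat prime_nat_iff by blast
    with assms CHAR_not_1 show False by auto
  qed
  show ?thesis
    by (intro conjI allI impI nilpotent_lie_6_classification[OF two] nilpotent_lie_of_dim_sum_models
        nilpotent_lie_of_dim_models CB_algebra_models not_CB_algebra_sum_models not_CB_algebra_models)
qed

end
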